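(* Let $B$ be a paracompact Hausdorff topological space, let $\mathcal{U}=\{U_0,\ldots,U_n\}$ be an open cover of $B$, and let $\{\varphi_r\}_{r=0}^n$ be a partition of unity dominated by $\mathcal{U}$. For $\tau\in Z^1(\mathcal{N}(\mathcal{U});\mathbb{Z}/2)$ and $\eta\in Z^2(\mathcal{N}(\mathcal{U});\mathbb{Z})$, the maps $$f_\tau:B\to\mathbb{R}\mathbf{P}^n,\qquad f_\tau(b)=\left[(-1)^{\tau_{0j}}\sqrt{\varphi_0(b)}:\cdots:(-1)^{\tau_{nj}}\sqrt{\varphi_n(b)}\right],\quad b\in U_j,$$ $$f_\eta:B\to\mathbb{C}\mathbf{P}^n,\qquad f_\eta(b)=\left[e^{2\pi i\sum_t\varphi_t(b)\eta_{0jt}}\sqrt{\varphi_0(b)}:\cdots:e^{2\pi i\sum_t\varphi_t(b)\eta_{njt}}\sqrt{\varphi_n(b)}\right],\quad b\in U_j,$$ are well-defined, and the assignments $$\mathbf{w}_1^{\mathcal{U}}:H^1(\mathcal{N}(\mathcal{U});\mathbb{Z}/2)\to[B,\mathbb{R}\mathbf{P}^\infty],\ [\tau]\mapsto[f_\tau],\qquad \mathbf{c}_1^{\mathcal{U}}:H^2(\mathcal{N}(\mathcal{U});\mathbb{Z})\to[B,\mathbb{C}\mathbf{P}^\infty],\ [\eta]\mapsto[f_\eta]$$ are functions (well-defined on cohomology classes) which are natural with respect to refinements of $\mathcal{U}$. Moreover: (1) if each $U_r$ is connected, then $\mathbf{w}_1^{\mathcal{U}}$ is injective; (2) if in addition each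 $U_r$ is locally path-connected and simply connected, and each $U_r\cap U_t$ is either empty or connected, then $\mathbf{c}_1^{\mathcal{U}}$ is injective.
   Context: A partition of unity dominated by $\mathcal{U}$ is a collection of continuous functions $\varphi_r:B\to\mathbb{R}_{\ge0}$, with $\varphi_r$ vanishing outside $U_r$ and $\sum_r\varphi_r=1$. The nerve $\mathcal{N}(\mathcal{U})$ is the abstract simplicial complex whose simplices are the finite nonempty sets of indices $\{r_0,\ldots,r_k\}$ with $U_{r_0}\cap\cdots\cap U_{r_k}\ne\emptyset$. For an abelian group $G$, $C^k(\mathcal{N}(\mathcal{U});G)$ is the group of $G$-valued functions on $k$-simplices, with coboundary $\delta^k(\phi)(\{s_0<\cdots<s_{k+1}\})=\sum_j(-1)^j\phi(\{s_0,\ldots,s_{k+1}\}\smallsetminus\{s_j\})$; $Z^k$ is the group of cocycles and $H^k$ the cohomology. Write $\tau_{rt}=\tau(\{r,t\})$ with $\tau_{rr}=0$. Write $\eta_{rst}=\eta(\{r,s,t\})$ for $r<s<t$, extended to all index triples alternatingly (sign of the permutation sorting the indices, $0$ if two indices coincide). Terms of the formulas in which $\varphi_r(b)=0$ or $\varphi_t(b)=0$ are read as $0$ (then the corresponding $\tau_{rj}$ or $\eta_{rjt}$ may be undefined). $[B,Y]$ is the set of homotopy classes of continuous maps $B\to Y$, and maps to $\mathbb{F}\mathbf{P}^n$ are regarded as maps to $\mathbb{F}\mathbf{P}^\infty$ via the standard inclusion. Natural with respect to refinements means: if $\mathcal{V}=\{V_i\}$ is a finite open cover of $B$ and $\rho$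 is a function on indices with $V_i\subset U_{\rho(i)}$ for all $i$, and $\rho^*$ is the homomorphism in cohomology induced by the simplicial map $\rho:\mathcal{N}(\mathcal{V})\to\mathcal{N}(\mathcal{U})$, then $\mathbf{w}_1^{\mathcal{V}}\circ\rho^*=\mathbf{w}_1^{\mathcal{U}}$ and $\mathbf{c}_1^{\mathcal{V}}\circ\rho^*=\mathbf{c}_1^{\mathcal{U}}$. Simply connected means path-connected with trivial fundamental group; locally path-connected means that every point has a neighbourhood basis of path-connected open sets. *)

theory Defs
  imports
    "HOL-Analysis.Analysis"
    "HOL-Algebra.Coset"
    "HOL-Combinatorics.Permutations"
    "HOL-Library.Z2"
begin

section \<open>Topological notions\<close>

definition paracompact_space :: "'a topology \<Rightarrow> bool" where
  "paracompact_space X \<longleftrightarrow>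
     (\<forall>\<C>. (\<forall>C\<in>\<C>. openin X C) \<and> \<Union>\<C> = topspace X \<longrightarrow>
        (\<exists>\<D>. (\<forall>D\<in>\<D>. openin X D) \<and> \<Union>\<D> = topspace X \<and>
             (\<forall>D\<in>\<D>. \<exists>C\<in>\<C>. D \<subseteq> C) \<and> locally_finite_in X \<D>))"

definition simply_connected_space :: "'a topology \<Rightarrow> bool" where
  "simply_connected_space X \<longleftrightarrow>
     path_connected_space X \<and>
     (\<forall>g. pathin X g \<and> g 1 = g 0 \<longrightarrow>
        homotopic_with (\<lambda>h. h 0 = g 0 \<and> h 1 = g 0) (top_of_set {0..1::real}) X g (\<lambda>_. g 0))"

definition homotopy_rel :: "'a topology \<Rightarrow> 'b topology \<Rightarrow> (('a \<Rightarrow> 'b) \<times> ('a \<Rightarrow> 'b)) set" where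
  "homotopy_rel X Y = {(f, g). homotopic_with (\<lambda>_. True) X Y f g}"

definition homotopy_class :: "'a topology \<Rightarrow> 'b topology \<Rightarrow> ('a \<Rightarrow> 'b) \<Rightarrow> ('a \<Rightarrow> 'b) set" where
  "homotopy_class X Y f = homotopy_rel X Y `` {f}"

text \<open>The set \<open>[X, Y]\<close>. Functions that agree on the underlying set of \<open>X\<close> are homotopic,
  so their values outside it play no role.\<close>

definition homotopy_classes :: "'a topology \<Rightarrow> 'b topology \<Rightarrow> ('a \<Rightarrow> 'b) set set" where
  "homotopy_classes X Y = {f. continuous_map X Y f} // homotopy_rel X Y"

definition quotient_topology :: "'a topology \<Rightarrow> ('a \<Rightarrow> 'b) \<Rightarrow> 'b topology" where
  "quotient_topology X q =
     topology (\<lambda>V. V \<subseteq> q ` topspace X \<and> openin X {x \<in> topspace X. q x \<in> V})"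

lemma openin_quotient_topology:
  "openin (quotient_topology X q) V \<longleftrightarrow>
     V \<subseteq> q ` topspace X \<and> openin X {x \<in> topspace X. q x \<in> V}"
proof -
  have "istopology (\<lambda>V. V \<subseteq> q ` topspace X \<and> openin X {x \<in> topspace X. q x \<in> V})"
    unfolding istopology_def
  proof (intro conjI allI impI)
    fix S T
    assume S: "S \<subseteq> q ` topspace X \<and> openin X {x \<in> topspace X. q x \<in> S}"
      and T: "T \<subseteq> q ` topspace X \<and> openin X {x \<in> topspace X. q x \<in> T}"
    show "S \<inter> T \<subseteq> q ` topspace X" using S by blast
    have "{x \<in> topspace X. q x \<in> S \<inter> T} =
        {x \<in> topspace X. q x \<in> S} \<inter> {x \<in> topspace X. q x \<in> T}" by blast
    then show "openin X {x \<in> topspace X. q x \<in> S \<inter> T}" using S T by auto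
  next
    fix \<K>
    assume K: "\<forall>K\<in>\<K>. K \<subseteq> q ` topspace X \<and> openin X {x \<in> topspace X. q x \<in> K}"
    then show "\<Union>\<K> \<subseteq> q ` topspace X" by blast
    have "{x \<in> topspace X. q x \<in> \<Union>\<K>} = (\<Union>K\<in>\<K>. {x \<in> topspace X. q x \<in> K})" by blast
    then show "openin X {x \<in> topspace X. q x \<in> \<Union>\<K>}" using K by auto
  qed
  then show ?thesis
    by (simp add: quotient_topology_def)
qed

lemma topspace_quotient_topology [simp]:
  "topspace (quotient_topology X q) = q ` topspace X"
proof
  show "topspace (quotient_topology X q) \<subseteq> q ` topspace X"
    using openin_quotient_topology[of X q] openin_topspace by blast
  have "{x \<in> topspace X. q x \<in> q ` topspace X} = topspace X" by blast
  then have "openin (quotient_topology X q) (q ` topspace X)"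
    by (simp add: openin_quotient_topology)
  then show "q ` topspace X \<subseteq> topspace (quotient_topology X q)"
    by (rule openin_subset)
qed

lemma quotient_map_quotient_topology: "quotient_map X (quotient_topology X q) q"
  by (auto simp: quotient_map_def openin_quotient_topology)


section \<open>Projective spaces\<close>

text \<open>
  As in \<^const>\<open>Euclidean_space\<close>, the space \<open>F\<^sup>n\<^sup>+\<^sup>1\<close> is realised as the sequences supported
  in \<open>{..n}\<close>. A point of projective space is a line with the origin removed. In this way the
  standard inclusions of \<open>FP\<^sup>n\<close> into \<open>FP\<^sup>m\<close> (for \<open>n \<le> m\<close>) and into \<open>FP\<^sup>\<infinity>\<close>
  are inclusions of sets of points, so a map into \<open>FP\<^sup>n\<close> is literally also a map into
  \<open>FP\<^sup>\<infinity>\<close>.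
\<close>

definition punctured_space :: "nat \<Rightarrow> (nat \<Rightarrow> 'f::real_normed_field) topology" where
  "punctured_space n =
     subtopology (product_topology (\<lambda>_. euclidean) UNIV) {x. (\<forall>i>n. x i = 0) \<and> x \<noteq> (\<lambda>_. 0)}"

definition proj :: "(nat \<Rightarrow> 'f::real_normed_field) \<Rightarrow> (nat \<Rightarrow> 'f) set" where
  "proj x = {(\<lambda>i. c * x i) | c. c \<noteq> 0}"

definition proj_space :: "nat \<Rightarrow> (nat \<Rightarrow> 'f::real_normed_field) set topology" where
  "proj_space n = quotient_topology (punctured_space n) proj"

text \<open>\<open>FP\<^sup>\<infinity>\<close> carries the direct limit (weak) topology of the \<open>FP\<^sup>n\<close>.\<close>

definition proj_space_inf :: "(nat \<Rightarrow> 'f::real_normed_field) set topology" where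
  "proj_space_inf =
     topology (\<lambda>V. V \<subseteq> (\<Union>n. topspace (proj_space n)) \<and>
                   (\<forall>n. openin (proj_space n) (V \<inter> topspace (proj_space n))))"

lemma openin_proj_space_inf:
  "openin proj_space_inf V \<longleftrightarrow>
     V \<subseteq> (\<Union>n. topspace (proj_space n)) \<and>
     (\<forall>n. openin (proj_space n) (V \<inter> topspace (proj_space n)))"
proof -
  have "istopology (\<lambda>V::(nat \<Rightarrow> 'a) set set. V \<subseteq> (\<Union>n. topspace (proj_space n)) \<and>
                   (\<forall>n. openin (proj_space n) (V \<inter> topspace (proj_space n))))"
    unfolding istopology_def
  proof (rule conjI; intro allI impI conjI)
    fix S T :: "(nat \<Rightarrow> 'a) set set" and n
    assume S: "S \<subseteq> (\<Union>n. topspace (proj_space n)) \<and>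
                   (\<forall>n. openin (proj_space n) (S \<inter> topspace (proj_space n)))"
      and T: "T \<subseteq> (\<Union>n. topspace (proj_space n)) \<and>
                   (\<forall>n. openin (proj_space n) (T \<inter> topspace (proj_space n)))"
    then show "S \<inter> T \<subseteq> (\<Union>n. topspace (proj_space n))" by blast
    have "S \<inter> T \<inter> topspace (proj_space n) =
        (S \<inter> topspace (proj_space n)) \<inter> (T \<inter> topspace (proj_space n))" by blast
    then show "openin (proj_space n) (S \<inter> T \<inter> topspace (proj_space n))"
      using S T by (simp add: openin_Int)
  next
    fix \<K> :: "(nat \<Rightarrow> 'a) set set set" and n
    assume K: "\<forall>K\<in>\<K>. K \<subseteq> (\<Union>n. topspace (proj_space n)) \<and>
                   (\<forall>n. openin (proj_space n) (K \<inter> topspace (proj_space n)))"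
    then show "\<Union>\<K> \<subseteq> (\<Union>n. topspace (proj_space n))" by blast
    have "openin (proj_space n) (\<Union>K\<in>\<K>. K \<inter> topspace (proj_space n))"
      using K by blast
    moreover have "\<Union>\<K> \<inter> topspace (proj_space n) = (\<Union>K\<in>\<K>. K \<inter> topspace (proj_space n))"
      by blast
    ultimately show "openin (proj_space n) (\<Union>\<K> \<inter> topspace (proj_space n))"
      by (simp only:)
  qed
  then show ?thesis
    by (simp add: proj_space_inf_def)
qed

abbreviation RP :: "nat \<Rightarrow> (nat \<Rightarrow> real) set topology" where "RP \<equiv> proj_space"
abbreviation CP :: "nat \<Rightarrow> (nat \<Rightarrow> complex) set topology" where "CP \<equiv> proj_space"
abbreviation RP_inf :: "(nat \<Rightarrow> real) set topology" where "RP_inf \<equiv> proj_space_inf"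
abbreviation CP_inf :: "(nat \<Rightarrow> complex) set topology" where "CP_inf \<equiv> proj_space_inf"


section \<open>Cohomology of abstract simplicial complexes with ordered vertices\<close>

definition simplices :: "'v set set \<Rightarrow> nat \<Rightarrow> 'v set set" where
  "simplices K k = {s \<in> K. finite s \<and> card s = Suc k}"

text \<open>A cochain is represented by its extension by zero to all sets of vertices.\<close>

definition cochain_group :: "'v set set \<Rightarrow> nat \<Rightarrow> ('v set \<Rightarrow> 'g::ab_group_add) monoid" where
  "cochain_group K k =
     \<lparr>carrier = {\<phi>. \<forall>s. s \<notin> simplices K k \<longrightarrow> \<phi> s = 0},
      mult = (\<lambda>\<phi> \<psi> s. \<phi> s + \<psi> s), one = (\<lambda>_. 0)\<rparr>"

definition coboundary ::
  "'v::linorder set set \<Rightarrow> nat \<Rightarrow> ('v set \<Rightarrow> 'g::ab_group_add) \<Rightarrow> 'v set \<Rightarrow> 'g" where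
  "coboundary K k \<phi> s =
     (if s \<in> simplices K (Suc k)
      then \<Sum>j\<le>Suc k. (let a = \<phi> (s - {sorted_list_of_set s ! j}) in if even j then a else - a)
      else 0)"

definition cocycles :: "'v::linorder set set \<Rightarrow> nat \<Rightarrow> ('v set \<Rightarrow> 'g::ab_group_add) set" where
  "cocycles K k = kernel (cochain_group K k) (cochain_group K (Suc k)) (coboundary K k)"

definition coboundaries :: "'v::linorder set set \<Rightarrow> nat \<Rightarrow> ('v set \<Rightarrow> 'g::ab_group_add) set" where
  "coboundaries K k =
     (case k of 0 \<Rightarrow> {\<lambda>_. 0} | Suc i \<Rightarrow> coboundary K i ` carrier (cochain_group K i))"

definition cohomology :: "'v::linorder set set \<Rightarrow> nat \<Rightarrow> ('v set \<Rightarrow> 'g::ab_group_add) set monoid" where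
  "cohomology K k = (cochain_group K k)\<lparr>carrier := cocycles K k\<rparr> Mod coboundaries K k"

definition cohomology_class ::
  "'v::linorder set set \<Rightarrow> nat \<Rightarrow> ('v set \<Rightarrow> 'g::ab_group_add) \<Rightarrow> ('v set \<Rightarrow> 'g) set" where
  "cohomology_class K k \<phi> = coboundaries K k #>\<^bsub>cochain_group K k\<^esub> \<phi>"

text \<open>The value \<open>\<phi>\<^bsub>v\<^sub>0...v\<^sub>k\<^esub>\<close> of the alternating extension of a cochain on a list of vertices.\<close>

definition alternating :: "('v::linorder set \<Rightarrow> 'g::ab_group_add) \<Rightarrow> 'v list \<Rightarrow> 'g" where
  "alternating \<phi> vs =
     (if distinct vs then
        if evenperm (THE p. p permutes {..<length vs} \<and> permute_list p vs = sort vs)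
        then \<phi> (set vs) else - \<phi> (set vs)
      else 0)"

text \<open>The maps induced by a simplicial map \<open>\<rho>\<close> from \<open>K\<close> on cochains and on cohomology. As for
  maps out of a quotient in \<^theory>\<open>HOL-Algebra.Coset\<close>, the value on a class is the common value
  on its representatives.\<close>

definition cochain_pullback ::
  "'w::linorder set set \<Rightarrow> nat \<Rightarrow> ('w \<Rightarrow> 'v) \<Rightarrow> ('v::linorder set \<Rightarrow> 'g::ab_group_add) \<Rightarrow> 'w set \<Rightarrow> 'g"
  where
  "cochain_pullback K k \<rho> \<phi> s =
     (if s \<in> simplices K k then alternating \<phi> (map \<rho> (sorted_list_of_set s)) else 0)"

definition cohomology_pullback ::
  "'w::linorder set set \<Rightarrow> nat \<Rightarrow> ('w \<Rightarrow> 'v) \<Rightarrow> ('v::linorder set \<Rightarrow> 'g::ab_group_add) set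
     \<Rightarrow> ('w set \<Rightarrow> 'g) set"
  where
  "cohomology_pullback K k \<rho> c =
     the_elem ((\<lambda>\<phi>. cohomology_class K k (cochain_pullback K k \<rho> \<phi>)) ` c)"


section \<open>Covers, partitions of unity and the classifying maps\<close>

definition open_cover :: "'a topology \<Rightarrow> nat \<Rightarrow> (nat \<Rightarrow> 'a set) \<Rightarrow> bool" where
  "open_cover X n U \<longleftrightarrow> (\<forall>r\<le>n. openin X (U r)) \<and> (\<Union>r\<le>n. U r) = topspace X"

definition partition_dominated_by ::
  "'a topology \<Rightarrow> nat \<Rightarrow> (nat \<Rightarrow> 'a set) \<Rightarrow> (nat \<Rightarrow> 'a \<Rightarrow> real) \<Rightarrow> bool" where
  "partition_dominated_by X n U \<phi> \<longleftrightarrow>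
     (\<forall>r\<le>n. continuous_map X euclideanreal (\<phi> r) \<and>
            (\<forall>b\<in>topspace X. 0 \<le> \<phi> r b \<and> (b \<notin> U r \<longrightarrow> \<phi> r b = 0))) \<and>
     (\<forall>b\<in>topspace X. (\<Sum>r\<le>n. \<phi> r b) = 1)"

definition nerve :: "nat \<Rightarrow> (nat \<Rightarrow> 'a set) \<Rightarrow> nat set set" where
  "nerve n U = {s. s \<noteq> {} \<and> s \<subseteq> {..n} \<and> (\<Inter>r\<in>s. U r) \<noteq> {}}"

text \<open>
  The defining formulas over \<open>U\<^sub>j\<close>. As cochains vanish off the simplices, terms with
  \<open>\<phi>\<^sub>r(b) = 0\<close> or \<open>\<phi>\<^sub>t(b) = 0\<close> contribute \<open>0\<close>; in particular \<open>\<tau>\<^sub>r\<^sub>r = \<tau>({r}) = 0\<close>.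
\<close>

definition f_tau_on ::
  "nat \<Rightarrow> (nat \<Rightarrow> 'a \<Rightarrow> real) \<Rightarrow> (nat set \<Rightarrow> bit) \<Rightarrow> nat \<Rightarrow> 'a \<Rightarrow> (nat \<Rightarrow> real) set" where
  "f_tau_on n \<phi> \<tau> j b =
     proj (\<lambda>r. if r \<le> n then (-1) ^ of_bool (\<tau> {r, j} = 1) * sqrt (\<phi> r b) else 0)"

definition f_eta_on ::
  "nat \<Rightarrow> (nat \<Rightarrow> 'a \<Rightarrow> real) \<Rightarrow> (nat set \<Rightarrow> int) \<Rightarrow> nat \<Rightarrow> 'a \<Rightarrow> (nat \<Rightarrow> complex) set" where
  "f_eta_on n \<phi> \<eta> j b =
     proj (\<lambda>r. if r \<le> n
               then exp (2 * of_real pi * \<i> *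
                         of_real (\<Sum>t\<le>n. \<phi> t b * of_int (alternating \<eta> [r, j, t])))
                    * of_real (sqrt (\<phi> r b))
               else 0)"

text \<open>The maps \<open>f\<^sub>\<tau>\<close> and \<open>f\<^sub>\<eta>\<close>, given by the formula for some \<open>j\<close> with \<open>b \<in> U\<^sub>j\<close>; the theorem
  asserts that the choice of \<open>j\<close> does not matter.\<close>

definition f_tau ::
  "nat \<Rightarrow> (nat \<Rightarrow> 'a set) \<Rightarrow> (nat \<Rightarrow> 'a \<Rightarrow> real) \<Rightarrow> (nat set \<Rightarrow> bit) \<Rightarrow> 'a \<Rightarrow> (nat \<Rightarrow> real) set" where
  "f_tau n U \<phi> \<tau> b = f_tau_on n \<phi> \<tau> (SOME j. j \<le> n \<and> b \<in> U j) b"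

definition f_eta ::
  "nat \<Rightarrow> (nat \<Rightarrow> 'a set) \<Rightarrow> (nat \<Rightarrow> 'a \<Rightarrow> real) \<Rightarrow> (nat set \<Rightarrow> int) \<Rightarrow> 'a \<Rightarrow> (nat \<Rightarrow> complex) set" where
  "f_eta n U \<phi> \<eta> b = f_eta_on n \<phi> \<eta> (SOME j. j \<le> n \<and> b \<in> U j) b"

text \<open>The assignments \<open>[\<tau>] \<mapsto> [f\<^sub>\<tau>]\<close> and \<open>[\<eta>] \<mapsto> [f\<^sub>\<eta>]\<close>: the common value on all representatives
  of a class. That there is one is part of the theorem, in the form of the equations
  \<open>w1 ... [\<tau>] = [f\<^sub>\<tau>]\<close> and \<open>c1 ... [\<eta>] = [f\<^sub>\<eta>]\<close> for all cocycles.\<close>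

definition w1 ::
  "'a topology \<Rightarrow> nat \<Rightarrow> (nat \<Rightarrow> 'a set) \<Rightarrow> (nat \<Rightarrow> 'a \<Rightarrow> real) \<Rightarrow> (nat set \<Rightarrow> bit) set
     \<Rightarrow> ('a \<Rightarrow> (nat \<Rightarrow> real) set) set" where
  "w1 X n U \<phi> c = the_elem ((\<lambda>\<tau>. homotopy_class X RP_inf (f_tau n U \<phi> \<tau>)) ` c)"

definition c1 ::
  "'a topology \<Rightarrow> nat \<Rightarrow> (nat \<Rightarrow> 'a set) \<Rightarrow> (nat \<Rightarrow> 'a \<Rightarrow> real) \<Rightarrow> (nat set \<Rightarrow> int) set
     \<Rightarrow> ('a \<Rightarrow> (nat \<Rightarrow> complex) set) set" where
  "c1 X n U \<phi> c = the_elem ((\<lambda>\<eta>. homotopy_class X CP_inf (f_eta n U \<phi> \<eta>)) ` c)"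

end

theory Submission
  imports Defs
begin

text \<open>
  Over \<open>U\<^sub>j\<close> the maps \<open>f\<^sub>\<tau>\<close> and \<open>f\<^sub>\<eta>\<close> come with homogeneous coordinates whose transition functions are
  \<open>(-1)\<^bsup>\<tau>(i,j)\<^esup>\<close> and \<open>exp (- 2 \<pi> i \<Sum>\<^sub>t \<phi>\<^sub>t \<eta>\<^sub>i\<^sub>j\<^sub>t)\<close>. Two maps whose homogeneous coordinates have the same
  transition functions are homotopic in \<open>FP\<^sup>\<infinity>\<close>, by linear homotopies after a shift of coordinates. A
  coboundary, or a passage to a refinement, only rescales the coordinates over each \<open>U\<^sub>j\<close>.

  For injectivity, the path of lines which a homotopy \<open>f\<^sub>\<tau> \<simeq> f\<^sub>\<tau>\<^sub>'\<close> assigns to a point of \<open>U\<^sub>j\<close> lifts to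
  homogeneous coordinates, and compares the coordinates of the two ends. In the real case the sign of the
  factor is locally constant, hence a \<open>0\<close>-cochain with coboundary \<open>\<tau> - \<tau>'\<close>. In the complex case the homotopy
  classes of lifts joining the two given coordinates form a torsor under the integers, locally constant
  along \<open>U\<^sub>j\<close>, which has a parallel section as \<open>U\<^sub>j\<close> is simply connected. On \<open>U\<^sub>i \<inter> U\<^sub>j\<close> the sections over \<open>U\<^sub>i\<close> and \<open>U\<^sub>j\<close>
  differ, up to an explicit correction, by an integer, and these integers form a \<open>1\<close>-cochain
  with coboundary \<open>\<eta>' - \<eta>\<close>.
\<close>

section \<open>Ordered cochains and alternating extensions\<close>

text \<open>The sums \<open>\<Sum>\<^sub>t \<phi>\<^sub>t \<eta>\<^sub>i\<^sub>j\<^sub>t\<close> are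
  the standard contraction of cochains of continuous real functions by a partition of unity: up to
  sign they form a real 1-cochain whose coboundary is the integral cocycle, so their exponentials
  satisfy the cocycle condition exactly. The same averaging gives the rescaling exponents for
  coboundaries and for refinements.

  A linear homotopy between two systems of coordinates may run through the zero vector; moving one
  system to unoccupied positions excludes this, and \<open>FP^inf\<close> provides the room.

  In the injectivity proofs nothing is lifted over all of [0,1] x U_j. A lift of the homotopy is
  chosen over each point separately, without continuity in the point. It serves only as a reference:
  every local or continuous statement is made for auxiliary lifts over tubes [0,1] x N or over
  cubes, whose factor relative to the reference lift has a constant sign along each path, or a
  continuous logarithm. Since the reference can jump, even a parallel section can only be described
  along paths.\<close>

lemma alternating_eq:
  assumes "distinct vs" "p permutes {..<length vs}" "permute_list p vs = sort vs"
  shows "alternating \<phi> vs = (if evenperm p then \<phi> (set vs) else - \<phi> (set vs))"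
proof -
  \<comment> \<open>Distinct entries make the sorting permutation unique, so the definite
    description in \<open>alternating\<close> can be evaluated at any permutation at hand.\<close>
  have "q = p" if q: "q permutes {..<length vs}" "permute_list q vs = sort vs" for q
  proof
    fix i
    show "q i = p i"
    proof (cases "i < length vs")
      case True
      have "vs ! q i = vs ! p i"
        using permute_list_nth[OF q(1) True] permute_list_nth[OF assms(2) True] q(2) assms(3) by simp
      moreover have "q i < length vs" "p i < length vs"
        using permutes_in_image[OF q(1), of i] permutes_in_image[OF assms(2), of i] True by auto
      ultimately show ?thesis using assms(1) nth_eq_iff_index_eq by blast
    next
      case False
      then show ?thesis using q(1) assms(2) by (simp add: permutes_def)
    qed
  qed
  then have "(THE q. q permutes {..<length vs} \<and> permute_list q vs = sort vs) = p"
    using assms by blast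
  then show ?thesis using assms(1) by (simp add: alternating_def)
qed

lemma alternating_sorted:
  "sorted vs \<Longrightarrow> distinct vs \<Longrightarrow> alternating \<phi> vs = \<phi> (set vs)"
  by (subst alternating_eq[where p = id]) (auto simp: permutes_id sorted_sort_id)

lemma alternating_less2: "i < j \<Longrightarrow> alternating \<phi> [i, j] = \<phi> {i, j}"
  by (simp add: alternating_sorted)

lemma alternating_less3: "i < j \<Longrightarrow> j < k \<Longrightarrow> alternating \<phi> [i, j, k] = \<phi> {i, j, k}"
  by (subst alternating_sorted) auto

lemma alternating_not_distinct: "\<not> distinct vs \<Longrightarrow> alternating \<phi> vs = 0"
  by (simp add: alternating_def)

text \<open>A permutation sorting one list becomes one sorting the other after composition with the
  transposition of the two positions, and this flips the parity. Lists with a repeated entry give 0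
  on both sides.\<close>

lemma alternating_swap:
  "alternating \<phi> (xs @ a # b # ys) = - alternating \<phi> (xs @ b # a # ys)"
proof (cases "distinct (xs @ a # b # ys)")
  case True
  let ?v = "xs @ a # b # ys" and ?w = "xs @ b # a # ys"
  let ?n = "length xs"
  let ?t = "Transposition.transpose ?n (Suc ?n)"
  have d: "distinct ?w" using True by auto
  have len: "length ?w = length ?v" by simp
  have t: "?t permutes {..<length ?w}" by (rule permutes_swap_id) auto
  have vt: "?v = permute_list ?t ?w"
  proof (rule nth_equalityI)
    fix i assume "i < length ?v"
    then show "?v ! i = permute_list ?t ?w ! i"
      by (subst permute_list_nth[OF t]) (auto simp: nth_append nth_Cons Transposition.transpose_def split: nat.splits if_splits)
  qed simp
  obtain p where p: "p permutes {..<length ?v}" "permute_list p ?v = sort ?v"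
    by (rule mset_eq_permutation[of "sort ?v" ?v]) auto
  have "permute_list (?t \<circ> p) ?w = sort ?w"
  proof -
    have "permute_list (?t \<circ> p) ?w = permute_list p (permute_list ?t ?w)"
      by (rule permute_list_compose) (use p(1) in simp)
    also have "\<dots> = sort ?v" using p(2) vt by simp
    also have "\<dots> = sort ?w" by (rule properties_for_sort) simp_all
    finally show ?thesis .
  qed
  moreover have "(?t \<circ> p) permutes {..<length ?w}"
    using p(1) t by (simp add: permutes_compose)
  ultimately have w: "alternating \<phi> ?w = (if evenperm (?t \<circ> p) then \<phi> (set ?w) else - \<phi> (set ?w))"
    using alternating_eq d by blast
  have "permutation p" "permutation ?t"
    using p(1) permutation_permutes by (blast, auto intro: permutation_swap_id)
  then have "evenperm (?t \<circ> p) \<longleftrightarrow> \<not> evenperm p"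
    by (simp add: evenperm_comp evenperm_swap)
  moreover have "set ?w = set ?v" by auto
  ultimately show ?thesis
    using w alternating_eq[OF True p, of \<phi>] by auto
next
  case False
  then have "\<not> distinct (xs @ b # a # ys)" by auto
  from alternating_not_distinct[OF this, of \<phi>] alternating_not_distinct[OF False, of \<phi>]
  show ?thesis by simp
qed

text \<open>The tool for proving identities between alternating extensions: only sorted lists
  without repetition have to be checked, and there \<open>alternating\<close> is the cochain itself.
  Integer values are essential, because for a repeated entry one learns only that \<open>g\<close>
  equals its own negative; modulo 2 this would say nothing.\<close>

lemma skew_symmetric_eq_0:
  fixes g :: "'v::linorder list \<Rightarrow> int"
  assumes swap: "\<And>xs a b ys. length (xs @ a # b # ys) = n \<Longrightarrow> g (xs @ a # b # ys) = - g (xs @ b # a # ys)"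
    and zero: "\<And>us. length us = n \<Longrightarrow> set us = set vs \<Longrightarrow> sorted us \<Longrightarrow> distinct us \<Longrightarrow> g us = 0"
    and len: "length vs = n"
  shows "g vs = 0"
proof -
  \<comment> \<open>Absolute values avoid keeping track of the sign of a permutation.\<close>
  have move: "\<bar>g (zs @ x # ys @ us)\<bar> = \<bar>g (zs @ ys @ x # us)\<bar>" if "length (zs @ x # ys @ us) = n" for zs x ys us
    using that
  proof (induction ys arbitrary: zs)
    case (Cons y ys)
    have "g (zs @ x # y # ys @ us) = - g (zs @ y # x # ys @ us)"
      using Cons.prems by (intro swap) simp
    moreover have "\<bar>g ((zs @ [y]) @ x # ys @ us)\<bar> = \<bar>g ((zs @ [y]) @ ys @ x # us)\<bar>"
      by (rule Cons.IH) (use Cons.prems in simp)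
    ultimately show ?case by simp
  qed simp
  have perm: "\<bar>g (zs @ xs)\<bar> = \<bar>g (zs @ ys)\<bar>" if "mset xs = mset ys" "length (zs @ xs) = n" for zs xs ys
    using that
  proof (induction xs arbitrary: zs ys)
    case (Cons x xs)
    then have "x \<in> set ys" by (metis list.set_intros(1) set_mset_mset)
    then obtain ys1 ys2 where ys: "ys = ys1 @ x # ys2" by (meson split_list)
    have l: "length ys = Suc (length xs)" using Cons.prems by (metis length_Cons size_mset)
    have "\<bar>g ((zs @ [x]) @ xs)\<bar> = \<bar>g ((zs @ [x]) @ ys1 @ ys2)\<bar>"
      by (rule Cons.IH) (use Cons.prems ys in auto)
    also have "\<dots> = \<bar>g (zs @ ys)\<bar>"
      using move[of zs x ys1 ys2] Cons.prems l ys by simp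
    finally show ?case by simp
  qed simp
  have s: "\<bar>g vs\<bar> = \<bar>g (sort vs)\<bar>" using perm[of vs "sort vs" "[]"] len by simp
  have "g (sort vs) = 0"
  proof (cases "distinct vs")
    case True
    then show ?thesis using zero[of "sort vs"] len by simp
  next
    case False
    then obtain xs ys zs y where vs: "vs = xs @ [y] @ ys @ [y] @ zs" by (metis not_distinct_decomp)
    have l: "length ([y, y] @ xs @ ys @ zs) = n" using vs len by simp
    \<comment> \<open>The two equal entries are brought to the front, where exchanging them changes
      the sign but not the list.\<close>
    have "\<bar>g vs\<bar> = \<bar>g ([] @ y # y # (xs @ ys @ zs))\<bar>"
      using perm[of vs "[y, y] @ xs @ ys @ zs" "[]"] vs len by simp
    moreover have "g ([] @ y # y # (xs @ ys @ zs)) = - g ([] @ y # y # (xs @ ys @ zs))"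
      by (rule swap) (use l in simp)
    ultimately show ?thesis using s by simp
  qed
  with s show ?thesis by simp
qed


section \<open>Simplices and coboundary formulas in low degrees\<close>

lemma sorted_list_of_set_insert2:
  fixes i j :: "'v::linorder"
  assumes "i < j"
  shows "sorted_list_of_set {i, j} = [i, j]"
proof -
  have "sorted_list_of_set (set [i, j]) = [i, j]"
    by (rule sorted_list_of_set.idem_if_sorted_distinct) (use assms in auto)
  then show ?thesis by (simp only: list.set)
qed

lemma sorted_list_of_set_insert3:
  fixes i j k :: "'v::linorder"
  assumes "i < j" "j < k"
  shows "sorted_list_of_set {i, j, k} = [i, j, k]"
proof -
  have "sorted_list_of_set (set [i, j, k]) = [i, j, k]"
    by (rule sorted_list_of_set.idem_if_sorted_distinct) (use assms in auto)
  then show ?thesis by (simp only: list.set)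
qed

lemma sorted_list_of_set_insert4:
  fixes i j k l :: "'v::linorder"
  assumes "i < j" "j < k" "k < l"
  shows "sorted_list_of_set {i, j, k, l} = [i, j, k, l]"
proof -
  have "sorted_list_of_set (set [i, j, k, l]) = [i, j, k, l]"
    by (rule sorted_list_of_set.idem_if_sorted_distinct) (use assms in auto)
  then show ?thesis by (simp only: list.set)
qed

lemma coboundary_0:
  fixes i j :: "'v::linorder"
  assumes "i < j" "{i, j} \<in> K"
  shows "coboundary K 0 \<phi> {i, j} = \<phi> {j} - \<phi> {i}"
proof -
  have "{i, j} \<in> simplices K (Suc 0)" using assms by (simp add: simplices_def)
  moreover have "{i, j} - {i} = {j}" "{i, j} - {j} = {i}" using assms by auto
  ultimately show ?thesis
    unfolding coboundary_def sorted_list_of_set_insert2[OF assms(1)] by simp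
qed

lemma coboundary_1:
  fixes i j k :: "'v::linorder"
  assumes "i < j" "j < k" "{i, j, k} \<in> K"
  shows "coboundary K 1 \<phi> {i, j, k} = \<phi> {j, k} - \<phi> {i, k} + \<phi> {i, j}"
proof -
  have "card (set [i, j, k]) = length [i, j, k]" by (rule distinct_card) (use assms in auto)
  then have "{i, j, k} \<in> simplices K (Suc 1)" using assms by (simp add: simplices_def)
  moreover have "{i, j, k} - {i} = {j, k}" "{i, j, k} - {j} = {i, k}" "{i, j, k} - {k} = {i, j}"
    using assms by auto
  ultimately show ?thesis
    unfolding coboundary_def sorted_list_of_set_insert3[OF assms(1,2)] by (simp add: Let_def)
qed

lemma coboundary_2:
  fixes i j k l :: "'v::linorder"
  assumes "i < j" "j < k" "k < l" "{i, j, k, l} \<in> K"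
  shows "coboundary K 2 \<phi> {i, j, k, l} = \<phi> {j, k, l} - \<phi> {i, k, l} + \<phi> {i, j, l} - \<phi> {i, j, k}"
proof -
  have "card (set [i, j, k, l]) = length [i, j, k, l]" by (rule distinct_card) (use assms in auto)
  then have "{i, j, k, l} \<in> simplices K (Suc 2)" using assms by (simp add: simplices_def)
  moreover have "{i, j, k, l} - {i} = {j, k, l}" "{i, j, k, l} - {j} = {i, k, l}"
    "{i, j, k, l} - {k} = {i, j, l}" "{i, j, k, l} - {l} = {i, j, k}"
    using assms by auto
  moreover have *: "{..Suc 2} = {0, 1, 2, 3::nat}" by auto
  ultimately show ?thesis
    unfolding coboundary_def sorted_list_of_set_insert4[OF assms(1-3)]
    by (simp add: Let_def *)
qed

lemma simplices_sorted_list: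
  fixes s :: "'v::linorder set"
  assumes "s \<in> simplices K k"
  obtains us where "length us = Suc k" "sorted us" "distinct us" "s = set us" "set us \<in> K"
  using assms that[of "sorted_list_of_set s"] by (auto simp: simplices_def)

lemma simplices_1E:
  fixes s :: "'v::linorder set"
  assumes "s \<in> simplices K 1"
  obtains i j where "i < j" "s = {i, j}" "{i, j} \<in> K"
proof -
  obtain us where us: "length us = 2" "sorted us" "distinct us" "s = set us" "set us \<in> K"
    using simplices_sorted_list[OF assms] by (metis Suc_1)
  then obtain i j where "us = [i, j]" by (auto simp: length_Suc_conv numeral_eq_Suc)
  with us show ?thesis using that[of i j] by auto
qed

lemma simplices_2E:
  fixes s :: "'v::linorder set"
  assumes "s \<in> simplices K 2"
  obtains i j k where "i < j" "j < k" "s = {i, j, k}" "{i, j, k} \<in> K"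
proof -
  obtain us where us: "length us = 3" "sorted us" "distinct us" "s = set us" "set us \<in> K"
    using simplices_sorted_list[OF assms] by (metis numeral_2_eq_2 numeral_3_eq_3)
  then obtain i j k where "us = [i, j, k]" by (auto simp: length_Suc_conv numeral_eq_Suc)
  with us show ?thesis using that[of i j k] by auto
qed

lemma simplices_3E:
  fixes s :: "'v::linorder set"
  assumes "s \<in> simplices K 3"
  obtains i j k l where "i < j" "j < k" "k < l" "s = {i, j, k, l}" "{i, j, k, l} \<in> K"
proof -
  obtain us where us: "length us = Suc 3" "sorted us" "distinct us" "s = set us" "set us \<in> K"
    using simplices_sorted_list[OF assms] by metis
  then obtain i j k l where "us = [i, j, k, l]" by (auto simp: length_Suc_conv numeral_eq_Suc)
  with us show ?thesis using that[of i j k l] by auto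
qed

section \<open>Cocycles and cohomology classes as concrete sets of functions\<close>

lemma carrier_cochain_group:
  "\<phi> \<in> carrier (cochain_group K k) \<longleftrightarrow> (\<forall>s. s \<notin> simplices K k \<longrightarrow> \<phi> s = 0)"
  by (simp add: cochain_group_def)

lemma coboundary_in_carrier: "coboundary K k \<phi> \<in> carrier (cochain_group K (Suc k))"
  by (simp add: carrier_cochain_group coboundary_def)

lemma cocycles_iff:
  "\<phi> \<in> cocycles K k \<longleftrightarrow>
     \<phi> \<in> carrier (cochain_group K k) \<and> (\<forall>s\<in>simplices K (Suc k). coboundary K k \<phi> s = 0)"
  by (auto simp: cocycles_def kernel_def cochain_group_def fun_eq_iff coboundary_def)

text \<open>The contributions of the faces cancel in pairs. The faces have to belong to
  \<open>K\<close>, as \<open>coboundary\<close> is set to 0 off the simplices.\<close>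

lemma coboundary_0_in_cocycles:
  fixes K :: "'v::linorder set set"
  assumes K: "\<And>s t. s \<in> K \<Longrightarrow> t \<subseteq> s \<Longrightarrow> t \<noteq> {} \<Longrightarrow> t \<in> K"
  shows "coboundary K 0 \<phi> \<in> cocycles K 1"
proof -
  have "coboundary K 1 (coboundary K 0 \<phi>) s = 0" if two: "s \<in> simplices K 2" for s
  proof -
    obtain i j k where s: "i < j" "j < k" "s = {i, j, k}" "{i, j, k} \<in> K"
      by (rule simplices_2E[OF two])
    then have "{i, j} \<in> K" "{i, k} \<in> K" "{j, k} \<in> K" by (auto intro: K)
    then show ?thesis using s by (simp add: coboundary_1[unfolded One_nat_def] coboundary_0)
  qed
  then show ?thesis
    using coboundary_in_carrier[of K 0 \<phi>] by (simp add: cocycles_iff numeral_2_eq_2)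
qed

lemma coboundary_1_in_cocycles:
  fixes K :: "'v::linorder set set"
  assumes K: "\<And>s t. s \<in> K \<Longrightarrow> t \<subseteq> s \<Longrightarrow> t \<noteq> {} \<Longrightarrow> t \<in> K"
  shows "coboundary K 1 \<phi> \<in> cocycles K 2"
proof -
  have "coboundary K 2 (coboundary K 1 \<phi>) s = 0" if three: "s \<in> simplices K 3" for s
  proof -
    obtain i j k l where s: "i < j" "j < k" "k < l" "s = {i, j, k, l}" "{i, j, k, l} \<in> K"
      by (rule simplices_3E[OF three])
    then have "{i, j, k} \<in> K" "{i, j, l} \<in> K" "{i, k, l} \<in> K" "{j, k, l} \<in> K"
      by (auto intro: K)
    then show ?thesis using s by (simp add: coboundary_2 coboundary_1[unfolded One_nat_def])
  qed
  then show ?thesis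
    using coboundary_in_carrier[of K 1 \<phi>] by (simp add: cocycles_iff numeral_2_eq_2 numeral_3_eq_3)
qed

lemma coboundary_add:
  "coboundary K k (\<lambda>s. \<phi> s + \<psi> s) = (\<lambda>s. coboundary K k \<phi> s + coboundary K k \<psi> s)"
  by (auto simp: coboundary_def Let_def fun_eq_iff sum.distrib[symmetric] intro!: sum.cong)

lemma coboundary_diff:
  "coboundary K k (\<lambda>s. \<phi> s - \<psi> s) = (\<lambda>s. coboundary K k \<phi> s - coboundary K k \<psi> s)"
  by (auto simp: coboundary_def Let_def fun_eq_iff sum_subtractf[symmetric] intro!: sum.cong)

lemma coboundaries_Suc: "coboundaries K (Suc k) = coboundary K k ` carrier (cochain_group K k)"
  by (simp add: coboundaries_def)

lemma coboundaries_diff: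
  assumes "\<phi> \<in> coboundaries K (Suc k)" "\<psi> \<in> coboundaries K (Suc k)"
  shows "(\<lambda>s. \<phi> s - \<psi> s) \<in> coboundaries K (Suc k)"
proof -
  obtain \<alpha> \<beta> where "\<alpha> \<in> carrier (cochain_group K k)" "\<beta> \<in> carrier (cochain_group K k)"
    "\<phi> = coboundary K k \<alpha>" "\<psi> = coboundary K k \<beta>"
    using assms by (auto simp: coboundaries_Suc)
  then show ?thesis
    unfolding coboundaries_Suc
    by (intro image_eqI[of _ _ "\<lambda>s. \<alpha> s - \<beta> s"]) (auto simp: coboundary_diff carrier_cochain_group)
qed

lemma zero_in_coboundaries: "(\<lambda>_. 0) \<in> coboundaries K (Suc k)"
  unfolding coboundaries_Suc
  by (intro image_eqI[of _ _ "\<lambda>_. 0"]) (auto simp: coboundary_def carrier_cochain_group fun_eq_iff Let_def intro!: sum.neutral[symmetric] sum.neutral)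

lemma coboundaries_add:
  assumes "\<phi> \<in> coboundaries K (Suc k)" "\<psi> \<in> coboundaries K (Suc k)"
  shows "(\<lambda>s. \<phi> s + \<psi> s) \<in> coboundaries K (Suc k)"
  using coboundaries_diff[OF assms(1) coboundaries_diff[OF zero_in_coboundaries assms(2)]] by simp

lemma cohomology_class_eq:
  "cohomology_class K k \<phi> = {\<lambda>s. \<beta> s + \<phi> s |\<beta>. \<beta> \<in> coboundaries K k}"
  by (auto simp: cohomology_class_def r_coset_def cochain_group_def)

lemma carrier_cohomology: "carrier (cohomology K k) = cohomology_class K k ` cocycles K k"
  by (auto simp: cohomology_def FactGroup_def RCOSETS_def cohomology_class_def r_coset_def)

lemma cohomology_class_eqI:
  assumes "(\<lambda>s. \<phi> s - \<psi> s) \<in> coboundaries K (Suc k)"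
  shows "cohomology_class K (Suc k) \<phi> = cohomology_class K (Suc k) \<psi>"
  unfolding cohomology_class_eq
proof (intro Collect_cong iffI; elim exE conjE)
  fix \<alpha> \<beta> assume "\<alpha> = (\<lambda>s. \<beta> s + \<phi> s)" "\<beta> \<in> coboundaries K (Suc k)"
  then show "\<exists>\<beta>. \<alpha> = (\<lambda>s. \<beta> s + \<psi> s) \<and> \<beta> \<in> coboundaries K (Suc k)"
    using coboundaries_add[OF _ assms, of \<beta>]
    by (intro exI[of _ "\<lambda>s. \<beta> s + (\<phi> s - \<psi> s)"]) auto
next
  fix \<alpha> \<beta> assume "\<alpha> = (\<lambda>s. \<beta> s + \<psi> s)" "\<beta> \<in> coboundaries K (Suc k)"
  then show "\<exists>\<beta>. \<alpha> = (\<lambda>s. \<beta> s + \<phi> s) \<and> \<beta> \<in> coboundaries K (Suc k)"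
    using coboundaries_diff[OF _ assms, of \<beta>]
    by (intro exI[of _ "\<lambda>s. \<beta> s - (\<phi> s - \<psi> s)"]) auto
qed

text \<open>This is how \<open>w1\<close>, \<open>c1\<close> and \<open>cohomology_pullback\<close>
  are evaluated: if adding coboundaries does not affect \<open>F\<close>, the image of a class is a
  singleton.\<close>

lemma the_elem_cohomology_class:
  assumes "\<And>\<beta>. \<beta> \<in> coboundaries K (Suc k) \<Longrightarrow> F (\<lambda>s. \<beta> s + \<phi> s) = F \<phi>"
  shows "the_elem (F ` cohomology_class K (Suc k) \<phi>) = F \<phi>"
proof -
  have "F ` cohomology_class K (Suc k) \<phi> = {F \<phi>}"
    using assms zero_in_coboundaries[of K k]
    by (fastforce simp: cohomology_class_eq image_iff)
  then show ?thesis by simp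
qed

section \<open>Cocycle identities for unordered and repeated indices\<close>

lemma alternating_coboundary_1:
  fixes \<theta> :: "'v::linorder set \<Rightarrow> int"
  assumes "{i, j, k} \<in> K"
  shows "alternating (coboundary K 1 \<theta>) [i, j, k] =
           alternating \<theta> [j, k] - alternating \<theta> [i, k] + alternating \<theta> [i, j]"
proof -
  \<comment> \<open>The value 0 on lists of other lengths is never consulted, since only lists of
    length 3 enter below.\<close>
  define g where "g l = (case l of [i, j, k] \<Rightarrow> alternating (coboundary K 1 \<theta>) [i, j, k] -
      (alternating \<theta> [j, k] - alternating \<theta> [i, k] + alternating \<theta> [i, j]) | _ \<Rightarrow> 0)" for l
  have "g [i, j, k] = 0"
  proof (rule skew_symmetric_eq_0[where n = 3])
    fix xs ys and a b :: 'v
    assume l: "length (xs @ a # b # ys) = 3"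
    have sw2: "alternating \<theta> [a, b] = - alternating \<theta> [b, a]" for a b
      using alternating_swap[of _ "[]" a b "[]"] by simp
    consider c where "xs = [c]" "ys = []" | c where "xs = []" "ys = [c]"
      using l by (cases xs; cases ys) auto
    then show "g (xs @ a # b # ys) = - g (xs @ b # a # ys)"
    proof cases
      case 1
      then show ?thesis
        using alternating_swap[of "coboundary K 1 \<theta>" "[c]" a b "[]"] sw2[of a b]
        by (simp add: g_def)
    next
      case 2
      then show ?thesis
        using alternating_swap[of "coboundary K 1 \<theta>" "[]" a b "[c]"] sw2[of a b]
        by (simp add: g_def)
    qed
  next
    fix us assume us: "length us = 3" "set us = set [i, j, k]" "sorted us" "distinct us"
    then obtain a b c where abc: "us = [a, b, c]" by (auto simp: length_Suc_conv numeral_eq_Suc)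
    then have "a < b" "b < c" "{a, b, c} \<in> K" using us assms by auto
    then show "g us = 0"
      using coboundary_1[of a b c K \<theta>]
      by (auto simp add: abc g_def alternating_less2 alternating_less3)
  qed simp
  then show ?thesis by (simp add: g_def)
qed

text \<open>Unordered and repeated indices are included because \<open>eta_sum_cocycle\<close> lets
  the last index run through all \<open>t\<close>, among them the three fixed ones.\<close>

lemma alternating_cocycle_2:
  fixes \<eta> :: "'v::linorder set \<Rightarrow> int"
  assumes "\<eta> \<in> cocycles K 2" "{i, j, k, l} \<in> K"
  shows "alternating \<eta> [j, k, l] - alternating \<eta> [i, k, l] + alternating \<eta> [i, j, l]
           - alternating \<eta> [i, j, k] = 0"
proof -
  define g where "g l = (case l of [i, j, k, l] \<Rightarrow> alternating \<eta> [j, k, l] - alternating \<eta> [i, k, l]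
      + alternating \<eta> [i, j, l] - alternating \<eta> [i, j, k] | _ \<Rightarrow> 0)" for l
  have "g [i, j, k, l] = 0"
  proof (rule skew_symmetric_eq_0[where n = 4])
    fix xs ys and a b :: 'v
    assume l: "length (xs @ a # b # ys) = 4"
    have sw1: "alternating \<eta> [a, b, c] = - alternating \<eta> [b, a, c]" for a b c
      using alternating_swap[of _ "[]" a b "[c]"] by simp
    have sw2: "alternating \<eta> [c, a, b] = - alternating \<eta> [c, b, a]" for a b c
      using alternating_swap[of _ "[c]" a b "[]"] by simp
    consider c d where "xs = [c, d]" "ys = []" | c d where "xs = [c]" "ys = [d]"
      | c d where "xs = []" "ys = [c, d]"
      using l by (cases xs; cases "tl xs"; cases ys; cases "tl ys") auto
    then show "g (xs @ a # b # ys) = - g (xs @ b # a # ys)"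
    proof cases
      case 1
      then show ?thesis
        using sw2[of c a b] sw2[of d a b] by (simp add: g_def)
    next
      case 2
      then show ?thesis
        using sw2[of c a b] sw1[of a b d] by (simp add: g_def)
    next
      case 3
      then show ?thesis
        using sw1[of a b c] sw1[of a b d] by (simp add: g_def)
    qed
  next
    fix us assume us: "length us = 4" "set us = set [i, j, k, l]" "sorted us" "distinct us"
    then obtain a b c d where abc: "us = [a, b, c, d]" by (auto simp: length_Suc_conv numeral_eq_Suc)
    then have *: "a < b" "b < c" "c < d" "{a, b, c, d} \<in> K" using us assms by auto
    then have "{a, b, c, d} \<in> simplices K (Suc 2)"
      using us abc distinct_card[of us] by (simp add: simplices_def)
    then have "coboundary K 2 \<eta> {a, b, c, d} = 0" using assms(1) by (simp add: cocycles_iff)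
    then show "g us = 0"
      using coboundary_2[of a b c d K \<eta>] * by (auto simp add: abc g_def alternating_less3)
  qed simp
  then show ?thesis by (simp add: g_def)
qed

text \<open>Both sides are skew in \<open>vs\<close>, even where \<rho> identifies vertices, and on
  sorted lists they agree by definition.\<close>

lemma alternating_cochain_pullback:
  fixes \<phi> :: "'v::linorder set \<Rightarrow> int"
  assumes "set vs \<in> L" "length vs = Suc k"
  shows "alternating (cochain_pullback L k \<rho> \<phi>) vs = alternating \<phi> (map \<rho> vs)"
proof -
  have "alternating (cochain_pullback L k \<rho> \<phi>) vs - alternating \<phi> (map \<rho> vs) = 0"
  proof (rule skew_symmetric_eq_0[where n = "Suc k" and g = "\<lambda>vs. alternating (cochain_pullback L k \<rho> \<phi>) vs - alternating \<phi> (map \<rho> vs)"])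
    fix xs ys a b
    show "alternating (cochain_pullback L k \<rho> \<phi>) (xs @ a # b # ys) - alternating \<phi> (map \<rho> (xs @ a # b # ys)) =
      - (alternating (cochain_pullback L k \<rho> \<phi>) (xs @ b # a # ys) - alternating \<phi> (map \<rho> (xs @ b # a # ys)))"
      using alternating_swap[of "cochain_pullback L k \<rho> \<phi>" xs a b ys]
        alternating_swap[of \<phi> "map \<rho> xs" "\<rho> a" "\<rho> b" "map \<rho> ys"] by simp
  next
    fix us assume us: "length us = Suc k" "set us = set vs" "sorted us" "distinct us"
    then have "set us \<in> simplices L k"
      using assms distinct_card[of us] by (simp add: simplices_def)
    then show "alternating (cochain_pullback L k \<rho> \<phi>) us - alternating \<phi> (map \<rho> us) = 0"
      using us alternating_sorted[of us "cochain_pullback L k \<rho> \<phi>"]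
        sorted_list_of_set.idem_if_sorted_distinct[of us]
      by (simp add: cochain_pullback_def)
  qed (rule assms)
  then show ?thesis by simp
qed

section \<open>Homogeneous coordinates for maps into projective spaces\<close>

lemma continuous_map_local:
  assumes "\<And>x. x \<in> topspace X \<Longrightarrow> \<exists>W. openin X W \<and> x \<in> W \<and> continuous_map (subtopology X W) Y f"
  shows "continuous_map X Y f"
proof -
  obtain W where W: "\<And>x. x \<in> topspace X \<Longrightarrow> openin X (W x) \<and> x \<in> W x \<and> continuous_map (subtopology X (W x)) Y f"
    using assms by metis
  show ?thesis
    by (rule pasting_lemma[where I = "topspace X" and T = W and f = "\<lambda>_. f"]) (use W in auto)
qed

text \<open>The set \<open>S\<close> is there for division, which is continuous only away from zero
  denominators.\<close>

lemma continuous_map_euclidean_pair: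
  assumes "continuous_map X euclidean f" "continuous_map X euclidean g" "continuous_on S h"
    "\<And>x. x \<in> topspace X \<Longrightarrow> (f x, g x) \<in> S"
  shows "continuous_map X euclidean (\<lambda>x. h (f x, g x))"
proof -
  have "continuous_map X (prod_topology euclidean euclidean) (\<lambda>x. (f x, g x))"
    by (intro continuous_map_pairedI assms(1,2))
  then have "continuous_map X (top_of_set S) (\<lambda>x. (f x, g x))"
    using assms(4) by (auto simp: continuous_map_in_subtopology)
  moreover have "continuous_map (top_of_set S) euclidean h" using assms(3) by simp
  ultimately have "continuous_map X euclidean (h \<circ> (\<lambda>x. (f x, g x)))" by (rule continuous_map_compose)
  then show ?thesis by (simp add: o_def)
qed

lemma continuous_map_mult:
  fixes f g :: "'a \<Rightarrow> 'f::real_normed_field"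
  assumes "continuous_map X euclidean f" "continuous_map X euclidean g"
  shows "continuous_map X euclidean (\<lambda>x. f x * g x)"
  using continuous_map_euclidean_pair[OF assms, of UNIV "\<lambda>p. fst p * snd p"]
  by (simp add: continuous_intros)

lemma continuous_map_divide:
  fixes f g :: "'a \<Rightarrow> 'f::real_normed_field"
  assumes "continuous_map X euclidean f" "continuous_map X euclidean g"
    "\<And>x. x \<in> topspace X \<Longrightarrow> g x \<noteq> 0"
  shows "continuous_map X euclidean (\<lambda>x. f x / g x)"
  using continuous_map_euclidean_pair[OF assms(1,2), of "UNIV \<times> - {0}" "\<lambda>p. fst p / snd p"] assms(3)
  by (auto simp: continuous_intros)

lemma proj_eq_iff: "proj x = proj y \<longleftrightarrow> (\<exists>c. c \<noteq> 0 \<and> y = (\<lambda>i. c * x i))"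
proof
  assume "proj x = proj y"
  then have "y \<in> proj x"
    unfolding proj_def by (auto intro: exI[of _ 1])
  then show "\<exists>c. c \<noteq> 0 \<and> y = (\<lambda>i. c * x i)" by (auto simp: proj_def)
next
  assume "\<exists>c. c \<noteq> 0 \<and> y = (\<lambda>i. c * x i)"
  then obtain c where c: "c \<noteq> 0" "y = (\<lambda>i. c * x i)" by blast
  have "proj y \<subseteq> proj x"
  proof
    fix z assume "z \<in> proj y"
    then obtain d where "d \<noteq> 0" "z = (\<lambda>i. d * y i)" by (auto simp: proj_def)
    then show "z \<in> proj x" using c by (auto simp: proj_def mult.assoc intro!: exI[of _ "d * c"])
  qed
  moreover have "proj x \<subseteq> proj y"
  proof
    fix z assume "z \<in> proj x"
    then obtain d where "d \<noteq> 0" "z = (\<lambda>i. d * x i)" by (auto simp: proj_def)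
    then show "z \<in> proj y" using c by (auto simp: proj_def intro!: exI[of _ "d / c"])
  qed
  ultimately show "proj x = proj y" by blast
qed

lemma proj_scale: "c \<noteq> 0 \<Longrightarrow> proj (\<lambda>i. c * x i) = proj x"
  by (metis proj_eq_iff)

lemma topspace_punctured_space: "topspace (punctured_space n) = {x. (\<forall>i>n. x i = 0) \<and> x \<noteq> (\<lambda>_. 0)}"
  by (simp add: punctured_space_def)

lemma topspace_proj_space: "topspace (proj_space n) = proj ` topspace (punctured_space n)"
  by (simp add: proj_space_def)

lemma topspace_proj_space_inf:
  "topspace (proj_space_inf :: (nat \<Rightarrow> 'a::real_normed_field) set topology) = (\<Union>n. topspace (proj_space n))"
proof
  show "topspace proj_space_inf \<subseteq> (\<Union>n. topspace (proj_space n :: (nat \<Rightarrow> 'a) set topology))"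
    using openin_proj_space_inf openin_topspace by blast
  have "(\<Union>m. topspace (proj_space m :: (nat \<Rightarrow> 'a) set topology)) \<inter> topspace (proj_space n) =
      topspace (proj_space n)" for n
    by blast
  then have "openin proj_space_inf (\<Union>n. topspace (proj_space n :: (nat \<Rightarrow> 'a) set topology))"
    unfolding openin_proj_space_inf by (metis openin_topspace order_refl)
  then show "(\<Union>n. topspace (proj_space n :: (nat \<Rightarrow> 'a) set topology)) \<subseteq> topspace proj_space_inf"
    by (rule openin_subset)
qed

lemma continuous_map_proj_space_inf:
  fixes f :: "'a \<Rightarrow> (nat \<Rightarrow> 'f::real_normed_field) set"
  assumes "continuous_map X (proj_space n) f"
  shows "continuous_map X proj_space_inf f"
  unfolding continuous_map
proof (intro conjI allI impI)
  show "f ` topspace X \<subseteq> topspace proj_space_inf"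
    using assms by (auto simp: topspace_proj_space_inf continuous_map)
  fix V :: "(nat \<Rightarrow> 'f) set set" assume "openin proj_space_inf V"
  then have "openin (proj_space n) (V \<inter> topspace (proj_space n))"
    by (simp only: openin_proj_space_inf)
  then have "openin X {x \<in> topspace X. f x \<in> V \<inter> topspace (proj_space n)}"
    by (rule openin_continuous_map_preimage[OF assms])
  moreover have "{x \<in> topspace X. f x \<in> V \<inter> topspace (proj_space n)} = {x \<in> topspace X. f x \<in> V}"
    using assms by (auto simp: continuous_map)
  ultimately show "openin X {x \<in> topspace X. f x \<in> V}" by simp
qed

text \<open>Only the individual coordinates are required to be continuous, so that no topology on the
  space of all sequences is needed.\<close>

definition lifts :: "'z topology \<Rightarrow> ('z \<Rightarrow> (nat \<Rightarrow> 'f::real_normed_field) set) \<Rightarrow> ('z \<Rightarrow> nat \<Rightarrow> 'f) \<Rightarrow> bool"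
  where "lifts Z q G \<longleftrightarrow>
    (\<forall>r. continuous_map Z euclidean (\<lambda>z. G z r)) \<and> (\<forall>z\<in>topspace Z. G z \<noteq> (\<lambda>_. 0) \<and> q z = proj (G z))"

lemma lifts_continuous: "lifts Z q G \<Longrightarrow> continuous_map Z euclidean (\<lambda>z. G z r)"
  by (simp add: lifts_def)

lemma lifts_nonzero: "lifts Z q G \<Longrightarrow> z \<in> topspace Z \<Longrightarrow> G z \<noteq> (\<lambda>_. 0)"
  by (simp add: lifts_def)

lemma lifts_proj: "lifts Z q G \<Longrightarrow> z \<in> topspace Z \<Longrightarrow> q z = proj (G z)"
  by (simp add: lifts_def)

lemma lifts_compose:
  assumes "lifts Z q G" "continuous_map Z' Z f"
  shows "lifts Z' (\<lambda>z. q (f z)) (\<lambda>z. G (f z))"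
  unfolding lifts_def
proof (intro conjI allI ballI)
  fix r show "continuous_map Z' euclidean (\<lambda>z. G (f z) r)"
    using continuous_map_compose[OF assms(2) lifts_continuous[OF assms(1)]] by (simp add: o_def)
next
  fix z assume "z \<in> topspace Z'"
  then have "f z \<in> topspace Z" using assms(2) by (auto simp: continuous_map)
  then show "G (f z) \<noteq> (\<lambda>_. 0)" "q (f z) = proj (G (f z))" using assms(1) by (auto simp: lifts_def)
qed

lemma lifts_subtopology: "lifts Z q G \<Longrightarrow> lifts (subtopology Z S) q G"
  by (auto simp: lifts_def continuous_map_from_subtopology)

lemma lifts_scale:
  assumes "lifts Z q G" "continuous_map Z euclidean c" "\<And>z. z \<in> topspace Z \<Longrightarrow> c z \<noteq> 0"
  shows "lifts Z q (\<lambda>z r. c z * G z r)"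
  unfolding lifts_def
proof (intro conjI allI ballI)
  show "continuous_map Z euclidean (\<lambda>z. c z * G z r)" for r
    using assms by (intro continuous_map_mult) (auto simp: lifts_def)
  fix z assume z: "z \<in> topspace Z"
  then show "(\<lambda>r. c z * G z r) \<noteq> (\<lambda>_. 0)"
    using assms(3)[OF z] lifts_nonzero[OF assms(1) z] by (auto simp: fun_eq_iff)
  show "q z = proj (\<lambda>r. c z * G z r)"
    using assms(3)[OF z] lifts_proj[OF assms(1) z] by (simp add: proj_scale)
qed

lemma lifts_cong:
  assumes "lifts Z q G" "\<And>z. z \<in> topspace Z \<Longrightarrow> q z = q' z" "\<And>z. z \<in> topspace Z \<Longrightarrow> G z = G' z"
  shows "lifts Z q' G'"
  unfolding lifts_def
proof (intro conjI allI ballI)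
  fix r show "continuous_map Z euclidean (\<lambda>z. G' z r)"
    by (rule continuous_map_eq[OF lifts_continuous[OF assms(1)]]) (simp add: assms(3))
qed (use assms in \<open>auto simp: lifts_def\<close>)

text \<open>The factor is forced at each point. Where the \<open>k\<close>-th coordinate of
  \<open>G\<close> does not vanish it is the quotient of the \<open>k\<close>-th coordinates, hence
  continuous there.\<close>

lemma lifts_ratio:
  assumes G: "lifts Z q G" and G': "lifts Z q G'"
  obtains c where "continuous_map Z euclidean c" "\<And>z. z \<in> topspace Z \<Longrightarrow> c z \<noteq> 0"
    "\<And>z r. z \<in> topspace Z \<Longrightarrow> G' z r = c z * G z r"
proof -
  have "\<exists>c. c \<noteq> 0 \<and> (\<forall>r. G' z r = c * G z r)" if "z \<in> topspace Z" for z
  proof -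
    have "proj (G z) = proj (G' z)" using assms that by (simp add: lifts_def)
    then show ?thesis by (auto simp: proj_eq_iff)
  qed
  then obtain c where c: "\<And>z. z \<in> topspace Z \<Longrightarrow> c z \<noteq> 0"
    "\<And>z r. z \<in> topspace Z \<Longrightarrow> G' z r = c z * G z r" by metis
  have "continuous_map Z euclidean c"
  proof (rule continuous_map_local)
    fix z assume z: "z \<in> topspace Z"
    then obtain k where k: "G z k \<noteq> 0" using G by (fastforce simp: lifts_def fun_eq_iff)
    let ?W = "{z \<in> topspace Z. G z k \<in> - {0}}"
    have W: "openin Z ?W"
      by (rule openin_continuous_map_preimage[OF lifts_continuous[OF G]]) auto
    have "continuous_map (subtopology Z ?W) euclidean (\<lambda>z. G' z k / G z k)"
      using lifts_continuous[OF G] lifts_continuous[OF G']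
      by (intro continuous_map_divide continuous_map_from_subtopology) auto
    then have "continuous_map (subtopology Z ?W) euclidean c"
      by (rule continuous_map_eq) (use c in auto)
    with W z k show "\<exists>W. openin Z W \<and> z \<in> W \<and> continuous_map (subtopology Z W) euclidean c"
      by blast
  qed
  with c that show ?thesis by blast
qed

text \<open>The common bound \<open>n\<close> places all values in one
  \<open>punctured_space n\<close>, where continuity of the coordinates is continuity of the
  map.\<close>

lemma continuous_map_proj_of_coordinates:
  assumes "\<And>r. continuous_map Z euclidean (\<lambda>z. G z r)"
    and "\<And>z. z \<in> topspace Z \<Longrightarrow> G z \<noteq> (\<lambda>_. 0)" and "\<And>z r. z \<in> topspace Z \<Longrightarrow> r > n \<Longrightarrow> G z r = 0"
  shows "continuous_map Z (proj_space n) (\<lambda>z. proj (G z))"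
proof -
  have "continuous_map Z (product_topology (\<lambda>_. euclidean) UNIV) G"
    using assms(1) by (simp add: continuous_map_componentwise_UNIV)
  then have "continuous_map Z (punctured_space n) G"
    unfolding punctured_space_def using assms(2,3) by (auto simp: continuous_map_in_subtopology)
  moreover have "continuous_map (punctured_space n) (proj_space n) proj"
    unfolding proj_space_def
    by (rule quotient_imp_continuous_map[OF quotient_map_quotient_topology])
  ultimately have "continuous_map Z (proj_space n) (proj \<circ> G)" by (rule continuous_map_compose)
  then show ?thesis by (simp add: o_def)
qed

lemma continuous_map_of_local_lifts:
  assumes "\<And>x. x \<in> topspace Z \<Longrightarrow> \<exists>W G. openin Z W \<and> x \<in> W \<and> lifts (subtopology Z W) f G \<and>
     (\<forall>z\<in>W. \<forall>r>n. G z r = 0)"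
  shows "continuous_map Z (proj_space n) f"
proof (rule continuous_map_local)
  fix x assume "x \<in> topspace Z"
  then obtain W G where W: "openin Z W" "x \<in> W" "lifts (subtopology Z W) f G" "\<forall>z\<in>W. \<forall>r>n. G z r = 0"
    using assms by blast
  have "continuous_map (subtopology Z W) (proj_space n) (\<lambda>z. proj (G z))"
    using W by (intro continuous_map_proj_of_coordinates) (auto simp: lifts_def)
  then have "continuous_map (subtopology Z W) (proj_space n) f"
    by (rule continuous_map_eq) (use W in \<open>auto simp: lifts_def\<close>)
  with W show "\<exists>W. openin Z W \<and> x \<in> W \<and> continuous_map (subtopology Z W) (proj_space n) f" by blast
qed

section \<open>Affine charts of projective space and local lifts\<close>

lemma proj_mem_topspaceE:
  assumes "L \<in> topspace proj_space_inf"
  obtains x where "L = proj x" "x \<noteq> (\<lambda>_. 0)"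
  using assms by (auto simp: topspace_proj_space_inf topspace_proj_space topspace_punctured_space)

lemma self_mem_proj: "x \<in> proj x"
  by (auto simp: proj_def intro: exI[of _ 1])

definition affine_coord :: "nat \<Rightarrow> nat \<Rightarrow> (nat \<Rightarrow> 'f::real_normed_field) set \<Rightarrow> 'f" where
  "affine_coord k l L = (let x = (SOME x. x \<in> L) in x l / x k)"

lemma affine_coord_proj: "affine_coord k l (proj x) = x l / x k"
proof -
  have "(SOME y. y \<in> proj x) \<in> proj x" by (rule someI[of _ x]) (rule self_mem_proj)
  then show ?thesis by (auto simp: affine_coord_def Let_def proj_def)
qed

text \<open>\<open>affine_coord k k\<close> is 1 on lines with nonzero \<open>k\<close>-th
  coordinate and, by the convention for division by zero, 0 on the others. So this is the usual
  affine chart.\<close>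

definition affine_chart :: "nat \<Rightarrow> (nat \<Rightarrow> 'f::real_normed_field) set set" where
  "affine_chart k = {L \<in> topspace proj_space_inf. affine_coord k k L \<noteq> 0}"

text \<open>The direct limit and the quotient topology are both defined through preimages, so the
  two layers can be unwound together.\<close>

lemma openin_proj_space_inf_coordinates:
  assumes "\<And>n. openin (punctured_space n) {x \<in> topspace (punctured_space n). P (proj x)}"
  shows "openin proj_space_inf {L \<in> topspace proj_space_inf. P L}"
proof -
  let ?V = "{L \<in> topspace proj_space_inf. P L}"
  have "openin (proj_space n) (?V \<inter> topspace (proj_space n))" for n
  proof -
    have eq: "?V \<inter> topspace (proj_space n) = {L \<in> topspace (proj_space n). P L}"
      by (auto simp: topspace_proj_space_inf)
    have "{x \<in> topspace (punctured_space n). proj x \<in> {L \<in> topspace (proj_space n). P L}} =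
        {x \<in> topspace (punctured_space n). P (proj x)}"
      by (auto simp: topspace_proj_space)
    then show ?thesis
      unfolding eq using assms[of n] by (auto simp: proj_space_def openin_quotient_topology)
  qed
  then show ?thesis
    by (auto simp: openin_proj_space_inf topspace_proj_space_inf)
qed

lemma continuous_map_punctured_coord: "continuous_map (punctured_space n) euclidean (\<lambda>x. x k)"
  unfolding punctured_space_def
  by (intro continuous_map_from_subtopology continuous_map_product_projection) auto

lemma openin_affine_chart: "openin proj_space_inf (affine_chart k :: (nat \<Rightarrow> 'a::real_normed_field) set set)"
  unfolding affine_chart_def
proof (rule openin_proj_space_inf_coordinates)
  fix n
  let ?Z = "punctured_space n :: (nat \<Rightarrow> 'a) topology"
  have "openin ?Z {x \<in> topspace ?Z. x k \<in> - {0}}"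
    by (rule openin_continuous_map_preimage[OF continuous_map_punctured_coord]) auto
  moreover have "{x \<in> topspace ?Z. x k \<in> - {0}} = {x \<in> topspace ?Z. affine_coord k k (proj x) \<noteq> 0}"
    by (auto simp: affine_coord_proj)
  ultimately show "openin ?Z {x \<in> topspace ?Z. affine_coord k k (proj x) \<noteq> 0}"
    by simp
qed

lemma continuous_map_affine_coord:
  "continuous_map (subtopology proj_space_inf (affine_chart k)) euclidean
     (affine_coord k l :: (nat \<Rightarrow> 'a::real_normed_field) set \<Rightarrow> 'a)"
  unfolding continuous_map
proof (intro conjI allI impI)
  fix T :: "'a set" assume T: "openin euclidean T"
  let ?P = "\<lambda>L. affine_coord k k L \<noteq> 0 \<and> affine_coord k l L \<in> T"
  have "openin proj_space_inf {L \<in> topspace proj_space_inf. ?P L}"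
  proof (rule openin_proj_space_inf_coordinates)
    fix n
    let ?Z = "punctured_space n :: (nat \<Rightarrow> 'a) topology"
    let ?W = "{x \<in> topspace ?Z. x k \<in> - {0}}"
    have W: "openin ?Z ?W"
      by (rule openin_continuous_map_preimage[OF continuous_map_punctured_coord]) auto
    have "continuous_map (subtopology ?Z ?W) euclidean (\<lambda>x. x l / x k)"
      by (intro continuous_map_divide continuous_map_from_subtopology continuous_map_punctured_coord) auto
    then have "openin (subtopology ?Z ?W) {x \<in> topspace (subtopology ?Z ?W). x l / x k \<in> T}"
      using T by (rule openin_continuous_map_preimage)
    then have "openin ?Z {x \<in> topspace (subtopology ?Z ?W). x l / x k \<in> T}"
      using W openin_trans_full by blast
    moreover have "{x \<in> topspace (subtopology ?Z ?W). x l / x k \<in> T} = {x \<in> topspace ?Z. ?P (proj x)}"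
      by (auto simp: affine_coord_proj)
    ultimately show "openin ?Z {x \<in> topspace ?Z. ?P (proj x)}" by simp
  qed
  moreover have "{L \<in> topspace proj_space_inf. ?P L} =
    {L \<in> topspace (subtopology proj_space_inf (affine_chart k)). affine_coord k l L \<in> T}"
    by (auto simp: affine_chart_def)
  ultimately have "openin proj_space_inf {L \<in> topspace (subtopology proj_space_inf (affine_chart k)). affine_coord k l L \<in> T}"
    by simp
  then show "openin (subtopology proj_space_inf (affine_chart k))
      {L \<in> topspace (subtopology proj_space_inf (affine_chart k)). affine_coord k l L \<in> T}"
    by (auto simp: openin_subtopology)
qed simp

text \<open>On the chart of lines with nonzero \<open>k\<close>-th coordinate, normalising this
  coordinate to 1 is a continuous choice of a representative.\<close>

lemma local_lift_exists:
  assumes q: "continuous_map Z proj_space_inf q" and z: "z \<in> topspace Z"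
  obtains W G where "openin Z W" "z \<in> W" "lifts (subtopology Z W) q G"
proof -
  have "q z \<in> topspace proj_space_inf" using q z by (auto simp: continuous_map)
  then obtain x where x: "q z = proj x" "x \<noteq> (\<lambda>_. 0)" "proj x \<in> topspace proj_space_inf"
    using proj_mem_topspaceE by metis
  then obtain k where k: "x k \<noteq> 0" by (auto simp: fun_eq_iff)
  let ?W = "{z \<in> topspace Z. q z \<in> affine_chart k}"
  have W: "openin Z ?W" by (rule openin_continuous_map_preimage[OF q openin_affine_chart])
  have qW: "continuous_map (subtopology Z ?W) (subtopology proj_space_inf (affine_chart k)) q"
    using q by (auto simp: continuous_map_in_subtopology continuous_map_from_subtopology)
  have "lifts (subtopology Z ?W) q (\<lambda>z r. affine_coord k r (q z))"
    unfolding lifts_def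
  proof (intro conjI ballI allI)
    show "continuous_map (subtopology Z ?W) euclidean (\<lambda>z. affine_coord k r (q z))" for r
      using continuous_map_compose[OF qW continuous_map_affine_coord] by (simp add: o_def)
    fix z assume "z \<in> topspace (subtopology Z ?W)"
    then have qz: "q z \<in> affine_chart k" by auto
    then obtain y where y: "q z = proj y" unfolding affine_chart_def using proj_mem_topspaceE by blast
    have yk: "y k \<noteq> 0" using qz by (auto simp: affine_chart_def y affine_coord_proj)
    show "(\<lambda>r. affine_coord k r (q z)) \<noteq> (\<lambda>_. 0)"
      using yk by (auto simp: y affine_coord_proj fun_eq_iff intro!: exI[of _ k])
    show "q z = proj (\<lambda>r. affine_coord k r (q z))"
      using proj_scale[of "1 / y k" y] yk by (simp add: y affine_coord_proj)
  qed
  moreover have "z \<in> ?W" using z k x by (auto simp: affine_chart_def affine_coord_proj)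
  ultimately show ?thesis using that W by blast
qed

section \<open>Homotopies from transition functions\<close>

lemma continuous_map_of_real:
  "continuous_map X euclideanreal f \<Longrightarrow>
     continuous_map X euclidean (\<lambda>x. of_real (f x) :: 'f::real_normed_field)"
  using continuous_map_compose[of X euclideanreal f euclidean "of_real :: real \<Rightarrow> 'f"]
  by (simp add: o_def continuous_intros)

lemma open_coverD:
  assumes "open_cover X n U"
  shows "j \<le> n \<Longrightarrow> openin X (U j)" "j \<le> n \<Longrightarrow> U j \<subseteq> topspace X"
    "b \<in> topspace X \<Longrightarrow> \<exists>j\<le>n. b \<in> U j"
  using assms openin_subset by (auto simp: open_cover_def)

text \<open>The reason why \<open>f_tau\<close> and \<open>f_eta\<close> are well-defined: the
  factor between the formulas for two indices is automatically nonzero because no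
  \<open>G j b\<close> vanishes, so both give the same line.\<close>

lemma lifts_of_transitions:
  assumes U: "open_cover X n U"
    and cont: "\<And>j r. j \<le> n \<Longrightarrow> continuous_map (subtopology X (U j)) euclidean (\<lambda>b. G j b r)"
    and nz: "\<And>j b. b \<in> topspace X \<Longrightarrow> G j b \<noteq> (\<lambda>_. 0)"
    and trans: "\<And>i j b. i \<le> n \<Longrightarrow> j \<le> n \<Longrightarrow> b \<in> U i \<Longrightarrow> b \<in> U j \<Longrightarrow> \<exists>c. \<forall>r. G i b r = c * G j b r"
    and f: "\<And>b. f b = proj (G (SOME j. j \<le> n \<and> b \<in> U j) b)" and j: "j \<le> n"
  shows "lifts (subtopology X (U j)) f (G j)"
  unfolding lifts_def
proof (intro conjI allI ballI)
  fix b assume "b \<in> topspace (subtopology X (U j))"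
  then have b: "b \<in> topspace X" "b \<in> U j" by auto
  then show "G j b \<noteq> (\<lambda>_. 0)" using nz by blast
  define i where "i = (SOME j. j \<le> n \<and> b \<in> U j)"
  have "i \<le> n" "b \<in> U i"
    using someI_ex[of "\<lambda>j. j \<le> n \<and> b \<in> U j"] b j unfolding i_def by blast+
  then obtain c where c: "G i b = (\<lambda>r. c * G j b r)" using trans j b(2) by blast
  then have "c \<noteq> 0" using nz[OF b(1), of i] by auto
  then show "f b = proj (G j b)" unfolding f i_def[symmetric] c by (rule proj_scale)
qed (rule cont[OF j])

text \<open>The homotopy runs linearly from \<open>A j b\<close> to \<open>B j b\<close>. As a
  single factor \<open>c\<close> serves both ends, it serves the whole segment, so the line does not
  depend on \<open>j\<close>. The bound \<open>N\<close> keeps the homotopy in one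
  finite-dimensional projective space, where continuity can be checked through coordinates.\<close>

lemma homotopic_of_lifts:
  fixes A B :: "nat \<Rightarrow> 'a \<Rightarrow> nat \<Rightarrow> 'f::real_normed_field"
  assumes cover: "open_cover X n U"
    and A: "\<And>j. j \<le> n \<Longrightarrow> lifts (subtopology X (U j)) f (A j)"
    and B: "\<And>j. j \<le> n \<Longrightarrow> lifts (subtopology X (U j)) g (B j)"
    and N: "\<And>j b r. j \<le> n \<Longrightarrow> b \<in> U j \<Longrightarrow> r > N \<Longrightarrow> A j b r = 0 \<and> B j b r = 0"
    and trans: "\<And>i j b. i \<le> n \<Longrightarrow> j \<le> n \<Longrightarrow> b \<in> U i \<Longrightarrow> b \<in> U j \<Longrightarrow>
      \<exists>c. \<forall>r. A i b r = c * A j b r \<and> B i b r = c * B j b r"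
    and nz: "\<And>j b t. j \<le> n \<Longrightarrow> b \<in> U j \<Longrightarrow> 0 \<le> t \<Longrightarrow> t \<le> 1 \<Longrightarrow>
      \<exists>r. of_real (1 - t) * A j b r + of_real t * B j b r \<noteq> 0"
  shows "homotopic_with (\<lambda>_. True) X proj_space_inf f g"
proof -
  define G where "G j z r = of_real (1 - fst z) * A j (snd z) r + of_real (fst z) * B j (snd z) r"
    for j and z :: "real \<times> 'a" and r
  define sel where "sel b = (SOME j. j \<le> n \<and> b \<in> U j)" for b
  have sel: "sel b \<le> n \<and> b \<in> U (sel b)" if "b \<in> topspace X" for b
    using open_coverD(3)[OF cover that] unfolding sel_def by (metis (mono_tags, lifting) someI_ex)
  define H where "H z = proj (G (sel (snd z)) z)" for z
  let ?Z = "prod_topology (top_of_set {0..1::real}) X"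
  have G_nz: "G j z \<noteq> (\<lambda>_. 0)" if "j \<le> n" "snd z \<in> U j" "0 \<le> fst z" "fst z \<le> 1" for j z
    using nz[OF that] by (auto simp: G_def fun_eq_iff)
  have H_eq: "H z = proj (G j z)" if j: "j \<le> n" "snd z \<in> U j" and t: "0 \<le> fst z" "fst z \<le> 1" for j z
  proof -
    have s: "sel (snd z) \<le> n" "snd z \<in> U (sel (snd z))"
      using sel open_coverD(2)[OF cover] j by blast+
    obtain c where c: "\<And>r. A (sel (snd z)) (snd z) r = c * A j (snd z) r \<and> B (sel (snd z)) (snd z) r = c * B j (snd z) r"
      using trans[OF s(1) j(1) s(2) j(2)] by blast
    have eq: "G (sel (snd z)) z = (\<lambda>r. c * G j z r)"
      by (simp add: G_def c fun_eq_iff algebra_simps)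
    then have "c \<noteq> 0" using G_nz[OF s t] by auto
    then show ?thesis unfolding H_def eq by (rule proj_scale)
  qed
  have cont: "continuous_map ?Z (proj_space N) H"
  proof (rule continuous_map_of_local_lifts)
    fix z assume "z \<in> topspace ?Z"
    then have z: "0 \<le> fst z" "fst z \<le> 1" "snd z \<in> topspace X" by auto
    define j where "j = sel (snd z)"
    have j: "j \<le> n" "snd z \<in> U j" using sel[OF z(3)] by (auto simp: j_def)
    let ?W = "{0..1} \<times> U j"
    have W: "openin ?Z ?W" "z \<in> ?W"
      using open_coverD(1)[OF cover j(1)] j z by (auto simp: openin_prod_Times_iff mem_Times_iff)
    have s: "continuous_map (subtopology ?Z ?W) (subtopology X (U j)) snd"
      by (auto simp: continuous_map_in_subtopology intro!: continuous_map_from_subtopology continuous_map_snd)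
    have f: "continuous_map (subtopology ?Z ?W) euclideanreal fst"
      by (intro continuous_map_from_subtopology continuous_map_into_fulltopology[OF continuous_map_fst])
    have AB: "continuous_map (subtopology ?Z ?W) euclidean (\<lambda>z. A j (snd z) r)"
      "continuous_map (subtopology ?Z ?W) euclidean (\<lambda>z. B j (snd z) r)" for r
      using continuous_map_compose[OF s lifts_continuous[OF A[OF j(1)]]]
        continuous_map_compose[OF s lifts_continuous[OF B[OF j(1)]]] by (auto simp: o_def)
    have "lifts (subtopology ?Z ?W) H (G j)"
      unfolding lifts_def
    proof (intro conjI allI ballI)
      fix r
      show "continuous_map (subtopology ?Z ?W) euclidean (\<lambda>z. G j z r)"
        unfolding G_def
        by (intro continuous_map_add continuous_map_mult AB continuous_map_of_real f
            continuous_map_diff continuous_map_const[THEN iffD2]) auto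
    qed (use G_nz H_eq j in auto)
    moreover have "\<forall>z\<in>?W. \<forall>r>N. G j z r = 0" using N j by (auto simp: G_def)
    ultimately show "\<exists>W G. openin ?Z W \<and> z \<in> W \<and> lifts (subtopology ?Z W) H G \<and> (\<forall>z\<in>W. \<forall>r>N. G z r = 0)"
      using W by blast
  qed
  have f: "H (0, b) = f b" and g: "H (1, b) = g b" if b: "b \<in> topspace X" for b
  proof -
    note s = sel[OF b]
    have "G (sel b) (0, b) = A (sel b) b" "G (sel b) (1, b) = B (sel b) b"
      by (simp_all add: G_def fun_eq_iff)
    then show "H (0, b) = f b" "H (1, b) = g b"
      using lifts_proj[OF A, of "sel b" b] lifts_proj[OF B, of "sel b" b] s b by (auto simp: H_def)
  qed
  have hom: "homotopic_with (\<lambda>_. True) X proj_space_inf (\<lambda>b. H (0, b)) (\<lambda>b. H (1, b))"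
    unfolding homotopic_with_def using continuous_map_proj_space_inf[OF cont] by blast
  note c = homotopic_with_imp_continuous_maps[OF hom]
  have "homotopic_with (\<lambda>_. True) X proj_space_inf (\<lambda>b. H (0, b)) f"
    by (rule homotopic_with_equal) (use c f in auto)
  moreover have "homotopic_with (\<lambda>_. True) X proj_space_inf (\<lambda>b. H (1, b)) g"
    by (rule homotopic_with_equal) (use c g in auto)
  ultimately show ?thesis
    using hom by (meson homotopic_with_symD homotopic_with_trans)
qed

text \<open>Both maps are deformed to the map obtained from the first one by moving its coordinates
  beyond those of the second.\<close>

lemma homotopic_of_same_transitions:
  fixes A B :: "nat \<Rightarrow> 'a \<Rightarrow> nat \<Rightarrow> 'f::real_normed_field"
  assumes cover: "open_cover X n U"
    and A: "\<And>j. j \<le> n \<Longrightarrow> lifts (subtopology X (U j)) f (A j)"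
    and B: "\<And>j. j \<le> n \<Longrightarrow> lifts (subtopology X (U j)) g (B j)"
    and N: "\<And>j b r. j \<le> n \<Longrightarrow> b \<in> U j \<Longrightarrow> r > N \<Longrightarrow> A j b r = 0 \<and> B j b r = 0"
    and trans: "\<And>i j b. i \<le> n \<Longrightarrow> j \<le> n \<Longrightarrow> b \<in> U i \<Longrightarrow> b \<in> U j \<Longrightarrow>
      \<exists>c. \<forall>r. A i b r = c * A j b r \<and> B i b r = c * B j b r"
  shows "homotopic_with (\<lambda>_. True) X proj_space_inf f g"
proof -
  \<comment> \<open>The shift by \<open>Suc N\<close> moves the coordinates of \<open>A\<close> to
    the positions from \<open>Suc N\<close> to \<open>Suc (N + N)\<close>, where \<open>A\<close>
    and \<open>B\<close> vanish.\<close>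
  define S where "S j b r = (if r > N then A j b (r - Suc N) else 0)" for j b r
  have S_shift: "S j b (Suc (N + r)) = A j b r" for j b r by (simp add: S_def)
  define sel where "sel b = (SOME j. j \<le> n \<and> b \<in> U j)" for b
  have sel: "sel b \<le> n \<and> b \<in> U (sel b)" if "b \<in> topspace X" for b
    using open_coverD(3)[OF cover that] unfolding sel_def by (metis (mono_tags, lifting) someI_ex)
  define h where "h b = proj (S (sel b) b)" for b
  note sub = open_coverD(2)[OF cover]
  have A_nz: "\<exists>r\<le>N. A j b r \<noteq> 0" if "j \<le> n" "b \<in> U j" for j b
  proof (rule ccontr)
    assume "\<not> (\<exists>r\<le>N. A j b r \<noteq> 0)"
    then have "A j b r = 0" for r using N[OF that] by (cases "r \<le> N") auto
    then have "A j b = (\<lambda>_. 0)" by blast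
    then show False using lifts_nonzero[OF A[OF that(1)], of b] sub that by auto
  qed
  have B_nz: "\<exists>r\<le>N. B j b r \<noteq> 0" if "j \<le> n" "b \<in> U j" for j b
  proof (rule ccontr)
    assume "\<not> (\<exists>r\<le>N. B j b r \<noteq> 0)"
    then have "B j b r = 0" for r using N[OF that] by (cases "r \<le> N") auto
    then have "B j b = (\<lambda>_. 0)" by blast
    then show False using lifts_nonzero[OF B[OF that(1)], of b] sub that by auto
  qed
  have S_nz: "S j b \<noteq> (\<lambda>_. 0)" if "j \<le> n" "b \<in> U j" for j b
  proof
    assume "S j b = (\<lambda>_. 0)"
    then have "A j b r = 0" for r using S_shift[of j b r] by simp
    then show False using A_nz[OF that] by blast
  qed
  have S: "lifts (subtopology X (U j)) h (S j)" if j: "j \<le> n" for j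
    unfolding lifts_def
  proof (intro conjI allI ballI)
    show "continuous_map (subtopology X (U j)) euclidean (\<lambda>b. S j b r)" for r
      using lifts_continuous[OF A[OF j]] by (cases "r > N") (auto simp: S_def)
    fix b assume "b \<in> topspace (subtopology X (U j))"
    then have b: "b \<in> topspace X" "b \<in> U j" by auto
    show "S j b \<noteq> (\<lambda>_. 0)" using S_nz j b by blast
    obtain c where c: "\<And>r. A (sel b) b r = c * A j b r"
      using trans[of "sel b" j b] sel[OF b(1)] j b by blast
    have eq: "S (sel b) b = (\<lambda>r. c * S j b r)" by (simp add: S_def c fun_eq_iff)
    then have "c \<noteq> 0" using S_nz[of "sel b" b] sel[OF b(1)] by auto
    then show "h b = proj (S j b)" unfolding h_def eq by (rule proj_scale)
  qed
  have trans': "\<exists>c. \<forall>r. A i b r = c * A j b r \<and> S i b r = c * S j b r"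
    "\<exists>c. \<forall>r. S i b r = c * S j b r \<and> B i b r = c * B j b r"
    if "i \<le> n" "j \<le> n" "b \<in> U i" "b \<in> U j" for i j b
    using trans[OF that] by (auto simp: S_def)
  have "homotopic_with (\<lambda>_. True) X proj_space_inf f h"
  proof (rule homotopic_of_lifts[OF cover A S, where N = "Suc (N + N)"])
    fix j b and t :: real
    assume jb: "j \<le> n" "b \<in> U j" and t: "0 \<le> t" "t \<le> 1"
    obtain r where r: "r \<le> N" "A j b r \<noteq> 0" using A_nz[OF jb] by blast
    \<comment> \<open>\<open>A\<close> and \<open>S\<close> occupy disjoint positions, so a nonzero
      entry of \<open>A\<close> survives as long as \<open>1 - t\<close> is nonzero, and at
      \<open>t = 1\<close> its shifted copy does.\<close>
    show "\<exists>r. of_real (1 - t) * A j b r + of_real t * S j b r \<noteq> 0"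
    proof (cases "t = 1")
      case True
      then show ?thesis using r S_shift by (intro exI[of _ "Suc (N + r)"]) simp
    next
      case False
      then have "of_real (1 - t) \<noteq> (0 :: 'f)" by (simp add: of_real_eq_0_iff del: of_real_diff)
      then show ?thesis using r by (intro exI[of _ r]) (simp add: S_def)
    qed
  qed (use N trans' in \<open>auto simp: S_def\<close>)
  moreover have "homotopic_with (\<lambda>_. True) X proj_space_inf h g"
  proof (rule homotopic_of_lifts[OF cover S B, where N = "Suc (N + N)"])
    fix j b and t :: real
    assume jb: "j \<le> n" "b \<in> U j" and t: "0 \<le> t" "t \<le> 1"
    obtain r where r: "r \<le> N" "A j b r \<noteq> 0" using A_nz[OF jb] by blast
    obtain s where s: "s \<le> N" "B j b s \<noteq> 0" using B_nz[OF jb] by blast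
    show "\<exists>r. of_real (1 - t) * S j b r + of_real t * B j b r \<noteq> 0"
    proof (cases "t = 0")
      case True
      then show ?thesis using r S_shift by (intro exI[of _ "Suc (N + r)"]) simp
    next
      case False
      then show ?thesis using s by (intro exI[of _ s]) (simp add: S_def)
    qed
  qed (use N trans' in \<open>auto simp: S_def\<close>)
  ultimately show ?thesis by (rule homotopic_with_trans)
qed

section \<open>Lifting homotopies to homogeneous coordinates\<close>

text \<open>Only the parameter space \<open>W\<close> may be shrunk, while all of \<open>K\<close>
  is kept. This asymmetry allows interval factors to be added to \<open>K\<close> one at a
  time.\<close>

definition tube_lift :: "'k topology \<Rightarrow> 'w topology \<Rightarrow> ('k \<times> 'w \<Rightarrow> (nat \<Rightarrow> 'f::real_normed_field) set) \<Rightarrow> 'w \<Rightarrow> bool"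
  where "tube_lift K W q b \<longleftrightarrow>
    (\<exists>N G. openin W N \<and> b \<in> N \<and> lifts (subtopology (prod_topology K W) {z. snd z \<in> N}) q G)"

lemma lifts_subset:
  "lifts (subtopology Z S) q G \<Longrightarrow> T \<subseteq> S \<Longrightarrow> lifts (subtopology Z T) q G"
  using lifts_subtopology[of "subtopology Z S" q G T] by (simp add: subtopology_subtopology inf_absorb2)

lemma continuous_map_ident: "continuous_map X X (\<lambda>x. x)"
  using continuous_map_id by (simp add: id_def)

lemmas continuous_map_projections = continuous_map_pairedI
  continuous_map_fst_of[unfolded o_def] continuous_map_snd_of[unfolded o_def]

lemma tube_lift_point:
  assumes q: "continuous_map (prod_topology K W) proj_space_inf q" and b: "b \<in> topspace W"
    and K: "topspace K = {k}"
  shows "tube_lift K W q b"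
proof -
  have "(k, b) \<in> topspace (prod_topology K W)" using b K by simp
  from local_lift_exists[OF q this] obtain O' G where O': "openin (prod_topology K W) O'" "(k, b) \<in> O'"
    "lifts (subtopology (prod_topology K W) O') q G" .
  then obtain U N where UN: "openin K U" "openin W N" "k \<in> U" "b \<in> N" "U \<times> N \<subseteq> O'"
    unfolding openin_prod_topology_alt by meson
  have "lifts (subtopology (prod_topology K W) (topspace (prod_topology K W) \<inter> {z. snd z \<in> N})) q G"
    by (rule lifts_subset[OF O'(3)]) (use UN K in auto)
  then have "lifts (subtopology (prod_topology K W) {z. snd z \<in> N}) q G"
    by (metis subtopology_restrict)
  then show ?thesis using UN unfolding tube_lift_def by blast
qed

text \<open>Bisection of the new interval. The assumption on \<open>K\<close>, applied with the
  interval counted among the parameters, gives lifts over short subintervals; lifts over adjacent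
  subintervals are matched on the common slice and glued. This explains the type of the parameter
  space in that assumption.\<close>

lemma tube_lift_interval:
  fixes K :: "'k topology" and W :: "'w topology"
    and q :: "('k \<times> real) \<times> 'w \<Rightarrow> (nat \<Rightarrow> 'f::real_normed_field) set"
  assumes K: "\<And>(W :: (real \<times> 'w) topology) (q :: 'k \<times> (real \<times> 'w) \<Rightarrow> (nat \<Rightarrow> 'f) set) b.
      continuous_map (prod_topology K W) proj_space_inf q \<Longrightarrow> b \<in> topspace W \<Longrightarrow> tube_lift K W q b"
    and q: "continuous_map (prod_topology (prod_topology K (top_of_set {0..1})) W) proj_space_inf q"
    and b0: "b0 \<in> topspace W"
  shows "tube_lift (prod_topology K (top_of_set {0..1})) W q b0"
proof -
  let ?I = "top_of_set {0..1::real}"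
  define Z where "Z = prod_topology K (prod_topology ?I W)"
  have assoc: "continuous_map Z (prod_topology (prod_topology K ?I) W) (\<lambda>z. ((fst z, fst (snd z)), snd (snd z)))"
    unfolding Z_def by (intro continuous_map_projections; rule continuous_map_ident)
  have assoc': "continuous_map (prod_topology (prod_topology K ?I) W) Z (\<lambda>z. (fst (fst z), snd (fst z), snd z))"
    unfolding Z_def by (intro continuous_map_projections; rule continuous_map_ident)
  define p where "p z = q ((fst z, fst (snd z)), snd (snd z))" for z
  have p: "continuous_map Z proj_space_inf p"
    using continuous_map_compose[OF assoc q] by (simp add: o_def p_def[abs_def])
  \<comment> \<open>Intervals that leave [0,1] satisfy \<open>P\<close> vacuously;
    \<open>Bolzano\<close> asks for such intervals around the end points.\<close>
  define P where "P a b \<longleftrightarrow> (0 \<le> a \<longrightarrow> a \<le> b \<longrightarrow> b \<le> 1 \<longrightarrow>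
    (\<exists>N G. openin W N \<and> b0 \<in> N \<and> lifts (subtopology Z {z. fst (snd z) \<in> {a..b} \<and> snd (snd z) \<in> N}) p G))" for a b
  have "P 0 1"
  proof (rule Bolzano)
    fix a b c :: real
    assume Pab: "P a b" and Pbc: "P b c" and le: "a \<le> b" "b \<le> c"
    show "P a c"
      unfolding P_def
    proof (intro impI)
      assume bounds: "0 \<le> a" "c \<le> 1"
      obtain N1 G1 where 1: "openin W N1" "b0 \<in> N1"
        "lifts (subtopology Z {z. fst (snd z) \<in> {a..b} \<and> snd (snd z) \<in> N1}) p G1"
        using Pab bounds le unfolding P_def by (meson order_trans)
      obtain N2 G2 where 2: "openin W N2" "b0 \<in> N2"
        "lifts (subtopology Z {z. fst (snd z) \<in> {b..c} \<and> snd (snd z) \<in> N2}) p G2"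
        using Pbc bounds le unfolding P_def by (meson order_trans)
      define N where "N = N1 \<inter> N2"
      define S where "S = {z :: 'k \<times> real \<times> 'w. fst (snd z) = b \<and> snd (snd z) \<in> N}"
      have S1: "lifts (subtopology Z S) p G1"
        by (rule lifts_subset[OF 1(3)]) (use le in \<open>auto simp: S_def N_def\<close>)
      have S2: "lifts (subtopology Z S) p G2"
        by (rule lifts_subset[OF 2(3)]) (use le in \<open>auto simp: S_def N_def\<close>)
      obtain c0 where c0: "continuous_map (subtopology Z S) euclidean c0"
        "\<And>z. z \<in> topspace (subtopology Z S) \<Longrightarrow> c0 z \<noteq> 0"
        "\<And>z r. z \<in> topspace (subtopology Z S) \<Longrightarrow> G1 z r = c0 z * G2 z r"
        using lifts_ratio[OF S2 S1] by blast
      \<comment> \<open>The projection onto the slice at \<open>b\<close>. The factor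
        \<open>c0\<close> lives on this slice only; composed with \<sigma> it rescales all of
        \<open>G2\<close>, which then continues \<open>G1\<close>.\<close>
      define \<sigma> where "\<sigma> z = (fst z, b, snd (snd z))" for z :: "'k \<times> real \<times> 'w"
      define Z' where "Z' = subtopology Z {z. fst (snd z) \<in> {a..c} \<and> snd (snd z) \<in> N}"
      have top': "topspace Z' = {z. fst z \<in> topspace K \<and> fst (snd z) \<in> {a..c} \<and> snd (snd z) \<in> N \<and> snd (snd z) \<in> topspace W}"
        using bounds by (auto simp: Z'_def Z_def)
      have \<sigma>: "continuous_map Z' (subtopology Z S) \<sigma>"
        unfolding continuous_map_in_subtopology
      proof
        show "continuous_map Z' Z \<sigma>"
          unfolding Z'_def \<sigma>_def Z_def
          by (intro continuous_map_from_subtopology continuous_map_projections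
              continuous_map_const[THEN iffD2]; (rule continuous_map_ident)?) (use bounds le in auto)
        show "\<sigma> \<in> topspace Z' \<rightarrow> S" by (auto simp: top' \<sigma>_def S_def)
      qed
      have \<sigma>_top: "\<sigma> z \<in> topspace (subtopology Z S)" if "z \<in> topspace Z'" for z
        using \<sigma> that by (auto simp: continuous_map)
      define G where "G z = (if fst (snd z) \<le> b then G1 z else (\<lambda>r. c0 (\<sigma> z) * G2 z r))" for z
      have "lifts Z' p G"
        unfolding lifts_def
      proof (intro conjI allI ballI)
        fix r
        have eq: "(\<lambda>z. G z r) = (\<lambda>z. if fst (snd z) \<le> b then G1 z r else c0 (\<sigma> z) * G2 z r)"
          by (auto simp: G_def)
        show "continuous_map Z' euclidean (\<lambda>z. G z r)"
          unfolding eq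
        proof (rule continuous_map_cases_le)
          have "continuous_map Z' ?I (\<lambda>z. fst (snd z))"
            unfolding Z'_def Z_def
            by (intro continuous_map_from_subtopology continuous_map_projections; rule continuous_map_ident)
          then show "continuous_map Z' euclideanreal (\<lambda>z. fst (snd z))"
            by (rule continuous_map_into_fulltopology)
          show "continuous_map (subtopology Z' {z \<in> topspace Z'. fst (snd z) \<le> b}) euclidean (\<lambda>z. G1 z r)"
            unfolding Z'_def subtopology_subtopology
            by (rule continuous_map_from_subtopology_mono[OF lifts_continuous[OF 1(3)]]) (auto simp: N_def)
          have "continuous_map (subtopology Z' {z \<in> topspace Z'. b \<le> fst (snd z)}) euclidean (\<lambda>z. G2 z r)"
            unfolding Z'_def subtopology_subtopology
            by (rule continuous_map_from_subtopology_mono[OF lifts_continuous[OF 2(3)]]) (auto simp: N_def)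
          moreover have "continuous_map (subtopology Z' {z \<in> topspace Z'. b \<le> fst (snd z)}) euclidean (\<lambda>z. c0 (\<sigma> z))"
            using continuous_map_compose[OF \<sigma> c0(1)] by (simp add: o_def continuous_map_from_subtopology)
          ultimately show "continuous_map (subtopology Z' {z \<in> topspace Z'. b \<le> fst (snd z)}) euclidean (\<lambda>z. c0 (\<sigma> z) * G2 z r)"
            by (rule continuous_map_mult[rotated])
          fix z assume z: "z \<in> topspace Z'" "fst (snd z) = b"
          then have "\<sigma> z = z" by (auto simp: \<sigma>_def prod_eq_iff)
          then show "G1 z r = c0 (\<sigma> z) * G2 z r" using c0(3) \<sigma>_top[OF z(1)] by simp
        qed simp
      next
        fix z assume z: "z \<in> topspace Z'"
        have c0z: "c0 (\<sigma> z) \<noteq> 0" using c0(2) \<sigma>_top[OF z] by blast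
        have "G z \<noteq> (\<lambda>_. 0) \<and> p z = proj (G z)"
        proof (cases "fst (snd z) \<le> b")
          case True
          then have "z \<in> topspace (subtopology Z {z. fst (snd z) \<in> {a..b} \<and> snd (snd z) \<in> N1})"
            using z by (auto simp: Z'_def N_def)
          then show ?thesis
            using lifts_nonzero[OF 1(3)] lifts_proj[OF 1(3)] True by (simp add: G_def)
        next
          case False
          then have "z \<in> topspace (subtopology Z {z. fst (snd z) \<in> {b..c} \<and> snd (snd z) \<in> N2})"
            using z by (auto simp: Z'_def N_def)
          then have "G2 z \<noteq> (\<lambda>_. 0)" "p z = proj (G2 z)"
            using lifts_nonzero[OF 2(3)] lifts_proj[OF 2(3)] by blast+
          then show ?thesis using False c0z by (auto simp: G_def proj_scale fun_eq_iff)
        qed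
        then show "G z \<noteq> (\<lambda>_. 0)" "p z = proj (G z)" by blast+
      qed
      moreover have "openin W N" "b0 \<in> N" using 1 2 by (auto simp: N_def)
      ultimately show "\<exists>N G. openin W N \<and> b0 \<in> N \<and>
          lifts (subtopology Z {z. fst (snd z) \<in> {a..c} \<and> snd (snd z) \<in> N}) p G"
        unfolding Z'_def by blast
    qed
  next
    fix x :: real assume x: "0 \<le> x" "x \<le> 1"
    \<comment> \<open>Here the interval belongs to the parameters; a box inside the neighbourhood
      obtained yields the admissible length \<open>d\<close>.\<close>
    have "tube_lift K (prod_topology ?I W) p (x, b0)"
      using p x b0 unfolding Z_def by (intro K) auto
    then obtain N G where N: "openin (prod_topology ?I W) N" "(x, b0) \<in> N"
      "lifts (subtopology Z {z. snd z \<in> N}) p G"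
      unfolding tube_lift_def Z_def by blast
    then obtain U V where UV: "openin ?I U" "openin W V" "x \<in> U" "b0 \<in> V" "U \<times> V \<subseteq> N"
      unfolding openin_prod_topology_alt by meson
    then obtain d where d: "d > 0" "\<And>y. y \<in> {0..1} \<Longrightarrow> dist y x < d \<Longrightarrow> y \<in> U"
      unfolding openin_euclidean_subtopology_iff by blast
    have "P a b" if ab: "a \<le> x" "x \<le> b" "b - a < d" for a b
      unfolding P_def
    proof (intro impI)
      assume "0 \<le> a" "b \<le> 1"
      have "lifts (subtopology Z {z. fst (snd z) \<in> {a..b} \<and> snd (snd z) \<in> V}) p G"
      proof (rule lifts_subset[OF N(3)], safe)
        fix k s w assume "fst (snd (k, s, w)) \<in> {a..b}" "snd (snd (k, s, w)) \<in> V"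
        then have "s \<in> U" "w \<in> V" using d(2)[of s] ab \<open>0 \<le> a\<close> \<open>b \<le> 1\<close> by (auto simp: dist_real_def)
        then show "snd (k, s, w) \<in> N" using UV by auto
      qed
      then show "\<exists>N G. openin W N \<and> b0 \<in> N \<and>
          lifts (subtopology Z {z. fst (snd z) \<in> {a..b} \<and> snd (snd z) \<in> N}) p G"
        using UV by blast
    qed
    then show "\<exists>d>0. \<forall>a b. a \<le> x \<and> x \<le> b \<and> b - a < d \<longrightarrow> P a b"
      using d(1) by blast
  qed simp
  then obtain N G where N: "openin W N" "b0 \<in> N"
    "lifts (subtopology Z {z. fst (snd z) \<in> {0..1} \<and> snd (snd z) \<in> N}) p G"
    by (auto simp: P_def)
  have "continuous_map (subtopology (prod_topology (prod_topology K ?I) W) {z. snd z \<in> N})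
      (subtopology Z {z. fst (snd z) \<in> {0..1} \<and> snd (snd z) \<in> N}) (\<lambda>z. (fst (fst z), snd (fst z), snd z))"
    unfolding continuous_map_in_subtopology
    using assoc' by (auto intro: continuous_map_from_subtopology)
  from lifts_compose[OF N(3) this] N(1,2) show ?thesis
    unfolding tube_lift_def by (auto simp: p_def)
qed

text \<open>Each step uses the previous one at a different type of parameters, so the three cases
  are obtained by successive instantiation. Dimension 3 is needed for the homotopy \<open>h\<close>
  along a map from a square.\<close>

lemma tube_lift_interval_1:
  fixes W :: "'w topology" and q :: "(unit \<times> real) \<times> 'w \<Rightarrow> (nat \<Rightarrow> 'f::real_normed_field) set"
  assumes "continuous_map (prod_topology (prod_topology (discrete_topology {()}) (top_of_set {0..1})) W) proj_space_inf q"
    "b \<in> topspace W"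
  shows "tube_lift (prod_topology (discrete_topology {()}) (top_of_set {0..1})) W q b"
  by (rule tube_lift_interval[OF tube_lift_point assms]) auto

lemma tube_lift_interval_2:
  fixes W :: "'w topology" and q :: "((unit \<times> real) \<times> real) \<times> 'w \<Rightarrow> (nat \<Rightarrow> 'f::real_normed_field) set"
  assumes "continuous_map (prod_topology (prod_topology (prod_topology (discrete_topology {()}) (top_of_set {0..1}))
      (top_of_set {0..1})) W) proj_space_inf q" "b \<in> topspace W"
  shows "tube_lift (prod_topology (prod_topology (discrete_topology {()}) (top_of_set {0..1})) (top_of_set {0..1})) W q b"
  by (rule tube_lift_interval[OF tube_lift_interval_1 assms])

lemma tube_lift_interval_3:
  fixes W :: "'w topology" and q :: "(((unit \<times> real) \<times> real) \<times> real) \<times> 'w \<Rightarrow> (nat \<Rightarrow> 'f::real_normed_field) set"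
  assumes "continuous_map (prod_topology (prod_topology (prod_topology (prod_topology (discrete_topology {()})
      (top_of_set {0..1})) (top_of_set {0..1})) (top_of_set {0..1})) W) proj_space_inf q" "b \<in> topspace W"
  shows "tube_lift (prod_topology (prod_topology (prod_topology (discrete_topology {()}) (top_of_set {0..1}))
      (top_of_set {0..1})) (top_of_set {0..1})) W q b"
  by (rule tube_lift_interval[OF tube_lift_interval_2 assms])

lemma homotopy_lift_exists:
  fixes W :: "'w topology" and q :: "real \<times> 'w \<Rightarrow> (nat \<Rightarrow> 'f::real_normed_field) set"
  assumes q: "continuous_map (prod_topology (top_of_set {0..1}) W) proj_space_inf q" and b: "b \<in> topspace W"
  obtains N G where "openin W N" "b \<in> N" "lifts (prod_topology (top_of_set {0..1}) (subtopology W N)) q G"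
proof -
  let ?K = "prod_topology (discrete_topology {()}) (top_of_set {0..1::real})"
  have "continuous_map (prod_topology ?K W) (prod_topology (top_of_set {0..1}) W) (\<lambda>z. (snd (fst z), snd z))"
    by (intro continuous_map_projections; rule continuous_map_ident)
  then have "continuous_map (prod_topology ?K W) proj_space_inf (q \<circ> (\<lambda>z. (snd (fst z), snd z)))"
    using q by (rule continuous_map_compose)
  from tube_lift_interval_1[OF this b] obtain N G where N: "openin W N" "b \<in> N"
    "lifts (subtopology (prod_topology ?K W) {z. snd z \<in> N}) (q \<circ> (\<lambda>z. (snd (fst z), snd z))) G"
    unfolding tube_lift_def by blast
  have "continuous_map (prod_topology (top_of_set {0..1}) (subtopology W N)) (prod_topology ?K W)
      (\<lambda>z. (((), fst z), snd z))"
    by (intro continuous_map_pairedI continuous_map_fst continuous_map_const[THEN iffD2]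
        continuous_map_into_fulltopology[OF continuous_map_snd]) auto
  then have "continuous_map (prod_topology (top_of_set {0..1}) (subtopology W N))
      (subtopology (prod_topology ?K W) {z. snd z \<in> N}) (\<lambda>z. (((), fst z), snd z))"
    by (auto simp: continuous_map_in_subtopology)
  from lifts_compose[OF N(3) this] N(1,2) that show ?thesis by (auto simp: o_def)
qed

text \<open>Over a one-point parameter space a tube is the whole cube.\<close>

lemma cube_lift_exists:
  fixes q :: "real \<times> real \<times> real \<Rightarrow> (nat \<Rightarrow> 'f::real_normed_field) set"
  assumes q: "continuous_map (top_of_set ({0..1} \<times> {0..1} \<times> {0..1})) proj_space_inf q"
  obtains G where "lifts (top_of_set ({0..1} \<times> {0..1} \<times> {0..1})) q G"
proof -
  let ?I = "top_of_set {0..1::real}" and ?C = "top_of_set ({0..1::real} \<times> {0..1::real} \<times> {0..1::real})"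
  let ?K = "prod_topology (prod_topology (prod_topology (discrete_topology {()}) ?I) ?I) ?I"
  have C: "?C = prod_topology ?I (prod_topology ?I ?I)"
    by (simp add: prod_topology_subtopology_eu)
  have "continuous_map (prod_topology ?K (discrete_topology {()})) ?C
      (\<lambda>z. (snd (fst (fst (fst z))), snd (fst (fst z)), snd (fst z)))"
    unfolding C by (intro continuous_map_projections; rule continuous_map_ident)
  then have "continuous_map (prod_topology ?K (discrete_topology {()})) proj_space_inf
      (q \<circ> (\<lambda>z. (snd (fst (fst (fst z))), snd (fst (fst z)), snd (fst z))))"
    using q by (rule continuous_map_compose)
  from tube_lift_interval_3[OF this] obtain N G where N: "() \<in> N"
    "lifts (subtopology (prod_topology ?K (discrete_topology {()})) {z. snd z \<in> N})
      (q \<circ> (\<lambda>z. (snd (fst (fst (fst z))), snd (fst (fst z)), snd (fst z)))) G"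
    unfolding tube_lift_def by auto
  have "continuous_map ?C (prod_topology ?K (discrete_topology {()}))
      (\<lambda>z. (((((), fst z), fst (snd z)), snd (snd z)), ()))"
    unfolding C
    by (intro continuous_map_projections continuous_map_const[THEN iffD2]; (rule continuous_map_ident)?) auto
  then have "continuous_map ?C (subtopology (prod_topology ?K (discrete_topology {()})) {z. snd z \<in> N})
      (\<lambda>z. (((((), fst z), fst (snd z)), snd (snd z)), ()))"
    using N(1) by (auto simp: continuous_map_in_subtopology)
  from lifts_compose[OF N(2) this] that show ?thesis by (auto simp: o_def)
qed

text \<open>A map on the square is pulled back to the cube along a projection, lifted there, and
  restricted to the face with last coordinate 0.\<close>

lemma square_lift_exists:
  fixes q :: "real \<times> real \<Rightarrow> (nat \<Rightarrow> 'f::real_normed_field) set"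
  assumes q: "continuous_map (top_of_set ({0..1} \<times> {0..1})) proj_space_inf q"
  obtains G where "lifts (top_of_set ({0..1} \<times> {0..1})) q G"
proof -
  let ?I = "top_of_set {0..1::real}" and ?C = "top_of_set ({0..1::real} \<times> {0..1::real} \<times> {0..1::real})"
  have C: "?C = prod_topology ?I (prod_topology ?I ?I)" "top_of_set ({0..1} \<times> {0..1}) = prod_topology ?I ?I"
    by (simp_all add: prod_topology_subtopology_eu)
  have "continuous_map ?C (top_of_set ({0..1} \<times> {0..1})) (\<lambda>z. (fst z, fst (snd z)))"
    unfolding C by (intro continuous_map_projections; rule continuous_map_ident)
  then have "continuous_map ?C proj_space_inf (q \<circ> (\<lambda>z. (fst z, fst (snd z))))"
    using q by (rule continuous_map_compose)
  then obtain G where G: "lifts ?C (q \<circ> (\<lambda>z. (fst z, fst (snd z)))) G" by (rule cube_lift_exists)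
  have "continuous_map (top_of_set ({0..1} \<times> {0..1})) ?C (\<lambda>z. (fst z, snd z, 0))"
    unfolding C
    by (intro continuous_map_pairedI continuous_map_fst continuous_map_snd continuous_map_const[THEN iffD2]) auto
  from lifts_compose[OF G this] that show ?thesis by (auto simp: o_def)
qed

section \<open>The real classifying maps\<close>

lemma nerve_subset: "s \<in> nerve n U \<Longrightarrow> t \<subseteq> s \<Longrightarrow> t \<noteq> {} \<Longrightarrow> t \<in> nerve n U"
  unfolding nerve_def by blast

lemma nerveI: "s \<noteq> {} \<Longrightarrow> s \<subseteq> {..n} \<Longrightarrow> (\<And>r. r \<in> s \<Longrightarrow> b \<in> U r) \<Longrightarrow> s \<in> nerve n U"
  unfolding nerve_def by blast

lemma partition_dominatedD:
  assumes "partition_dominated_by X n U \<phi>"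
  shows "r \<le> n \<Longrightarrow> continuous_map X euclideanreal (\<phi> r)"
    "r \<le> n \<Longrightarrow> b \<in> topspace X \<Longrightarrow> 0 \<le> \<phi> r b"
    "r \<le> n \<Longrightarrow> b \<in> topspace X \<Longrightarrow> \<phi> r b \<noteq> 0 \<Longrightarrow> b \<in> U r"
    "b \<in> topspace X \<Longrightarrow> (\<Sum>r\<le>n. \<phi> r b) = 1"
    "b \<in> topspace X \<Longrightarrow> \<exists>r\<le>n. \<phi> r b > 0"
proof -
  show "r \<le> n \<Longrightarrow> continuous_map X euclideanreal (\<phi> r)"
    "r \<le> n \<Longrightarrow> b \<in> topspace X \<Longrightarrow> 0 \<le> \<phi> r b"
    "r \<le> n \<Longrightarrow> b \<in> topspace X \<Longrightarrow> \<phi> r b \<noteq> 0 \<Longrightarrow> b \<in> U r"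
    "b \<in> topspace X \<Longrightarrow> (\<Sum>r\<le>n. \<phi> r b) = 1"
    using assms by (auto simp: partition_dominated_by_def)
  assume b: "b \<in> topspace X"
  have "\<not> (\<forall>r\<le>n. \<phi> r b \<le> 0)"
  proof
    assume "\<forall>r\<le>n. \<phi> r b \<le> 0"
    then have "(\<Sum>r\<le>n. \<phi> r b) \<le> 0" by (intro sum_nonpos) auto
    then show False using \<open>b \<in> topspace X \<Longrightarrow> (\<Sum>r\<le>n. \<phi> r b) = 1\<close> b by simp
  qed
  then show "\<exists>r\<le>n. \<phi> r b > 0" by (auto simp: not_le)
qed

definition bit_sign :: "bit \<Rightarrow> real" where "bit_sign x = (-1) ^ of_bool (x = 1)"

lemma bit_sign_simps [simp]: "bit_sign 0 = 1" "bit_sign 1 = -1"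
  by (simp_all add: bit_sign_def)

lemma bit_sign_nonzero [simp]: "bit_sign x \<noteq> 0"
  by (cases x) simp_all

lemma bit_sign_add: "bit_sign (x + y) = bit_sign x * bit_sign y"
  by (cases x; cases y) simp_all

lemma cocycle_singleton:
  assumes "\<tau> \<in> cocycles K 1"
  shows "\<tau> {i} = 0"
  using assms by (auto simp: cocycles_iff carrier_cochain_group simplices_def)

text \<open>Signs disappear modulo 2, so the identity is symmetric in the three indices. For
  repeated indices it rests on \<open>\<tau> {i} = 0\<close> and on the vanishing of
  doubles.\<close>

lemma bit_cocycle:
  fixes \<tau> :: "'v::linorder set \<Rightarrow> bit"
  assumes \<tau>: "\<tau> \<in> cocycles K 1" and K: "{i, j, k} \<in> K"
  shows "\<tau> {i, k} = \<tau> {i, j} + \<tau> {j, k}"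
proof (cases "distinct [i, j, k]")
  case True
  then have "card (set [i, j, k]) = 3" by (subst distinct_card) auto
  then have s: "{i, j, k} \<in> simplices K 2" using K by (simp add: simplices_def)
  obtain a b c where abc: "a < b" "b < c" "{i, j, k} = {a, b, c}" "{a, b, c} \<in> K"
    by (rule simplices_2E[OF s])
  have "coboundary K 1 \<tau> {a, b, c} = 0"
    using \<tau> s abc(3) by (simp add: cocycles_iff numeral_2_eq_2)
  then have *: "\<tau> {b, c} + \<tau> {a, c} + \<tau> {a, b} = 0"
    using coboundary_1[OF abc(1,2,4), of \<tau>] by simp
  have "(i = a \<and> j = b \<and> k = c) \<or> (i = a \<and> j = c \<and> k = b) \<or> (i = b \<and> j = a \<and> k = c) \<or>
      (i = b \<and> j = c \<and> k = a) \<or> (i = c \<and> j = a \<and> k = b) \<or> (i = c \<and> j = b \<and> k = a)"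
  proof -
    have "i \<in> {a, b, c}" "j \<in> {a, b, c}" "k \<in> {a, b, c}"
      unfolding abc(3)[symmetric] by simp_all
    then show ?thesis using True by (elim insertE emptyE) simp_all
  qed
  moreover have comm: "\<tau> {b, a} = \<tau> {a, b}" "\<tau> {c, a} = \<tau> {a, c}" "\<tau> {c, b} = \<tau> {b, c}"
    by (simp_all add: insert_commute)
  ultimately show ?thesis
    using * by (elim disjE conjE; cases "\<tau> {b, c}"; cases "\<tau> {a, c}"; cases "\<tau> {a, b}") (simp_all only: comm, simp_all)
next
  case False
  then show ?thesis
    using cocycle_singleton[OF \<tau>] by (cases "\<tau> {i, j}") (auto simp: insert_commute)
qed

lemma bit_coboundary_0:
  fixes \<epsilon> :: "'v::linorder set \<Rightarrow> bit"
  assumes "{i, j} \<in> K"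
  shows "coboundary K 0 \<epsilon> {i, j} = \<epsilon> {i} + \<epsilon> {j}"
proof -
  consider "i < j" | "j < i" | "i = j" by fastforce
  then show ?thesis
  proof cases
    case 1
    then show ?thesis using coboundary_0[of i j K \<epsilon>] assms by (cases "\<epsilon> {i}"; cases "\<epsilon> {j}") auto
  next
    case 2
    then show ?thesis using coboundary_0[of j i K \<epsilon>] assms by (simp add: insert_commute)
  next
    case 3
    then show ?thesis by (cases "\<epsilon> {j}") (auto simp: coboundary_def simplices_def)
  qed
qed

section \<open>Coordinates and transition signs of \<open>f_tau\<close>\<close>

definition tau_lift :: "nat \<Rightarrow> (nat \<Rightarrow> 'a \<Rightarrow> real) \<Rightarrow> (nat set \<Rightarrow> bit) \<Rightarrow> nat \<Rightarrow> 'a \<Rightarrow> nat \<Rightarrow> real" where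
  "tau_lift n \<phi> \<tau> j b r = (if r \<le> n then bit_sign (\<tau> {r, j}) * sqrt (\<phi> r b) else 0)"

lemma f_tau_on_eq: "f_tau_on n \<phi> \<tau> j b = proj (tau_lift n \<phi> \<tau> j b)"
  unfolding f_tau_on_def tau_lift_def bit_sign_def ..

text \<open>Only coordinates with \<open>\<phi> r b\<close> nonzero count, and these force
  \<open>b \<in> U r\<close>. Then \<open>r\<close>, \<open>i\<close>, \<open>j\<close> form a
  simplex of the nerve, and the cocycle identity applies.\<close>

lemma tau_lift_transition:
  assumes "partition_dominated_by X n U \<phi>" "open_cover X n U" "\<tau> \<in> cocycles (nerve n U) 1"
    and "i \<le> n" "j \<le> n" "b \<in> U i" "b \<in> U j"
  shows "tau_lift n \<phi> \<tau> i b r = bit_sign (\<tau> {i, j}) * tau_lift n \<phi> \<tau> j b r"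
proof (cases "r \<le> n \<and> \<phi> r b \<noteq> 0")
  case True
  then have "b \<in> U r"
    using partition_dominatedD(3)[OF assms(1)] open_coverD(2)[OF assms(2)] assms by blast
  then have "{r, j, i} \<in> nerve n U" using assms True by (intro nerveI[where b = b]) auto
  from bit_cocycle[OF assms(3) this] have "\<tau> {r, i} = \<tau> {i, j} + \<tau> {r, j}"
    by (cases "\<tau> {i, j}"; cases "\<tau> {r, j}") (auto simp: insert_commute)
  then have "bit_sign (\<tau> {r, i}) = bit_sign (\<tau> {i, j}) * bit_sign (\<tau> {r, j})"
    by (metis bit_sign_add)
  then show ?thesis by (simp add: tau_lift_def)
qed (auto simp: tau_lift_def)

lemma tau_lift_nonzero:
  assumes "partition_dominated_by X n U \<phi>" "b \<in> topspace X"
  shows "tau_lift n \<phi> \<tau> j b \<noteq> (\<lambda>_. 0)"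
proof -
  obtain r where "r \<le> n" "\<phi> r b > 0" using partition_dominatedD(5)[OF assms] by blast
  then have "tau_lift n \<phi> \<tau> j b r \<noteq> 0" by (simp add: tau_lift_def)
  then show ?thesis by metis
qed

lemma lifts_f_tau:
  assumes "partition_dominated_by X n U \<phi>" "open_cover X n U" "\<tau> \<in> cocycles (nerve n U) 1" "j \<le> n"
  shows "lifts (subtopology X (U j)) (f_tau n U \<phi> \<tau>) (tau_lift n \<phi> \<tau> j)"
proof (rule lifts_of_transitions[OF assms(2) _ tau_lift_nonzero[OF assms(1)] _ _ assms(4)])
  fix j r
  show "continuous_map (subtopology X (U j)) euclidean (\<lambda>b. tau_lift n \<phi> \<tau> j b r)"
    using partition_dominatedD(1)[OF assms(1), of r]
    by (cases "r \<le> n")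
      (auto simp: tau_lift_def intro!: continuous_map_mult continuous_map_from_subtopology continuous_map_sqrt)
next
  fix i j b assume "i \<le> n" "j \<le> n" "b \<in> U i" "b \<in> U j"
  then show "\<exists>c. \<forall>r. tau_lift n \<phi> \<tau> i b r = c * tau_lift n \<phi> \<tau> j b r"
    using tau_lift_transition[OF assms(1-3)] by blast
qed (simp_all add: f_tau_def f_tau_on_eq)

lemma f_tau_eq:
  assumes "partition_dominated_by X n U \<phi>" "open_cover X n U" "\<tau> \<in> cocycles (nerve n U) 1" "j \<le> n" "b \<in> U j"
  shows "f_tau n U \<phi> \<tau> b = f_tau_on n \<phi> \<tau> j b"
  using lifts_proj[OF lifts_f_tau[OF assms(1-4)], of b] open_coverD(2)[OF assms(2,4)] assms(5)
  by (auto simp: f_tau_on_eq)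

lemma continuous_f_tau:
  assumes "partition_dominated_by X n U \<phi>" "open_cover X n U" "\<tau> \<in> cocycles (nerve n U) 1"
  shows "continuous_map X (RP n) (f_tau n U \<phi> \<tau>)"
proof (rule continuous_map_of_local_lifts)
  fix b assume "b \<in> topspace X"
  then obtain j where "j \<le> n" "b \<in> U j" using open_coverD(3)[OF assms(2)] by blast
  then show "\<exists>W G. openin X W \<and> b \<in> W \<and> lifts (subtopology X W) (f_tau n U \<phi> \<tau>) G \<and> (\<forall>z\<in>W. \<forall>r>n. G z r = 0)"
    using lifts_f_tau[OF assms] open_coverD(1)[OF assms(2)]
    by (intro exI[of _ "U j"] exI[of _ "tau_lift n \<phi> \<tau> j"]) (auto simp: tau_lift_def)
qed

lemma homotopic_f_tau_cohomologous:
  assumes "partition_dominated_by X n U \<phi>" "open_cover X n U" "\<tau> \<in> cocycles (nerve n U) 1"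
    and \<tau>': "\<tau>' \<in> cocycles (nerve n U) 1" "\<tau>' = (\<lambda>s. coboundary (nerve n U) 0 \<epsilon> s + \<tau> s)"
  shows "homotopic_with (\<lambda>_. True) X RP_inf (f_tau n U \<phi> \<tau>') (f_tau n U \<phi> \<tau>)"
proof (rule homotopic_of_same_transitions[OF assms(2), where N = n
      and A = "\<lambda>j b r. bit_sign (\<epsilon> {j}) * tau_lift n \<phi> \<tau>' j b r" and B = "tau_lift n \<phi> \<tau>"])
  fix i j b assume ij: "i \<le> n" "j \<le> n" "b \<in> U i" "b \<in> U j"
  have K: "{i, j} \<in> nerve n U" using ij by (intro nerveI[where b = b]) auto
  have s: "bit_sign (\<tau>' {i, j}) = bit_sign (\<epsilon> {i}) * bit_sign (\<epsilon> {j}) * bit_sign (\<tau> {i, j})"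
    by (simp add: \<tau>'(2) bit_coboundary_0[OF K] bit_sign_add del: add_bit_eq_xor)
  \<comment> \<open>The sign of \<open>\<epsilon> {i}\<close> occurs twice and cancels; the sign of
    \<open>\<epsilon> {j}\<close> is absorbed by the rescaled coordinates over
    \<open>U j\<close>.\<close>
  have "bit_sign (\<epsilon> {i}) * tau_lift n \<phi> \<tau>' i b r = bit_sign (\<tau> {i, j}) * (bit_sign (\<epsilon> {j}) * tau_lift n \<phi> \<tau>' j b r)" for r
    unfolding tau_lift_transition[OF assms(1,2) \<tau>'(1) ij] s
    by (cases "\<epsilon> {i}") auto
  then show "\<exists>c. \<forall>r. bit_sign (\<epsilon> {i}) * tau_lift n \<phi> \<tau>' i b r = c * (bit_sign (\<epsilon> {j}) * tau_lift n \<phi> \<tau>' j b r) \<and>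
      tau_lift n \<phi> \<tau> i b r = c * tau_lift n \<phi> \<tau> j b r"
    using tau_lift_transition[OF assms(1-3) ij] by blast
qed (use lifts_f_tau[OF assms(1-3)] lifts_scale[OF lifts_f_tau[OF assms(1,2) \<tau>'(1)]] in \<open>auto simp: tau_lift_def\<close>)

section \<open>Cochains modulo 2 under refinement\<close>

lemma bit_cochain_pullback:
  fixes \<tau> :: "'v::linorder set \<Rightarrow> bit" and \<rho> :: "'w::linorder \<Rightarrow> 'v"
  assumes "\<And>v. \<tau> {v} = 0" "{i, j} \<in> L"
  shows "cochain_pullback L 1 \<rho> \<tau> {i, j} = \<tau> {\<rho> i, \<rho> j}"
proof -
  have less: "cochain_pullback L 1 \<rho> \<tau> {i, j} = \<tau> {\<rho> i, \<rho> j}" if "i < j" "{i, j} \<in> L" for i j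
  proof -
    have "{i, j} \<in> simplices L 1" using that by (simp add: simplices_def)
    then show ?thesis
      using assms(1)
      by (simp only: cochain_pullback_def if_True sorted_list_of_set_insert2[OF that(1)])
        (auto simp: alternating_def)
  qed
  consider "i < j" | "j < i" | "i = j" by fastforce
  then show ?thesis
  proof cases
    case 3
    then show ?thesis using assms(1) by (simp add: cochain_pullback_def simplices_def)
  qed (use less[of i j] less[of j i] assms(2) in \<open>auto simp: insert_commute\<close>)
qed

lemma bit_pullback_cocycle:
  fixes \<tau> :: "'v::linorder set \<Rightarrow> bit" and \<rho> :: "'w::linorder \<Rightarrow> 'v"
  assumes \<tau>: "\<tau> \<in> cocycles K 1" and \<rho>: "\<And>s. s \<in> L \<Longrightarrow> \<rho> ` s \<in> K"
    and L: "\<And>s t. s \<in> L \<Longrightarrow> t \<subseteq> s \<Longrightarrow> t \<noteq> {} \<Longrightarrow> t \<in> L"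
  shows "cochain_pullback L 1 \<rho> \<tau> \<in> cocycles L 1"
  unfolding cocycles_iff carrier_cochain_group
proof (intro conjI ballI)
  fix s assume "s \<in> simplices L (Suc 1)"
  then have two: "s \<in> simplices L 2" by (simp add: numeral_2_eq_2)
  obtain i j k where s: "i < j" "j < k" "s = {i, j, k}" "{i, j, k} \<in> L"
    by (rule simplices_2E[OF two])
  then have "{i, j} \<in> L" "{i, k} \<in> L" "{j, k} \<in> L" by (auto intro: L)
  moreover have "\<tau> {\<rho> i, \<rho> k} = \<tau> {\<rho> i, \<rho> j} + \<tau> {\<rho> j, \<rho> k}"
    using \<rho>[OF s(4)] by (intro bit_cocycle[OF \<tau>]) simp
  ultimately have "coboundary L 1 (cochain_pullback L 1 \<rho> \<tau>) {i, j, k} = 0"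
    using coboundary_1[OF s(1,2,4), of "cochain_pullback L 1 \<rho> \<tau>"]
      bit_cochain_pullback[of \<tau> _ _ L \<rho>] cocycle_singleton[OF \<tau>]
    by (cases "\<tau> {\<rho> i, \<rho> j}"; cases "\<tau> {\<rho> j, \<rho> k}") simp_all
  then show "coboundary L 1 (cochain_pullback L 1 \<rho> \<tau>) s = 0" by (simp add: s(3))
qed (simp add: cochain_pullback_def)

lemma bit_pullback_coboundary:
  fixes \<beta> \<tau> :: "'v::linorder set \<Rightarrow> bit" and \<rho> :: "'w::linorder \<Rightarrow> 'v"
  assumes \<rho>: "\<And>s. s \<in> L \<Longrightarrow> \<rho> ` s \<in> K"
    and L: "\<And>s t. s \<in> L \<Longrightarrow> t \<subseteq> s \<Longrightarrow> t \<noteq> {} \<Longrightarrow> t \<in> L"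
    and \<tau>: "\<And>v. \<tau> {v} = 0" and \<beta>: "\<beta> \<in> coboundaries K 1"
  shows "(\<lambda>s. cochain_pullback L 1 \<rho> (\<lambda>s. \<beta> s + \<tau> s) s - cochain_pullback L 1 \<rho> \<tau> s) \<in> coboundaries L 1"
proof -
  obtain \<epsilon> :: "'v set \<Rightarrow> bit" where \<epsilon>: "\<beta> = coboundary K 0 \<epsilon>" using \<beta> coboundaries_Suc[of K 0] by auto
  \<comment> \<open>The pullback of \<epsilon> along \<rho>, cut off outside the vertices of
    \<open>L\<close> so that it is a cochain.\<close>
  define \<epsilon>' where "\<epsilon>' s = (if s \<in> simplices L 0 then \<epsilon> (\<rho> ` s) else 0)" for s
  have \<beta>0: "\<beta> {v} = 0" for v by (simp add: \<epsilon> coboundary_def simplices_def)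
  have "cochain_pullback L 1 \<rho> (\<lambda>s. \<beta> s + \<tau> s) s - cochain_pullback L 1 \<rho> \<tau> s = coboundary L 0 \<epsilon>' s" for s
  proof (cases "s \<in> simplices L 1")
    case True
    obtain i j where s: "i < j" "s = {i, j}" "{i, j} \<in> L" by (rule simplices_1E[OF True])
    then have "{i} \<in> simplices L 0" "{j} \<in> simplices L 0" by (auto simp: simplices_def intro: L)
    then have "coboundary L 0 \<epsilon>' {i, j} = \<epsilon> {\<rho> i} + \<epsilon> {\<rho> j}"
      using bit_coboundary_0[OF s(3), of \<epsilon>'] by (simp add: \<epsilon>'_def)
    moreover have "\<beta> {\<rho> i, \<rho> j} = \<epsilon> {\<rho> i} + \<epsilon> {\<rho> j}"
      unfolding \<epsilon> using \<rho>[OF s(3)] by (intro bit_coboundary_0) simp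
    moreover have "cochain_pullback L 1 \<rho> (\<lambda>s. \<beta> s + \<tau> s) {i, j} = \<beta> {\<rho> i, \<rho> j} + \<tau> {\<rho> i, \<rho> j}"
      by (intro bit_cochain_pullback s) (simp add: \<beta>0 \<tau>)
    moreover have "cochain_pullback L 1 \<rho> \<tau> {i, j} = \<tau> {\<rho> i, \<rho> j}"
      by (intro bit_cochain_pullback s \<tau>)
    ultimately show ?thesis
      by (cases "\<tau> {\<rho> i, \<rho> j}") (simp_all add: s(2))
  next
    case False
    then show ?thesis by (simp add: cochain_pullback_def coboundary_def)
  qed
  moreover have "\<epsilon>' \<in> carrier (cochain_group L 0)" by (simp add: carrier_cochain_group \<epsilon>'_def)
  ultimately show ?thesis using coboundaries_Suc[of L 0] by auto
qed

text \<open>Over \<open>V i\<close> the map \<open>f_tau n U \<phi> \<tau>\<close> has the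
  coordinates belonging to \<open>U (\<rho> i)\<close>. Their transition signs are those of the
  pulled back cocycle, so the rescaling is trivial in the real case.\<close>

lemma homotopic_f_tau_refinement:
  assumes "partition_dominated_by X n U \<phi>" "open_cover X n U" "\<tau> \<in> cocycles (nerve n U) 1"
    and "partition_dominated_by X m V \<psi>" "open_cover X m V"
    and \<rho>: "\<And>i. i \<le> m \<Longrightarrow> \<rho> i \<le> n \<and> V i \<subseteq> U (\<rho> i)"
    and \<tau>': "cochain_pullback (nerve m V) 1 \<rho> \<tau> \<in> cocycles (nerve m V) 1"
  shows "homotopic_with (\<lambda>_. True) X RP_inf (f_tau m V \<psi> (cochain_pullback (nerve m V) 1 \<rho> \<tau>)) (f_tau n U \<phi> \<tau>)"
proof (rule homotopic_of_same_transitions[OF assms(5), where N = "max m n"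
      and A = "tau_lift m \<psi> (cochain_pullback (nerve m V) 1 \<rho> \<tau>)" and B = "\<lambda>j. tau_lift n \<phi> \<tau> (\<rho> j)"])
  fix i j b assume ij: "i \<le> m" "j \<le> m" "b \<in> V i" "b \<in> V j"
  then have \<rho>ij: "\<rho> i \<le> n" "\<rho> j \<le> n" "b \<in> U (\<rho> i)" "b \<in> U (\<rho> j)" using \<rho> by blast+
  have "{i, j} \<in> nerve m V" using ij by (intro nerveI[where b = b]) auto
  then have "cochain_pullback (nerve m V) 1 \<rho> \<tau> {i, j} = \<tau> {\<rho> i, \<rho> j}"
    using cocycle_singleton[OF assms(3)] by (intro bit_cochain_pullback) auto
  then show "\<exists>c. \<forall>r. tau_lift m \<psi> (cochain_pullback (nerve m V) 1 \<rho> \<tau>) i b r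
        = c * tau_lift m \<psi> (cochain_pullback (nerve m V) 1 \<rho> \<tau>) j b r \<and>
      tau_lift n \<phi> \<tau> (\<rho> i) b r = c * tau_lift n \<phi> \<tau> (\<rho> j) b r"
    using tau_lift_transition[OF assms(4,5) \<tau>' ij] tau_lift_transition[OF assms(1-3) \<rho>ij] by metis
next
  fix j assume j: "j \<le> m"
  then show "lifts (subtopology X (V j)) (f_tau n U \<phi> \<tau>) (tau_lift n \<phi> \<tau> (\<rho> j))"
    using lifts_subset[OF lifts_f_tau[OF assms(1-3)], of "\<rho> j" "V j"] \<rho> by blast
qed (use lifts_f_tau[OF assms(4,5) \<tau>'] in \<open>auto simp: tau_lift_def\<close>)

section \<open>The complex classifying maps\<close>

definition unit_exp :: "real \<Rightarrow> complex" where "unit_exp x = cis (2 * pi * x)"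

lemma unit_exp_add: "unit_exp (x + y) = unit_exp x * unit_exp y"
  by (simp add: unit_exp_def cis_mult distrib_left)

lemma unit_exp_nonzero [simp]: "unit_exp x \<noteq> 0"
  by (simp add: unit_exp_def)

lemma unit_exp_Ints: "x \<in> \<int> \<Longrightarrow> unit_exp x = 1"
  by (simp add: unit_exp_def cis_multiple_2pi)

lemma unit_exp_cong_Ints: "x - y \<in> \<int> \<Longrightarrow> unit_exp x = unit_exp y"
  using unit_exp_add[of "x - y" y] by (simp add: unit_exp_Ints)

lemma unit_exp_conv_exp: "unit_exp x = exp (2 * of_real pi * \<i> * of_real x)"
  by (simp add: unit_exp_def cis_conv_exp mult_ac)

lemma continuous_map_unit_exp:
  "continuous_map X euclideanreal f \<Longrightarrow> continuous_map X euclidean (\<lambda>x. unit_exp (f x))"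
  using continuous_map_compose[of X euclideanreal f euclidean unit_exp]
  by (simp add: o_def unit_exp_def[abs_def] continuous_intros)

text \<open>The additive form of \<open>homotopic_of_same_transitions\<close>: \<open>a\<close> and
  \<open>b\<close> are logarithms of transition functions, and \<open>d j\<close> rescales the
  coordinates of \<open>g\<close> over \<open>U j\<close>. Agreement modulo the integers suffices
  because \<open>unit_exp\<close> kills them.\<close>

lemma homotopic_of_log_transitions:
  fixes A B :: "nat \<Rightarrow> 'a \<Rightarrow> nat \<Rightarrow> complex" and a b :: "nat \<Rightarrow> nat \<Rightarrow> 'a \<Rightarrow> real"
  assumes cover: "open_cover X n U"
    and A: "\<And>j. j \<le> n \<Longrightarrow> lifts (subtopology X (U j)) f (A j)"
    and B: "\<And>j. j \<le> n \<Longrightarrow> lifts (subtopology X (U j)) g (B j)"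
    and N: "\<And>j x r. j \<le> n \<Longrightarrow> x \<in> U j \<Longrightarrow> r > N \<Longrightarrow> A j x r = 0 \<and> B j x r = 0"
    and a: "\<And>i j x r. i \<le> n \<Longrightarrow> j \<le> n \<Longrightarrow> x \<in> U i \<Longrightarrow> x \<in> U j \<Longrightarrow> A i x r = unit_exp (a i j x) * A j x r"
    and b: "\<And>i j x r. i \<le> n \<Longrightarrow> j \<le> n \<Longrightarrow> x \<in> U i \<Longrightarrow> x \<in> U j \<Longrightarrow> B i x r = unit_exp (b i j x) * B j x r"
    and d: "\<And>j. j \<le> n \<Longrightarrow> continuous_map (subtopology X (U j)) euclideanreal (d j)"
    and abd: "\<And>i j x. i \<le> n \<Longrightarrow> j \<le> n \<Longrightarrow> x \<in> U i \<Longrightarrow> x \<in> U j \<Longrightarrow> (d i x + b i j x) - (a i j x + d j x) \<in> \<int>"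
  shows "homotopic_with (\<lambda>_. True) X proj_space_inf f g"
proof (rule homotopic_of_same_transitions[OF cover A, where N = N and B = "\<lambda>j x r. unit_exp (d j x) * B j x r"])
  fix i j x assume ij: "i \<le> n" "j \<le> n" "x \<in> U i" "x \<in> U j"
  have "unit_exp (d i x) * unit_exp (b i j x) = unit_exp (a i j x) * unit_exp (d j x)"
    using unit_exp_cong_Ints[OF abd[OF ij]] by (simp add: unit_exp_add)
  then have "unit_exp (d i x) * B i x r = unit_exp (a i j x) * (unit_exp (d j x) * B j x r)" for r
    using b[OF ij] by (metis mult.assoc)
  with a[OF ij] show "\<exists>c. \<forall>r. A i x r = c * A j x r \<and> unit_exp (d i x) * B i x r = c * (unit_exp (d j x) * B j x r)"
    by blast
qed (use N lifts_scale[OF B continuous_map_unit_exp[OF d]] in auto)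

section \<open>Coordinates and transition logarithms of \<open>f_eta\<close>\<close>

lemma alternating_add:
  "alternating (\<lambda>s. \<phi> s + \<psi> s) vs = alternating \<phi> vs + alternating \<psi> vs"
  by (simp add: alternating_def)

definition eta_lift :: "nat \<Rightarrow> (nat \<Rightarrow> 'a \<Rightarrow> real) \<Rightarrow> (nat set \<Rightarrow> int) \<Rightarrow> nat \<Rightarrow> 'a \<Rightarrow> nat \<Rightarrow> complex" where
  "eta_lift n \<phi> \<eta> j b r =
     (if r \<le> n then unit_exp (\<Sum>t\<le>n. \<phi> t b * of_int (alternating \<eta> [r, j, t])) * of_real (sqrt (\<phi> r b)) else 0)"

lemma eta_lift_eq_0: "n < r \<Longrightarrow> eta_lift n \<phi> \<eta> j b r = 0"
  by (simp add: eta_lift_def)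

lemma f_eta_on_eq: "f_eta_on n \<phi> \<eta> j b = proj (eta_lift n \<phi> \<eta> j b)"
  unfolding f_eta_on_def eta_lift_def unit_exp_conv_exp ..

text \<open>The real 1-cochain obtained by contracting \<eta> with the partition of unity; its
  coboundary is computed in \<open>eta_sum_cocycle\<close>. With the minus sign it is the logarithm
  of the factor from the coordinates over \<open>U j\<close> to those over
  \<open>U i\<close>.\<close>

definition eta_transition :: "nat \<Rightarrow> (nat \<Rightarrow> 'a \<Rightarrow> real) \<Rightarrow> (nat set \<Rightarrow> int) \<Rightarrow> nat \<Rightarrow> nat \<Rightarrow> 'a \<Rightarrow> real" where
  "eta_transition n \<phi> \<eta> i j b = - (\<Sum>t\<le>n. \<phi> t b * of_int (alternating \<eta> [i, j, t]))"

lemma partition_sum_cong: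
  assumes "partition_dominated_by X n U \<phi>" "b \<in> topspace X"
    and "\<And>t. t \<le> n \<Longrightarrow> b \<in> U t \<Longrightarrow> x t = y t"
  shows "(\<Sum>t\<le>n. \<phi> t b * x t) = (\<Sum>t\<le>n. \<phi> t b * y t)"
  using assms(3) partition_dominatedD(3)[OF assms(1) _ assms(2)]
  by (intro sum.cong refl) (metis atMost_iff mult_zero_left)

lemma partition_sum_const:
  assumes "partition_dominated_by X n U \<phi>" "b \<in> topspace X"
  shows "(\<Sum>t\<le>n. \<phi> t b * c) = c"
  using partition_dominatedD(4)[OF assms] by (simp flip: sum_distrib_right)

text \<open>Whenever \<open>\<phi> t b\<close> is nonzero, \<open>b\<close> lies in
  \<open>U t\<close>, so the cocycle identity for \<open>i\<close>, \<open>j\<close>,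
  \<open>k\<close>, \<open>t\<close> is available in every term that counts. The one summand without
  \<open>t\<close> passes through the average unchanged, as the weights add up to 1.\<close>

lemma eta_sum_cocycle:
  assumes \<phi>: "partition_dominated_by X n U \<phi>" and b: "b \<in> topspace X" and \<eta>: "\<eta> \<in> cocycles (nerve n U) 2"
    and ijk: "i \<le> n" "j \<le> n" "k \<le> n" "b \<in> U i" "b \<in> U j" "b \<in> U k"
  shows "eta_transition n \<phi> \<eta> j k b - eta_transition n \<phi> \<eta> i k b + eta_transition n \<phi> \<eta> i j b
    = - of_int (alternating \<eta> [i, j, k])"
proof -
  have "(\<Sum>t\<le>n. \<phi> t b * of_int (alternating \<eta> [i, j, k])) =
      (\<Sum>t\<le>n. \<phi> t b * (of_int (alternating \<eta> [j, k, t]) - of_int (alternating \<eta> [i, k, t]) + of_int (alternating \<eta> [i, j, t])))"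
  proof (rule partition_sum_cong[OF \<phi> b])
    fix t assume "t \<le> n" "b \<in> U t"
    then have "{i, j, k, t} \<in> nerve n U" using ijk by (intro nerveI[where b = b]) auto
    from alternating_cocycle_2[OF \<eta> this]
    have "alternating \<eta> [i, j, k] = alternating \<eta> [j, k, t] - alternating \<eta> [i, k, t] + alternating \<eta> [i, j, t]"
      by simp
    then show "(of_int (alternating \<eta> [i, j, k]) :: real) =
      of_int (alternating \<eta> [j, k, t]) - of_int (alternating \<eta> [i, k, t]) + of_int (alternating \<eta> [i, j, t])"
      by simp
  qed
  then show ?thesis
    unfolding partition_sum_const[OF \<phi> b]
    by (simp add: eta_transition_def distrib_left right_diff_distrib sum.distrib sum_subtractf)
qed

text \<open>The exponent of the \<open>r\<close>-th coordinate over \<open>U k\<close> is itself a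
  transition logarithm, from \<open>r\<close> to \<open>k\<close> with opposite sign. So the claim
  is \<open>eta_sum_cocycle\<close> for \<open>r\<close>, \<open>i\<close>, \<open>j\<close>, whose
  integral right-hand side disappears under \<open>unit_exp\<close>.\<close>

lemma eta_lift_transition:
  assumes \<phi>: "partition_dominated_by X n U \<phi>" and U: "open_cover X n U" and \<eta>: "\<eta> \<in> cocycles (nerve n U) 2"
    and ij: "i \<le> n" "j \<le> n" "b \<in> U i" "b \<in> U j"
  shows "eta_lift n \<phi> \<eta> i b r = unit_exp (eta_transition n \<phi> \<eta> i j b) * eta_lift n \<phi> \<eta> j b r"
proof (cases "r \<le> n \<and> \<phi> r b \<noteq> 0")
  case True
  have b: "b \<in> topspace X" using open_coverD(2)[OF U] ij by blast
  have r: "b \<in> U r" using partition_dominatedD(3)[OF \<phi> _ b] True by blast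
  have "eta_transition n \<phi> \<eta> i j b - eta_transition n \<phi> \<eta> r j b + eta_transition n \<phi> \<eta> r i b
    = - of_int (alternating \<eta> [r, i, j])"
    by (rule eta_sum_cocycle[OF \<phi> b \<eta>]) (use True ij r in auto)
  then have "- eta_transition n \<phi> \<eta> r i b - (eta_transition n \<phi> \<eta> i j b + - eta_transition n \<phi> \<eta> r j b) =
      of_int (alternating \<eta> [r, i, j])" by simp
  then have "unit_exp (- eta_transition n \<phi> \<eta> r i b) = unit_exp (eta_transition n \<phi> \<eta> i j b + - eta_transition n \<phi> \<eta> r j b)"
    by (intro unit_exp_cong_Ints) simp
  also have "\<dots> = unit_exp (eta_transition n \<phi> \<eta> i j b) * unit_exp (- eta_transition n \<phi> \<eta> r j b)"
    by (rule unit_exp_add)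
  finally have "unit_exp (- eta_transition n \<phi> \<eta> r i b) =
      unit_exp (eta_transition n \<phi> \<eta> i j b) * unit_exp (- eta_transition n \<phi> \<eta> r j b)" .
  moreover have "eta_lift n \<phi> \<eta> k b r = unit_exp (- eta_transition n \<phi> \<eta> r k b) * of_real (sqrt (\<phi> r b))" for k
    using True by (simp add: eta_lift_def eta_transition_def)
  ultimately show ?thesis by simp
qed (auto simp: eta_lift_def)

lemma eta_lift_nonzero:
  assumes "partition_dominated_by X n U \<phi>" "b \<in> topspace X"
  shows "eta_lift n \<phi> \<eta> j b \<noteq> (\<lambda>_. 0)"
proof -
  obtain r where "r \<le> n" "\<phi> r b > 0" using partition_dominatedD(5)[OF assms] by blast
  then have "eta_lift n \<phi> \<eta> j b r \<noteq> 0" by (simp add: eta_lift_def)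
  then show ?thesis by metis
qed

lemma continuous_map_weighted_sum:
  assumes "partition_dominated_by X n U \<phi>"
  shows "continuous_map (subtopology X S) euclideanreal (\<lambda>b. \<Sum>t\<le>n. \<phi> t b * c t)"
  using partition_dominatedD(1)[OF assms]
  by (intro continuous_map_sum continuous_map_mult continuous_map_from_subtopology) auto

lemma lifts_f_eta:
  assumes "partition_dominated_by X n U \<phi>" "open_cover X n U" "\<eta> \<in> cocycles (nerve n U) 2" "j \<le> n"
  shows "lifts (subtopology X (U j)) (f_eta n U \<phi> \<eta>) (eta_lift n \<phi> \<eta> j)"
proof (rule lifts_of_transitions[OF assms(2) _ eta_lift_nonzero[OF assms(1)] _ _ assms(4)])
  fix j r
  show "continuous_map (subtopology X (U j)) euclidean (\<lambda>b. eta_lift n \<phi> \<eta> j b r)"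
  proof (cases "r \<le> n")
    case True
    have "continuous_map (subtopology X (U j)) euclideanreal (\<lambda>b. sqrt (\<phi> r b))"
      by (intro continuous_map_sqrt continuous_map_from_subtopology partition_dominatedD(1)[OF assms(1) True])
    then have "continuous_map (subtopology X (U j)) euclidean (\<lambda>b. unit_exp (\<Sum>t\<le>n. \<phi> t b * of_int (alternating \<eta> [r, j, t])) *
        of_real (sqrt (\<phi> r b)))"
      by (intro continuous_map_mult continuous_map_of_real continuous_map_unit_exp continuous_map_weighted_sum[OF assms(1)])
    then show ?thesis using True by (simp add: eta_lift_def)
  qed (simp add: eta_lift_def)
next
  fix i j b assume "i \<le> n" "j \<le> n" "b \<in> U i" "b \<in> U j"
  then show "\<exists>c. \<forall>r. eta_lift n \<phi> \<eta> i b r = c * eta_lift n \<phi> \<eta> j b r"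
    using eta_lift_transition[OF assms(1-3)] by blast
qed (simp_all add: f_eta_def f_eta_on_eq)

lemma f_eta_eq:
  assumes "partition_dominated_by X n U \<phi>" "open_cover X n U" "\<eta> \<in> cocycles (nerve n U) 2" "j \<le> n" "b \<in> U j"
  shows "f_eta n U \<phi> \<eta> b = f_eta_on n \<phi> \<eta> j b"
  using lifts_proj[OF lifts_f_eta[OF assms(1-4)], of b] open_coverD(2)[OF assms(2,4)] assms(5)
  by (auto simp: f_eta_on_eq)

lemma continuous_f_eta:
  assumes "partition_dominated_by X n U \<phi>" "open_cover X n U" "\<eta> \<in> cocycles (nerve n U) 2"
  shows "continuous_map X (CP n) (f_eta n U \<phi> \<eta>)"
proof (rule continuous_map_of_local_lifts)
  fix b assume "b \<in> topspace X"
  then obtain j where "j \<le> n" "b \<in> U j" using open_coverD(3)[OF assms(2)] by blast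
  then show "\<exists>W G. openin X W \<and> b \<in> W \<and> lifts (subtopology X W) (f_eta n U \<phi> \<eta>) G \<and> (\<forall>z\<in>W. \<forall>r>n. G z r = 0)"
    using lifts_f_eta[OF assms] open_coverD(1)[OF assms(2)]
    by (intro exI[of _ "U j"] exI[of _ "eta_lift n \<phi> \<eta> j"]) (auto simp: eta_lift_def)
qed

text \<open>The rescaling exponent over \<open>U i\<close> is the average of \<theta> over the edges
  starting at \<open>i\<close>. Averaging the coboundary formula leaves the value of \<theta> on the
  edge from \<open>i\<close> to \<open>j\<close>; this is an integer and invisible in the transition
  functions.\<close>

lemma homotopic_f_eta_cohomologous:
  assumes \<phi>: "partition_dominated_by X n U \<phi>" and U: "open_cover X n U" and \<eta>: "\<eta> \<in> cocycles (nerve n U) 2"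
    and \<eta>': "\<eta>' \<in> cocycles (nerve n U) 2" "\<eta>' = (\<lambda>s. coboundary (nerve n U) 1 \<theta> s + \<eta> s)"
  shows "homotopic_with (\<lambda>_. True) X CP_inf (f_eta n U \<phi> \<eta>') (f_eta n U \<phi> \<eta>)"
proof (rule homotopic_of_log_transitions[OF U lifts_f_eta[OF \<phi> U \<eta>'(1)] lifts_f_eta[OF \<phi> U \<eta>], where N = n
      and a = "eta_transition n \<phi> \<eta>'" and b = "eta_transition n \<phi> \<eta>"
      and d = "\<lambda>i b. \<Sum>t\<le>n. \<phi> t b * of_int (alternating \<theta> [i, t])"])
  fix i j b assume ij: "i \<le> n" "j \<le> n" "b \<in> U i" "b \<in> U j"
  have b: "b \<in> topspace X" using open_coverD(2)[OF U] ij by blast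
  define \<sigma> where "\<sigma> i = (\<Sum>t\<le>n. \<phi> t b * of_int (alternating \<theta> [i, t]))" for i
  have "- eta_transition n \<phi> \<eta>' i j b = (\<Sum>t\<le>n. \<phi> t b * (of_int (alternating \<theta> [j, t]) - of_int (alternating \<theta> [i, t])
      + of_int (alternating \<theta> [i, j]) + of_int (alternating \<eta> [i, j, t])))"
    unfolding eta_transition_def minus_minus
  proof (rule partition_sum_cong[OF \<phi> b])
    fix t assume "t \<le> n" "b \<in> U t"
    then have "{i, j, t} \<in> nerve n U" using ij by (intro nerveI[where b = b]) auto
    from alternating_coboundary_1[OF this, of \<theta>]
    show "(of_int (alternating \<eta>' [i, j, t]) :: real) = of_int (alternating \<theta> [j, t]) - of_int (alternating \<theta> [i, t])
        + of_int (alternating \<theta> [i, j]) + of_int (alternating \<eta> [i, j, t])"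
      unfolding \<eta>'(2) alternating_add by simp
  qed
  also have "\<dots> = \<sigma> j - \<sigma> i + of_int (alternating \<theta> [i, j]) - eta_transition n \<phi> \<eta> i j b"
    using partition_sum_const[OF \<phi> b, of "of_int (alternating \<theta> [i, j])"]
    by (simp add: eta_transition_def \<sigma>_def distrib_left right_diff_distrib sum.distrib sum_subtractf)
  finally have "(\<sigma> i + eta_transition n \<phi> \<eta> i j b) - (eta_transition n \<phi> \<eta>' i j b + \<sigma> j) = of_int (alternating \<theta> [i, j])"
    by simp
  then show "(\<Sum>t\<le>n. \<phi> t b * of_int (alternating \<theta> [i, t])) + eta_transition n \<phi> \<eta> i j b -
      (eta_transition n \<phi> \<eta>' i j b + (\<Sum>t\<le>n. \<phi> t b * of_int (alternating \<theta> [j, t]))) \<in> \<int>"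
    unfolding \<sigma>_def by (metis Ints_of_int)
qed (auto simp: eta_lift_eq_0 intro: eta_lift_transition[OF \<phi> U \<eta>'(1)] eta_lift_transition[OF \<phi> U \<eta>]
    continuous_map_weighted_sum[OF \<phi>])

section \<open>Integral cochains under refinement\<close>

lemma pullback_cocycle_2:
  fixes \<eta> :: "'v::linorder set \<Rightarrow> int" and \<rho> :: "'w::linorder \<Rightarrow> 'v"
  assumes \<eta>: "\<eta> \<in> cocycles K 2" and \<rho>: "\<And>s. s \<in> L \<Longrightarrow> \<rho> ` s \<in> K"
    and L: "\<And>s t. s \<in> L \<Longrightarrow> t \<subseteq> s \<Longrightarrow> t \<noteq> {} \<Longrightarrow> t \<in> L"
  shows "cochain_pullback L 2 \<rho> \<eta> \<in> cocycles L 2"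
  unfolding cocycles_iff carrier_cochain_group
proof (intro conjI ballI)
  let ?\<eta> = "cochain_pullback L 2 \<rho> \<eta>"
  have val: "?\<eta> {i, j, k} = alternating \<eta> [\<rho> i, \<rho> j, \<rho> k]" if "i < j" "j < k" "{i, j, k} \<in> L" for i j k
    using alternating_cochain_pullback[of "[i, j, k]" L 2 \<rho> \<eta>] alternating_less3[of i j k ?\<eta>] that by simp
  fix s assume "s \<in> simplices L (Suc 2)"
  then have three: "s \<in> simplices L 3" by (simp add: numeral_3_eq_3 numeral_2_eq_2)
  obtain i j k l where s: "i < j" "j < k" "k < l" "s = {i, j, k, l}" "{i, j, k, l} \<in> L"
    by (rule simplices_3E[OF three])
  then have L4: "{i, j, k} \<in> L" "{i, j, l} \<in> L" "{i, k, l} \<in> L" "{j, k, l} \<in> L" by (auto intro: L)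
  have "{\<rho> i, \<rho> j, \<rho> k, \<rho> l} \<in> K" using \<rho>[OF s(5)] by simp
  then have "coboundary L 2 ?\<eta> {i, j, k, l} = 0"
    using alternating_cocycle_2[OF \<eta>, of "\<rho> i" "\<rho> j" "\<rho> k" "\<rho> l"] s L4
    by (simp add: coboundary_2 val)
  then show "coboundary L 2 ?\<eta> s = 0" by (simp add: s(4))
qed (simp add: cochain_pullback_def)

lemma pullback_coboundary_2:
  fixes \<beta> \<eta> :: "'v::linorder set \<Rightarrow> int" and \<rho> :: "'w::linorder \<Rightarrow> 'v"
  assumes \<rho>: "\<And>s. s \<in> L \<Longrightarrow> \<rho> ` s \<in> K"
    and L: "\<And>s t. s \<in> L \<Longrightarrow> t \<subseteq> s \<Longrightarrow> t \<noteq> {} \<Longrightarrow> t \<in> L"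
    and \<beta>: "\<beta> \<in> coboundaries K 2"
  shows "(\<lambda>s. cochain_pullback L 2 \<rho> (\<lambda>s. \<beta> s + \<eta> s) s - cochain_pullback L 2 \<rho> \<eta> s) \<in> coboundaries L 2"
proof -
  obtain \<theta> :: "'v set \<Rightarrow> int" where \<theta>: "\<beta> = coboundary K 1 \<theta>"
    using \<beta> coboundaries_Suc[of K 1] by (auto simp: numeral_2_eq_2)
  let ?\<theta> = "cochain_pullback L 1 \<rho> \<theta>"
  have "cochain_pullback L 2 \<rho> (\<lambda>s. \<beta> s + \<eta> s) s - cochain_pullback L 2 \<rho> \<eta> s = coboundary L 1 ?\<theta> s" for s
  proof (cases "s \<in> simplices L 2")
    case True
    obtain i j k where s: "i < j" "j < k" "s = {i, j, k}" "{i, j, k} \<in> L" by (rule simplices_2E[OF True])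
    have val: "cochain_pullback L 2 \<rho> \<eta> {i, j, k} = alternating \<eta> [\<rho> i, \<rho> j, \<rho> k]" for \<eta> :: "'v set \<Rightarrow> int"
      using alternating_cochain_pullback[of "[i, j, k]" L 2 \<rho> \<eta>] alternating_less3[of i j k "cochain_pullback L 2 \<rho> \<eta>"] s
      by simp
    have val1: "?\<theta> {i, j} = alternating \<theta> [\<rho> i, \<rho> j]" if "i < j" "{i, j} \<in> L" for i j
      using alternating_cochain_pullback[of "[i, j]" L 1 \<rho> \<theta>] alternating_less2[of i j ?\<theta>] that by simp
    have "{i, j} \<in> L" "{i, k} \<in> L" "{j, k} \<in> L" using s by (auto intro: L)
    then have "coboundary L 1 ?\<theta> {i, j, k} = alternating \<theta> [\<rho> j, \<rho> k] - alternating \<theta> [\<rho> i, \<rho> k] + alternating \<theta> [\<rho> i, \<rho> j]"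
      using s coboundary_1[OF s(1,2,4), of ?\<theta>] val1[of i j] val1[of i k] val1[of j k] by simp
    also have "\<dots> = alternating \<beta> [\<rho> i, \<rho> j, \<rho> k]"
      unfolding \<theta> using \<rho>[OF s(4)] by (subst alternating_coboundary_1) auto
    finally show ?thesis by (simp add: val s(3) alternating_add)
  next
    case False
    then show ?thesis by (simp add: cochain_pullback_def coboundary_def numeral_2_eq_2)
  qed
  moreover have "?\<theta> \<in> carrier (cochain_group L 1)" by (simp add: carrier_cochain_group cochain_pullback_def)
  ultimately show ?thesis using coboundaries_Suc[of L 1] by (auto simp: numeral_2_eq_2)
qed

text \<open>Over \<open>V\<^sub>i\<close> the two maps are compared by averaging \<open>\<eta>\<close> with respect to both partitions of unity.\<close>

lemma homotopic_f_eta_refinement: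
  assumes \<phi>: "partition_dominated_by X n U \<phi>" and U: "open_cover X n U" and \<eta>: "\<eta> \<in> cocycles (nerve n U) 2"
    and \<psi>: "partition_dominated_by X m V \<psi>" and V: "open_cover X m V"
    and \<rho>: "\<And>i. i \<le> m \<Longrightarrow> \<rho> i \<le> n \<and> V i \<subseteq> U (\<rho> i)"
    and \<eta>': "cochain_pullback (nerve m V) 2 \<rho> \<eta> \<in> cocycles (nerve m V) 2"
  shows "homotopic_with (\<lambda>_. True) X CP_inf (f_eta m V \<psi> (cochain_pullback (nerve m V) 2 \<rho> \<eta>)) (f_eta n U \<phi> \<eta>)"
proof (rule homotopic_of_log_transitions[OF V lifts_f_eta[OF \<psi> V \<eta>'], where N = "max m n"
      and a = "eta_transition m \<psi> (cochain_pullback (nerve m V) 2 \<rho> \<eta>)"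
      and b = "\<lambda>i j. eta_transition n \<phi> \<eta> (\<rho> i) (\<rho> j)" and B = "\<lambda>j. eta_lift n \<phi> \<eta> (\<rho> j)"
      and d = "\<lambda>i b. \<Sum>s\<le>m. \<psi> s b * (\<Sum>t\<le>n. \<phi> t b * of_int (alternating \<eta> [\<rho> i, \<rho> s, t]))"])
  let ?\<eta> = "cochain_pullback (nerve m V) 2 \<rho> \<eta>"
  fix i j b assume ij: "i \<le> m" "j \<le> m" "b \<in> V i" "b \<in> V j"
  have b: "b \<in> topspace X" using open_coverD(2)[OF V] ij by blast
  \<comment> \<open>Up to sign, the transition logarithm of \<open>f_eta n U \<phi> \<eta>\<close>
    between \<open>\<rho> i\<close> and \<open>\<rho> s\<close>. Its average over \<open>s\<close>
    with weights \<psi> is the rescaling exponent.\<close>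
  define \<sigma> where "\<sigma> i s = (\<Sum>t\<le>n. \<phi> t b * of_int (alternating \<eta> [\<rho> i, \<rho> s, t]))" for i s
  have "- eta_transition m \<psi> ?\<eta> i j b =
      (\<Sum>s\<le>m. \<psi> s b * (\<sigma> j s - \<sigma> i s + \<sigma> i j))"
    unfolding eta_transition_def minus_minus
  proof (rule partition_sum_cong[OF \<psi> b])
    fix s assume s: "s \<le> m" "b \<in> V s"
    then have "{i, j, s} \<in> nerve m V" using ij by (intro nerveI[where b = b]) auto
    then have "alternating ?\<eta> [i, j, s] = alternating \<eta> [\<rho> i, \<rho> j, \<rho> s]"
      using alternating_cochain_pullback[of "[i, j, s]" "nerve m V" 2 \<rho> \<eta>] by simp
    moreover have "- \<sigma> j s - - \<sigma> i s + - \<sigma> i j = - of_int (alternating \<eta> [\<rho> i, \<rho> j, \<rho> s])"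
      using eta_sum_cocycle[OF \<phi> b \<eta>, of "\<rho> i" "\<rho> j" "\<rho> s"] \<rho> ij s
      unfolding eta_transition_def \<sigma>_def by blast
    ultimately show "(of_int (alternating ?\<eta> [i, j, s]) :: real) = \<sigma> j s - \<sigma> i s + \<sigma> i j" by simp
  qed
  also have "\<dots> = (\<Sum>s\<le>m. \<psi> s b * \<sigma> j s) - (\<Sum>s\<le>m. \<psi> s b * \<sigma> i s) + \<sigma> i j"
    using partition_sum_const[OF \<psi> b, of "\<sigma> i j"]
    by (simp add: distrib_left right_diff_distrib sum.distrib sum_subtractf)
  \<comment> \<open>Here the logarithms match exactly, not just modulo the integers.\<close>
  finally have "(\<Sum>s\<le>m. \<psi> s b * \<sigma> i s) + - \<sigma> i j - (eta_transition m \<psi> ?\<eta> i j b + (\<Sum>s\<le>m. \<psi> s b * \<sigma> j s)) = 0"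
    by simp
  then show "(\<Sum>s\<le>m. \<psi> s b * (\<Sum>t\<le>n. \<phi> t b * of_int (alternating \<eta> [\<rho> i, \<rho> s, t]))) +
      eta_transition n \<phi> \<eta> (\<rho> i) (\<rho> j) b -
      (eta_transition m \<psi> ?\<eta> i j b + (\<Sum>s\<le>m. \<psi> s b * (\<Sum>t\<le>n. \<phi> t b * of_int (alternating \<eta> [\<rho> j, \<rho> s, t])))) \<in> \<int>"
    unfolding \<sigma>_def eta_transition_def by (metis Ints_0)
next
  fix j assume j: "j \<le> m"
  then show "lifts (subtopology X (V j)) (f_eta n U \<phi> \<eta>) (eta_lift n \<phi> \<eta> (\<rho> j))"
    using lifts_subset[OF lifts_f_eta[OF \<phi> U \<eta>], of "\<rho> j" "V j"] \<rho> by blast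
next
  fix j
  show "continuous_map (subtopology X (V j)) euclideanreal
      (\<lambda>b. \<Sum>s\<le>m. \<psi> s b * (\<Sum>t\<le>n. \<phi> t b * of_int (alternating \<eta> [\<rho> j, \<rho> s, t])))"
    by (rule continuous_map_sum, simp, rule continuous_map_mult, rule continuous_map_from_subtopology,
        rule partition_dominatedD(1)[OF \<psi>], simp, rule continuous_map_weighted_sum[OF \<phi>])
next
  fix i j x r assume "i \<le> m" "j \<le> m" "x \<in> V i" "x \<in> V j"
  then show "eta_lift n \<phi> \<eta> (\<rho> i) x r = unit_exp (eta_transition n \<phi> \<eta> (\<rho> i) (\<rho> j) x) * eta_lift n \<phi> \<eta> (\<rho> j) x r"
    using \<rho> by (intro eta_lift_transition[OF \<phi> U \<eta>]) blast+
qed (auto simp: eta_lift_eq_0 intro: eta_lift_transition[OF \<psi> V \<eta>'])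

section \<open>Injectivity in the real case\<close>

lemma locally_constant_on_connectedin:
  assumes S: "connectedin X S"
    and loc: "\<And>x. x \<in> S \<Longrightarrow> \<exists>W. openin X W \<and> x \<in> W \<and> (\<forall>y\<in>W \<inter> S. f y = f x)"
    and xy: "x \<in> S" "y \<in> S"
  shows "f x = f y"
proof (rule ccontr)
  assume ne: "f x \<noteq> f y"
  have opn: "openin (subtopology X S) {z \<in> S. P (f z)}" for P
  proof (subst openin_subopen, intro ballI)
    fix z assume z: "z \<in> {z \<in> S. P (f z)}"
    then obtain W where W: "openin X W" "z \<in> W" "\<forall>y\<in>W \<inter> S. f y = f z" using loc by blast
    have "openin (subtopology X S) (W \<inter> S)" using W by (auto simp: openin_subtopology)
    moreover have "z \<in> W \<inter> S" using W(2) z by blast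
    moreover have "W \<inter> S \<subseteq> {z \<in> S. P (f z)}"
    proof
      fix y assume y: "y \<in> W \<inter> S"
      then have "f y = f z" using W(3) by blast
      with y z show "y \<in> {z \<in> S. P (f z)}" by simp
    qed
    ultimately show "\<exists>T. openin (subtopology X S) T \<and> z \<in> T \<and> T \<subseteq> {z \<in> S. P (f z)}" by blast
  qed
  have "connected_space (subtopology X S)" "topspace (subtopology X S) = S"
    using S by (auto simp: connectedin_def)
  moreover have "S \<subseteq> {z \<in> S. f z = f x} \<union> {z \<in> S. f z \<noteq> f x}"
    "{z \<in> S. f z = f x} \<inter> {z \<in> S. f z \<noteq> f x} = {}" by auto
  ultimately have "{z \<in> S. f z = f x} = {} \<or> {z \<in> S. f z \<noteq> f x} = {}"
    using opn[of "\<lambda>v. v = f x"] opn[of "\<lambda>v. v \<noteq> f x"] unfolding connected_space_def by metis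
  moreover have "x \<in> {z \<in> S. f z = f x}" "y \<in> {z \<in> S. f z \<noteq> f x}" using xy ne by simp_all
  ultimately show False by blast
qed

lemma continuous_nonzero_same_sign:
  fixes c :: "real \<Rightarrow> real"
  assumes c: "continuous_on {0..1} c" and nz: "\<And>t. t \<in> {0..1} \<Longrightarrow> c t \<noteq> 0"
  shows "c 0 * c 1 > 0"
proof (rule ccontr)
  assume "\<not> c 0 * c 1 > 0"
  then have "c 0 * c 1 < 0" using nz[of 0] nz[of 1] by (simp add: not_less less_le)
  then consider "c 0 < 0" "0 < c 1" | "c 1 < 0" "0 < c 0" by (auto simp: mult_less_0_iff)
  then show False
  proof cases
    case 1
    then obtain t where "0 \<le> t" "t \<le> 1" "c t = 0"
      using IVT'[of c 0 0 1] c by auto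
    then show False using nz by auto
  next
    case 2
    then obtain t where "0 \<le> t" "t \<le> 1" "c t = 0"
      using IVT2'[of c 1 0 0] c by auto
    then show False using nz by auto
  qed
qed

text \<open>The lifts are chosen point by point and no continuity in \<open>b\<close> is claimed.
  What is derived from them must either be independent of the choice or be compared with a lift that
  is continuous in \<open>b\<close>.\<close>

lemma path_lift_exists:
  assumes h: "continuous_map (prod_topology (top_of_set {0..1::real}) X) proj_space_inf h"
  obtains \<gamma> where "\<And>b. b \<in> topspace X \<Longrightarrow> lifts (top_of_set {0..1}) (\<lambda>t. h (t, b)) (\<gamma> b)"
proof -
  have "\<exists>\<gamma>. lifts (top_of_set {0..1}) (\<lambda>t. h (t, b)) \<gamma>" if b: "b \<in> topspace X" for b
  proof -
    obtain N G where N: "openin X N" "b \<in> N" "lifts (prod_topology (top_of_set {0..1}) (subtopology X N)) h G"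
      using homotopy_lift_exists[OF h b] .
    have "continuous_map (top_of_set {0..1}) (prod_topology (top_of_set {0..1}) (subtopology X N)) (\<lambda>t. (t, b))"
      using N b by (intro continuous_map_pairedI continuous_map_ident continuous_map_const[THEN iffD2]) auto
    from lifts_compose[OF N(3) this] show ?thesis by blast
  qed
  then show ?thesis using that by metis
qed

lemma lifts_scalar:
  assumes "lifts Z q G" "lifts Z' q' G'" "z \<in> topspace Z" "z' \<in> topspace Z'" "q z = q' z'"
  obtains c where "c \<noteq> 0" "\<And>r. G' z' r = c * G z r"
proof -
  have "proj (G z) = proj (G' z')" using assms by (simp add: lifts_def)
  then show ?thesis using that by (auto simp: proj_eq_iff)
qed

lemma lifts_scalar_unique:
  assumes "lifts Z q G" "z \<in> topspace Z" "\<And>r. c * G z r = d * G z r"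
  shows "c = d"
proof -
  obtain r where "G z r \<noteq> 0" using lifts_nonzero[OF assms(1,2)] by (auto simp: fun_eq_iff)
  then show ?thesis using assms(3)[of r] by simp
qed

lemma homotopic_f_tau_imp_cohomologous:
  assumes \<phi>: "partition_dominated_by X n U \<phi>" and U: "open_cover X n U"
    and \<tau>: "\<tau> \<in> cocycles (nerve n U) 1" and \<tau>': "\<tau>' \<in> cocycles (nerve n U) 1"
    and conn: "\<And>r. r \<le> n \<Longrightarrow> connectedin X (U r)"
    and hom: "homotopic_with (\<lambda>_. True) X RP_inf (f_tau n U \<phi> \<tau>) (f_tau n U \<phi> \<tau>')"
  shows "(\<lambda>s. \<tau> s - \<tau>' s) \<in> coboundaries (nerve n U) 1"
proof -
  let ?I = "top_of_set {0..1::real}" and ?K = "nerve n U"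
  obtain h where h: "continuous_map (prod_topology ?I X) RP_inf h"
    and h0: "\<And>b. h (0, b) = f_tau n U \<phi> \<tau> b" and h1: "\<And>b. h (1, b) = f_tau n U \<phi> \<tau>' b"
    using hom by (auto simp: homotopic_with_def)
  obtain \<gamma> where \<gamma>: "\<And>b. b \<in> topspace X \<Longrightarrow> lifts ?I (\<lambda>t. h (t, b)) (\<gamma> b)"
    using path_lift_exists[OF h] by blast
  define F F' where "F = tau_lift n \<phi> \<tau>" and "F' = tau_lift n \<phi> \<tau>'"
  have F: "lifts (subtopology X (U j)) (\<lambda>b. h (0, b)) (F j)" if "j \<le> n" for j
    unfolding F_def h0 using lifts_f_tau[OF \<phi> U \<tau> that] by simp
  have F': "lifts (subtopology X (U j)) (\<lambda>b. h (1, b)) (F' j)" if "j \<le> n" for j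
    unfolding F'_def h1 using lifts_f_tau[OF \<phi> U \<tau>' that] by simp
  note sub = open_coverD(2)[OF U]
  have top: "b \<in> topspace (subtopology X (U j))" "b \<in> topspace X" if "j \<le> n" "b \<in> U j" for j b
    using sub that by auto
  \<comment> \<open>\<alpha>, and \<beta> below, measure the chosen lift against the given
    coordinates at the two ends. They need not be continuous in \<open>b\<close>.\<close>
  have "\<exists>\<alpha>. \<alpha> \<noteq> 0 \<and> (\<forall>r. \<gamma> b 0 r = \<alpha> * F j b r)" if "j \<le> n" "b \<in> U j" for j b
    using lifts_scalar[OF F[OF that(1)] \<gamma>[OF top(2)[OF that]] top(1)[OF that], of 0] by auto
  then obtain \<alpha> where \<alpha>: "\<And>j b. j \<le> n \<Longrightarrow> b \<in> U j \<Longrightarrow> \<alpha> j b \<noteq> 0"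
    "\<And>j b r. j \<le> n \<Longrightarrow> b \<in> U j \<Longrightarrow> \<gamma> b 0 r = \<alpha> j b * F j b r" by metis
  have "\<exists>\<beta>. \<beta> \<noteq> 0 \<and> (\<forall>r. \<gamma> b 1 r = \<beta> * F' j b r)" if "j \<le> n" "b \<in> U j" for j b
    using lifts_scalar[OF F'[OF that(1)] \<gamma>[OF top(2)[OF that]] top(1)[OF that], of 1] by auto
  then obtain \<beta> where \<beta>: "\<And>j b. j \<le> n \<Longrightarrow> b \<in> U j \<Longrightarrow> \<beta> j b \<noteq> 0"
    "\<And>j b r. j \<le> n \<Longrightarrow> b \<in> U j \<Longrightarrow> \<gamma> b 1 r = \<beta> j b * F' j b r" by metis
  \<comment> \<open>The product has the sign of the quotient comparing the two ends. This sign
    survives any rescaling of \<open>\<gamma> b\<close> by a continuous function of time without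
    zeros.\<close>
  define s where "s j b = sgn (\<alpha> j b * \<beta> j b)" for j b
  have s_const: "s j b = s j b'" if j: "j \<le> n" and b: "b \<in> U j" "b' \<in> U j" for j b b'
  proof (rule locally_constant_on_connectedin[OF conn[OF j] _ b])
    fix b0 assume b0: "b0 \<in> U j"
    \<comment> \<open>Near \<open>b0\<close> the jointly continuous lift \<open>G\<close> replaces
      \<gamma>. It gives the same sign, but through factors \<open>k0\<close>, \<open>k1\<close>
      that are continuous in \<open>b\<close>.\<close>
    obtain N G where N: "openin X N" "b0 \<in> N" "lifts (prod_topology ?I (subtopology X N)) h G"
      using homotopy_lift_exists[OF h top(2)[OF j b0]] .
    define M where "M = N \<inter> U j"
    have M: "openin X M" "b0 \<in> M" using N b0 open_coverD(1)[OF U j] by (auto simp: M_def)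
    have topM: "topspace (subtopology X M) = M" using M(1) openin_subset by force
    have cM: "continuous_map (subtopology X M) (prod_topology ?I (subtopology X N)) (\<lambda>b. (t, b))" if "t \<in> {0..1}" for t
    proof (intro continuous_map_pairedI continuous_map_const[THEN iffD2])
      show "continuous_map (subtopology X M) (subtopology X N) (\<lambda>b. b)"
        by (rule continuous_map_from_subtopology_mono[of _ N]) (auto simp: M_def continuous_map_ident)
    qed (use that in auto)
    have G0: "lifts (subtopology X M) (\<lambda>b. h (0, b)) (\<lambda>b. G (0, b))"
      and G1: "lifts (subtopology X M) (\<lambda>b. h (1, b)) (\<lambda>b. G (1, b))"
      using lifts_compose[OF N(3) cM] by auto
    have FM: "lifts (subtopology X M) (\<lambda>b. h (0, b)) (F j)" "lifts (subtopology X M) (\<lambda>b. h (1, b)) (F' j)"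
      using lifts_subset[OF F[OF j]] lifts_subset[OF F'[OF j]] by (auto simp: M_def)
    obtain k0 where k0: "continuous_map (subtopology X M) euclidean k0" "\<And>b. b \<in> M \<Longrightarrow> k0 b \<noteq> 0"
      "\<And>b r. b \<in> M \<Longrightarrow> G (0, b) r = k0 b * F j b r"
      using lifts_ratio[OF FM(1) G0] unfolding topM by blast
    obtain k1 where k1: "continuous_map (subtopology X M) euclidean k1" "\<And>b. b \<in> M \<Longrightarrow> k1 b \<noteq> 0"
      "\<And>b r. b \<in> M \<Longrightarrow> G (1, b) r = k1 b * F' j b r"
      using lifts_ratio[OF FM(2) G1] unfolding topM by blast
    have s_eq: "s j b = sgn (k0 b * k1 b)" if b: "b \<in> M" for b
    proof -
      have bj: "b \<in> U j" "b \<in> N" using b by (auto simp: M_def)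
      note t = top[OF j bj(1)]
      have "continuous_map ?I (prod_topology ?I (subtopology X N)) (\<lambda>t. (t, b))"
        using t bj by (intro continuous_map_pairedI continuous_map_ident continuous_map_const[THEN iffD2]) auto
      from lifts_compose[OF N(3) this] have "lifts ?I (\<lambda>t. h (t, b)) (\<lambda>t. G (t, b))" by simp
      from lifts_ratio[OF \<gamma>[OF t(2)] this] obtain \<kappa> where \<kappa>: "continuous_map ?I euclidean \<kappa>"
        "\<And>t. t \<in> {0..1} \<Longrightarrow> \<kappa> t \<noteq> 0" "\<And>t r. t \<in> {0..1} \<Longrightarrow> G (t, b) r = \<kappa> t * \<gamma> b t r"
        by auto
      have "G (0, b) r = (\<kappa> 0 * \<alpha> j b) * F j b r" "G (1, b) r = (\<kappa> 1 * \<beta> j b) * F' j b r" for r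
        using \<kappa>(3)[of 0 r] \<kappa>(3)[of 1 r] \<alpha>(2)[OF j bj(1), of r] \<beta>(2)[OF j bj(1), of r] by simp_all
      then have "k0 b = \<kappa> 0 * \<alpha> j b" "k1 b = \<kappa> 1 * \<beta> j b"
        using lifts_scalar_unique[OF F[OF j] t(1), of "k0 b" "\<kappa> 0 * \<alpha> j b"] k0(3)[OF b]
          lifts_scalar_unique[OF F'[OF j] t(1), of "k1 b" "\<kappa> 1 * \<beta> j b"] k1(3)[OF b]
        by metis+
      \<comment> \<open>The factor between the two lifts along the path has no zero, so it has the
        same sign at both ends and drops out of the comparison.\<close>
      moreover have "\<kappa> 0 * \<kappa> 1 > 0" using \<kappa> by (intro continuous_nonzero_same_sign) auto
      ultimately have "k0 b * k1 b = (\<kappa> 0 * \<kappa> 1) * (\<alpha> j b * \<beta> j b)" "sgn (\<kappa> 0 * \<kappa> 1) = 1" by simp_all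
      then show ?thesis unfolding s_def by (simp only: sgn_mult)
    qed
    define W where "W = {b \<in> M. (k0 b * k1 b) * (k0 b0 * k1 b0) \<in> {0<..}}"
    have "continuous_map (subtopology X M) euclideanreal (\<lambda>b. (k0 b * k1 b) * (k0 b0 * k1 b0))"
      using k0(1) k1(1) by (intro continuous_map_mult continuous_map_const[THEN iffD2]) auto
    from openin_continuous_map_preimage[OF this, of "{0<..}", unfolded topM, folded W_def]
    have "openin (subtopology X M) W" by simp
    then have "openin X W" using M(1) openin_trans_full by blast
    moreover have "k0 b0 * k1 b0 \<noteq> 0" using k0(2)[OF M(2)] k1(2)[OF M(2)] by simp
    then have "(k0 b0 * k1 b0) * (k0 b0 * k1 b0) > 0" using not_real_square_gt_zero by blast
    then have "b0 \<in> W" using M(2) unfolding W_def by blast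
    moreover have "s j y = s j b0" if "y \<in> W" for y
    proof -
      have "(k0 y * k1 y) * (k0 b0 * k1 b0) > 0" "y \<in> M" using that unfolding W_def by blast+
      then have "sgn (k0 y * k1 y) = sgn (k0 b0 * k1 b0)"
        by (metis sgn_neg sgn_pos zero_less_mult_iff)
      then show ?thesis using s_eq[OF \<open>y \<in> M\<close>] s_eq[OF M(2)] by simp
    qed
    ultimately show "\<exists>W. openin X W \<and> b0 \<in> W \<and> (\<forall>y\<in>W \<inter> U j. s j y = s j b0)" by blast
  qed
  \<comment> \<open>By \<open>s_const\<close> all points of \<open>U j\<close> give the same answer.
    An index with empty \<open>U j\<close> is not a vertex of the nerve and gets 0.\<close>
  define \<epsilon> :: "nat set \<Rightarrow> bit" where
    "\<epsilon> v = (if v \<in> simplices ?K 0 \<and> (\<forall>j b. v = {j} \<longrightarrow> b \<in> U j \<longrightarrow> s j b = -1) then 1 else 0)" for v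
  have \<epsilon>: "bit_sign (\<epsilon> {j}) = s j b" if j: "j \<le> n" "b \<in> U j" for j b
  proof -
    have "{j} \<in> ?K" using j by (intro nerveI[where b = b]) auto
    then have K: "{j} \<in> simplices ?K 0" by (simp add: simplices_def)
    have "s j b = 1 \<or> s j b = -1" using \<alpha>(1)[OF j] \<beta>(1)[OF j] by (auto simp: s_def sgn_if)
    then show ?thesis
    proof
      assume "s j b = -1"
      moreover from this have "s j b' = -1" if "b' \<in> U j" for b' using s_const[OF j(1) that j(2)] by simp
      then have "\<epsilon> {j} = 1" using K by (auto simp: \<epsilon>_def)
      ultimately show ?thesis by simp
    next
      assume 1: "s j b = 1"
      then have "\<epsilon> {j} = 0" using j by (auto simp: \<epsilon>_def)
      then show ?thesis using 1 by simp
    qed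
  qed
  have "\<tau> v - \<tau>' v = coboundary ?K 0 \<epsilon> v" for v
  proof (cases "v \<in> simplices ?K 1")
    case True
    obtain i j where v: "i < j" "v = {i, j}" "{i, j} \<in> ?K" by (rule simplices_1E[OF True])
    then obtain b where b: "i \<le> n" "j \<le> n" "b \<in> U i" "b \<in> U j" by (auto simp: nerve_def)
    note t = top[OF b(2,4)]
    \<comment> \<open>Rewriting the coordinates over \<open>U i\<close> in those over
      \<open>U j\<close> multiplies \<alpha> by the sign of \<tau> and \<beta> by the sign of
      \<tau>', so \<open>s\<close> changes by the product of the two signs.\<close>
    have "\<gamma> b 0 r = (\<alpha> i b * bit_sign (\<tau> {i, j})) * F j b r"
      "\<gamma> b 1 r = (\<beta> i b * bit_sign (\<tau>' {i, j})) * F' j b r" for r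
      unfolding \<alpha>(2)[OF b(1,3)] \<beta>(2)[OF b(1,3)] F_def F'_def
      by (simp_all add: tau_lift_transition[OF \<phi> U \<tau> b] tau_lift_transition[OF \<phi> U \<tau>' b])
    then have "\<alpha> j b = \<alpha> i b * bit_sign (\<tau> {i, j})" "\<beta> j b = \<beta> i b * bit_sign (\<tau>' {i, j})"
      using lifts_scalar_unique[OF F[OF b(2)] t(1), of "\<alpha> j b" "\<alpha> i b * bit_sign (\<tau> {i, j})"] \<alpha>(2)[OF b(2,4)]
        lifts_scalar_unique[OF F'[OF b(2)] t(1), of "\<beta> j b" "\<beta> i b * bit_sign (\<tau>' {i, j})"] \<beta>(2)[OF b(2,4)]
      by metis+
    then have "s j b = s i b * (sgn (bit_sign (\<tau> {i, j})) * sgn (bit_sign (\<tau>' {i, j})))"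
      by (simp add: s_def sgn_mult)
    also have "\<dots> = s i b * (bit_sign (\<tau> {i, j}) * bit_sign (\<tau>' {i, j}))"
      by (cases "\<tau> {i, j}"; cases "\<tau>' {i, j}") simp_all
    finally have "bit_sign (\<epsilon> {j}) = bit_sign (\<epsilon> {i}) * (bit_sign (\<tau> {i, j}) * bit_sign (\<tau>' {i, j}))"
      using \<epsilon>[OF b(1,3)] \<epsilon>[OF b(2,4)] by simp
    then have "\<tau> {i, j} - \<tau>' {i, j} = \<epsilon> {i} + \<epsilon> {j}"
      by (cases "\<tau> {i, j}"; cases "\<tau>' {i, j}"; cases "\<epsilon> {i}"; cases "\<epsilon> {j}") simp_all
    then show ?thesis unfolding v(2) bit_coboundary_0[OF v(3)] .
  next
    case False
    then show ?thesis using \<tau> \<tau>' by (simp add: cocycles_iff carrier_cochain_group coboundary_def)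
  qed
  moreover have "\<epsilon> \<in> carrier (cochain_group ?K 0)" by (simp add: carrier_cochain_group \<epsilon>_def)
  ultimately show ?thesis using coboundaries_Suc[of ?K 0] by auto
qed

section \<open>Torsors of logarithms along a homotopy\<close>

text \<open>Along a path of lines from \<open>[F b]\<close> to \<open>[F' b]\<close>, the homotopy classes of lifts from \<open>F b\<close> to
  \<open>F' b\<close> form a torsor under the integers. Relative to a fixed lift \<open>\<gamma> b\<close> starting at \<open>F b\<close> its
  elements are the logarithms \<open>e\<close> with \<open>\<gamma> b 1 = exp e * F' b\<close>. The following relation expresses
  that \<open>e\<close> is a continuous family of elements of these torsors along a map \<open>A\<close>.\<close>

definition log_lift ::
  "(real \<times> 'a \<Rightarrow> (nat \<Rightarrow> complex) set) \<Rightarrow> ('a \<Rightarrow> nat \<Rightarrow> complex) \<Rightarrow> ('a \<Rightarrow> nat \<Rightarrow> complex) \<Rightarrow>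
   ('a \<Rightarrow> real \<Rightarrow> nat \<Rightarrow> complex) \<Rightarrow> 's::real_normed_vector set \<Rightarrow> ('s \<Rightarrow> 'a) \<Rightarrow> ('s \<Rightarrow> complex) \<Rightarrow>
   (real \<times> 's \<Rightarrow> nat \<Rightarrow> complex) \<Rightarrow> ('s \<Rightarrow> complex) \<Rightarrow> ('s \<Rightarrow> real \<Rightarrow> complex) \<Rightarrow> bool"
  where "log_lift h F F' \<gamma> S A e G v r \<longleftrightarrow>
    lifts (top_of_set ({0..1} \<times> S)) (\<lambda>z. h (fst z, A (snd z))) G \<and> continuous_on S v \<and>
    (\<forall>p\<in>S. \<forall>k. G (0, p) k = F (A p) k) \<and>
    (\<forall>p\<in>S. \<forall>k. G (1, p) k = exp (v p) * F' (A p) k) \<and>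
    (\<forall>p\<in>S. continuous_on {0..1} (r p)) \<and> (\<forall>p\<in>S. r p 0 = 0) \<and>
    (\<forall>p\<in>S. \<forall>t\<in>{0..1}. \<forall>k. G (t, p) k = exp (r p t) * \<gamma> (A p) t k) \<and>
    (\<forall>p\<in>S. e p = v p - r p 1)"

text \<open>In \<open>log_lift\<close>, \<open>G\<close> is a jointly continuous lift starting at
  \<open>F\<close>, \<open>v\<close> a continuous logarithm of its end factor relative to
  \<open>F'\<close>, and \<open>r p\<close> the logarithm, along the path, of its factor relative to
  \<gamma>. Jumps of \<gamma> enter through \<open>r\<close>, so \<open>e\<close> itself need not be
  continuous.\<close>

definition log_section where
  "log_section h F F' \<gamma> S A e \<longleftrightarrow> (\<exists>G v r. log_lift h F F' \<gamma> S A e G v r)"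

lemma log_liftD:
  assumes "log_lift h F F' \<gamma> S A e G v r"
  shows "lifts (top_of_set ({0..1} \<times> S)) (\<lambda>z. h (fst z, A (snd z))) G" "continuous_on S v"
    "p \<in> S \<Longrightarrow> G (0, p) k = F (A p) k" "p \<in> S \<Longrightarrow> G (1, p) k = exp (v p) * F' (A p) k"
    "p \<in> S \<Longrightarrow> continuous_on {0..1} (r p)" "p \<in> S \<Longrightarrow> r p 0 = 0"
    "p \<in> S \<Longrightarrow> t \<in> {0..1} \<Longrightarrow> G (t, p) k = exp (r p t) * \<gamma> (A p) t k"
    "p \<in> S \<Longrightarrow> e p = v p - r p 1"
  using assms unfolding log_lift_def by blast+

lemma log_sectionI:
  assumes "lifts (top_of_set ({0..1} \<times> S)) (\<lambda>z. h (fst z, A (snd z))) G" "continuous_on S v"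
    "\<And>p k. p \<in> S \<Longrightarrow> G (0, p) k = F (A p) k" "\<And>p k. p \<in> S \<Longrightarrow> G (1, p) k = exp (v p) * F' (A p) k"
    "\<And>p. p \<in> S \<Longrightarrow> continuous_on {0..1} (r p)" "\<And>p. p \<in> S \<Longrightarrow> r p 0 = 0"
    "\<And>p t k. p \<in> S \<Longrightarrow> t \<in> {0..1} \<Longrightarrow> G (t, p) k = exp (r p t) * \<gamma> (A p) t k"
    "\<And>p. p \<in> S \<Longrightarrow> e p = v p - r p 1"
  shows "log_section h F F' \<gamma> S A e"
  unfolding log_section_def log_lift_def
  using assms by (intro exI[of _ G] exI[of _ v] exI[of _ r] conjI ballI allI)

lemma lifts_ratio_on:
  assumes "lifts (top_of_set S) q G" "lifts (top_of_set S) q G'"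
  obtains c where "continuous_on S c" "\<And>z. z \<in> S \<Longrightarrow> c z \<noteq> 0" "\<And>z k. z \<in> S \<Longrightarrow> G' z k = c z * G z k"
proof -
  obtain c where c: "continuous_map (top_of_set S) euclidean c" "\<And>z. z \<in> topspace (top_of_set S) \<Longrightarrow> c z \<noteq> 0"
    "\<And>z k. z \<in> topspace (top_of_set S) \<Longrightarrow> G' z k = c z * G z k"
    using lifts_ratio[OF assms] by blast
  show ?thesis by (rule that[of c]) (use c in simp_all)
qed

lemma log_section_compose:
  fixes f :: "'t::real_normed_vector \<Rightarrow> 's::real_normed_vector"
  assumes e: "log_section h F F' \<gamma> S A e" and f: "continuous_on S' f" "f ` S' \<subseteq> S"
    and A: "\<And>p. p \<in> S' \<Longrightarrow> A' p = A (f p)"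
  shows "log_section h F F' \<gamma> S' A' (\<lambda>p. e (f p))"
proof -
  obtain G v r where "log_lift h F F' \<gamma> S A e G v r"
    using e unfolding log_section_def by blast
  note l = log_liftD[OF this]
  have "continuous_on ({0..1::real} \<times> S') (\<lambda>z. (fst z, f (snd z)))"
    by (intro continuous_intros continuous_on_compose2[OF f(1)]) auto
  then have "continuous_map (top_of_set ({0..1::real} \<times> S')) (top_of_set ({0..1} \<times> S)) (\<lambda>z. (fst z, f (snd z)))"
    using f(2) by (auto simp: continuous_map_in_subtopology)
  from lifts_compose[OF l(1) this]
  have "lifts (top_of_set ({0..1} \<times> S')) (\<lambda>z. h (fst z, A (f (snd z)))) (\<lambda>z. G (fst z, f (snd z)))" by simp
  then have "lifts (top_of_set ({0..1} \<times> S')) (\<lambda>z. h (fst z, A' (snd z))) (\<lambda>z. G (fst z, f (snd z)))"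
    by (rule lifts_cong) (auto simp: A)
  then show ?thesis
    by (rule log_sectionI[where v = "\<lambda>p. v (f p)" and r = "\<lambda>p. r (f p)"])
      (use f(2) in \<open>auto intro: continuous_on_compose2[OF l(2) f] simp: A l(3) l(4) l(5) l(6) l(8) l(7) image_subset_iff
        simp del: atLeastAtMost_iff\<close>)
qed

text \<open>The integers act by shifting \<open>v\<close>, while \<open>G\<close> and
  \<open>r\<close> stay the same.\<close>

lemma log_section_add_period:
  assumes "log_section h F F' \<gamma> S A e" "exp c = 1"
  shows "log_section h F F' \<gamma> S A (\<lambda>p. e p + c)"
proof -
  obtain G v r where "log_lift h F F' \<gamma> S A e G v r"
    using assms(1) unfolding log_section_def by blast
  note l = log_liftD[OF this]
  have "continuous_on S (\<lambda>p. v p + c)" using l(2) by (intro continuous_intros)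
  then show ?thesis
    by (rule log_sectionI[OF l(1) _ l(3) _ l(5) l(6) l(7)])
      (simp_all add: l(4) l(8) exp_add assms(2))
qed

text \<open>Passage between the coordinates over two members of the cover. \<open>G\<close> and
  \<gamma> are multiplied by the same factor exp \<open>a\<close>, so \<open>r\<close> is unchanged;
  \<open>v\<close> gains \<open>a\<close> from the rescaled lift and loses \<open>a'\<close> to the
  new end coordinates.\<close>

lemma log_section_change:
  assumes e: "log_section h F1 F1' \<gamma>1 S A e"
    and A: "continuous_map (top_of_set S) (subtopology X W) A"
    and F: "\<And>b k. b \<in> W \<Longrightarrow> F2 b k = exp (a b) * F1 b k" and F': "\<And>b k. b \<in> W \<Longrightarrow> F2' b k = exp (a' b) * F1' b k"
    and \<gamma>: "\<And>b t k. b \<in> W \<Longrightarrow> \<gamma>2 b t k = exp (a b) * \<gamma>1 b t k"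
    and a: "continuous_map (subtopology X W) euclidean a" and a': "continuous_map (subtopology X W) euclidean a'"
  shows "log_section h F2 F2' \<gamma>2 S A (\<lambda>p. e p + a (A p) - a' (A p))"
proof -
  obtain G v r where "log_lift h F1 F1' \<gamma>1 S A e G v r"
    using e unfolding log_section_def by blast
  note l = log_liftD[OF this]
  have AW: "A p \<in> W" if "p \<in> S" for p using A that by (auto simp: continuous_map_def)
  have ca: "continuous_on S (\<lambda>p. a (A p))" and ca': "continuous_on S (\<lambda>p. a' (A p))"
    using continuous_map_compose[OF A a] continuous_map_compose[OF A a'] by (simp_all add: o_def)
  let ?G = "\<lambda>z k. exp (a (A (snd z))) * G z k"
  have "continuous_on ({0..1::real} \<times> S) (\<lambda>z. exp (a (A (snd z))))"
    by (intro continuous_intros continuous_on_compose2[OF ca]) auto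
  then have "lifts (top_of_set ({0..1} \<times> S)) (\<lambda>z. h (fst z, A (snd z))) ?G"
    by (intro lifts_scale[OF l(1)]) auto
  moreover have "continuous_on S (\<lambda>p. a (A p) + v p - a' (A p))"
    using l(2) ca ca' by (intro continuous_intros)
  ultimately show ?thesis
    by (rule log_sectionI[OF _ _ _ _ l(5) l(6)])
      (simp_all add: l(3) l(4) l(7) l(8) AW F F' \<gamma> exp_add exp_diff del: atLeastAtMost_iff)
qed

text \<open>Distinct logarithms of 1 are at least 2 pi apart, so a continuous choice of them on a
  connected set cannot jump.\<close>

lemma continuous_log_one_constant:
  fixes f :: "'s::real_normed_vector \<Rightarrow> complex"
  assumes S: "convex S" and f: "continuous_on S f" and one: "\<And>x. x \<in> S \<Longrightarrow> exp (f x) = 1"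
    and xy: "x \<in> S" "y \<in> S"
  shows "f x = f y"
proof -
  have "f constant_on S"
  proof (rule continuous_discrete_range_constant[OF convex_connected[OF S] f])
    fix x assume x: "x \<in> S"
    have "2 * pi \<le> norm (f y - f x)" if y: "y \<in> S" "f y \<noteq> f x" for y
    proof -
      have "exp (f y) = exp (f x)" using one x y by simp
      then obtain n :: int where n: "f y = f x + of_int (2 * n) * of_real pi * \<i>"
        by (auto simp: exp_eq)
      with y have "n \<noteq> 0" by auto
      then have "1 \<le> \<bar>real_of_int n\<bar>" by linarith
      then have "2 * pi \<le> 2 * pi * \<bar>real_of_int n\<bar>" by simp
      also have "\<dots> = norm (f y - f x)" by (simp add: n norm_mult abs_mult)
      finally show ?thesis .
    qed
    then show "\<exists>e>0. \<forall>y. y \<in> S \<and> f y \<noteq> f x \<longrightarrow> e \<le> norm (f y - f x)"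
      by (intro exI[of _ "2 * pi"]) auto
  qed
  then show ?thesis using xy by (auto simp: constant_on_def)
qed

text \<open>The situation over one member \<open>Y\<close> of the cover. The normalisation
  \<open>\<gamma>0\<close> makes any lift that starts at \<open>F\<close> comparable with \<gamma>
  by a logarithm starting at 0.\<close>

locale line_homotopy =
  fixes X :: "'a topology" and Y :: "'a set" and h :: "real \<times> 'a \<Rightarrow> (nat \<Rightarrow> complex) set"
    and F F' :: "'a \<Rightarrow> nat \<Rightarrow> complex" and \<gamma> :: "'a \<Rightarrow> real \<Rightarrow> nat \<Rightarrow> complex"
  assumes h: "continuous_map (prod_topology (top_of_set {0..1}) X) CP_inf h"
    and Y: "Y \<subseteq> topspace X"
    and F: "lifts (subtopology X Y) (\<lambda>b. h (0, b)) F"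
    and F': "lifts (subtopology X Y) (\<lambda>b. h (1, b)) F'"
    and \<gamma>: "\<And>b. b \<in> Y \<Longrightarrow> lifts (top_of_set {0..1}) (\<lambda>t. h (t, b)) (\<gamma> b)"
    and \<gamma>0: "\<And>b. b \<in> Y \<Longrightarrow> \<gamma> b 0 = F b"
begin

lemma topspace_Y: "topspace (subtopology X Y) = Y"
  using Y by auto

lemma F_nonzero: "b \<in> Y \<Longrightarrow> \<exists>k. F b k \<noteq> 0" and F'_nonzero: "b \<in> Y \<Longrightarrow> \<exists>k. F' b k \<noteq> 0"
  and \<gamma>_nonzero: "b \<in> Y \<Longrightarrow> t \<in> {0..1} \<Longrightarrow> \<exists>k. \<gamma> b t k \<noteq> 0"
  using lifts_nonzero[OF F, of b] lifts_nonzero[OF F', of b] lifts_nonzero[OF \<gamma>, of b t] topspace_Y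
  by (auto simp: fun_eq_iff)

lemma log_section_value:
  assumes "log_section h F F' \<gamma> S A e" "p \<in> S"
  shows "\<gamma> (A p) 1 k = exp (e p) * F' (A p) k"
proof -
  obtain G v r where "log_lift h F F' \<gamma> S A e G v r"
    using assms(1) unfolding log_section_def by blast
  note l = log_liftD[OF this]
  have "exp (v p) * F' (A p) k = exp (r p 1) * \<gamma> (A p) 1 k"
    using l(4)[OF assms(2), of k] l(7)[OF assms(2), of 1 k] by simp
  moreover have "exp (v p) = exp (r p 1) * exp (e p)" using l(8) assms(2) by (simp add: mult_exp_exp)
  ultimately have "exp (r p 1) * \<gamma> (A p) 1 k = exp (r p 1) * (exp (e p) * F' (A p) k)" by simp
  then show ?thesis by simp
qed

text \<open>The two lifts differ by a factor exp \<mu> on the contractible set [0,1] x S. The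
  difference of the sections is the sum of \<open>\<mu> (0, x)\<close> and
  \<open>v' x - v x - \<mu> (1, x)\<close>; both are continuous logarithms of 1, hence constant. The
  possibly discontinuous \<gamma> enters only through \<open>r' - r\<close>, where it
  cancels.\<close>

lemma log_section_unique:
  assumes S: "convex S" and A: "A ` S \<subseteq> Y"
    and e: "log_section h F F' \<gamma> S A e" and e': "log_section h F F' \<gamma> S A e'"
    and p: "p \<in> S" "q \<in> S" and eq: "e p = e' p"
  shows "e q = e' q"
proof -
  let ?Q = "{0..1::real} \<times> S"
  obtain G v r where "log_lift h F F' \<gamma> S A e G v r"
    using e unfolding log_section_def by blast
  note l = log_liftD[OF this]
  obtain G' v' r' where "log_lift h F F' \<gamma> S A e' G' v' r'"
    using e' unfolding log_section_def by blast
  note l' = log_liftD[OF this]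
  obtain c where c: "continuous_on ?Q c" "\<And>z. z \<in> ?Q \<Longrightarrow> c z \<noteq> 0" "\<And>z k. z \<in> ?Q \<Longrightarrow> G' z k = c z * G z k"
    using lifts_ratio_on[OF l(1) l'(1)] by blast
  have "convex ?Q" using S by (intro convex_Times) auto
  then obtain \<mu> where \<mu>: "continuous_on ?Q \<mu>" "\<And>z. z \<in> ?Q \<Longrightarrow> c z = exp (\<mu> z)"
    using continuous_logarithm_on_contractible[OF c(1) _ c(2)] convex_imp_contractible by blast
  have \<mu>0: "exp (\<mu> (0, x)) = 1" if x: "x \<in> S" for x
  proof -
    obtain k where k: "F (A x) k \<noteq> 0" using F_nonzero A x by blast
    have "G' (0, x) k = exp (\<mu> (0, x)) * G (0, x) k" using c(3)[of "(0, x)" k] \<mu>(2)[of "(0, x)"] x by simp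
    then show ?thesis using l(3) l'(3) x k by simp
  qed
  have \<mu>1: "exp (v' x - v x - \<mu> (1, x)) = 1" if x: "x \<in> S" for x
  proof -
    obtain k where k: "F' (A x) k \<noteq> 0" using F'_nonzero A x by blast
    have "G' (1, x) k = exp (\<mu> (1, x)) * G (1, x) k" using c(3)[of "(1, x)" k] \<mu>(2)[of "(1, x)"] x by simp
    then show ?thesis using l(4) l'(4) x k by (simp add: exp_diff)
  qed
  \<comment> \<open>At fixed \<open>x\<close> both logarithms refer to the same path \<gamma>. Their
    difference follows the change of \<mu> in time up to a continuous logarithm of 1, which is 0 at
    time 0.\<close>
  have \<mu>t: "r' x 1 - r x 1 = \<mu> (1, x) - \<mu> (0, x)" if x: "x \<in> S" for x
  proof -
    let ?f = "\<lambda>t. r' x t - r x t - (\<mu> (t, x) - \<mu> (0, x))"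
    have "continuous_on {0..1} (\<lambda>t. \<mu> (t, x))"
      using x by (intro continuous_on_compose2[OF \<mu>(1)] continuous_intros) auto
    then have cont_f: "continuous_on {0..1} ?f" using l(5) l'(5) x by (intro continuous_intros) auto
    have one_f: "exp (?f t) = 1" if t: "t \<in> {0..1}" for t
    proof -
      obtain k where k: "\<gamma> (A x) t k \<noteq> 0" using \<gamma>_nonzero A x t by blast
      have "G' (t, x) k = exp (\<mu> (t, x)) * G (t, x) k" using c(3)[of "(t, x)" k] \<mu>(2)[of "(t, x)"] x t by simp
      then have "exp (r' x t) = exp (\<mu> (t, x)) * exp (r x t)"
        using l(7)[OF x t, of k] l'(7)[OF x t, of k] k by simp
      then show ?thesis using \<mu>0[OF x] by (simp add: exp_diff)
    qed
    have "?f 1 = ?f 0" by (rule continuous_log_one_constant[OF _ cont_f one_f]) auto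
    then show ?thesis using l(6) l'(6) x by simp
  qed
  have c0: "continuous_on S (\<lambda>x. \<mu> (0, x))"
    by (rule continuous_on_compose2[OF \<mu>(1)]) (auto intro!: continuous_intros)
  have c1: "continuous_on S (\<lambda>x. \<mu> (1, x))"
    by (rule continuous_on_compose2[OF \<mu>(1)]) (auto intro!: continuous_intros)
  have "\<mu> (0, p) = \<mu> (0, q)" by (rule continuous_log_one_constant[OF S c0 \<mu>0 p])
  moreover have "v' p - v p - \<mu> (1, p) = v' q - v q - \<mu> (1, q)"
    by (rule continuous_log_one_constant[OF S _ \<mu>1 p]) (intro continuous_intros l(2) l'(2) c1)
  moreover have "e' x - e x = (v' x - v x - \<mu> (1, x)) + \<mu> (0, x)" if "x \<in> S" for x
  proof -
    have "e' x - e x = (v' x - v x) - (r' x 1 - r x 1)" using l(8) l'(8) that by simp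
    then show ?thesis unfolding \<mu>t[OF that] by simp
  qed
  ultimately have "e' p - e p = e' q - e q" using p by simp
  then show ?thesis using eq by simp
qed

text \<open>Along a constant map the reference lift \<open>\<gamma> b\<close> itself carries a
  constant section, with which \<open>log_section_unique\<close> compares \<open>e\<close>.\<close>

lemma log_section_const:
  assumes S: "convex S" and A: "\<And>p. p \<in> S \<Longrightarrow> A p = b" and b: "b \<in> Y"
    and e: "log_section h F F' \<gamma> S A e" and pq: "p \<in> S" "q \<in> S"
  shows "e p = e q"
proof -
  have "continuous_map (top_of_set ({0..1} \<times> S)) (top_of_set {0..1::real}) fst"
    by (auto simp: continuous_map_in_subtopology intro!: continuous_intros)
  from lifts_compose[OF \<gamma>[OF b] this]
  have "lifts (top_of_set ({0..1} \<times> S)) (\<lambda>z. h (fst z, A (snd z))) (\<lambda>z. \<gamma> b (fst z))"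
    by (rule lifts_cong) (auto simp: A)
  then have "log_section h F F' \<gamma> S A (\<lambda>_. e p)"
    by (rule log_sectionI[where v = "\<lambda>_. e p" and r = "\<lambda>_ _. 0"])
      (use log_section_value[OF e pq(1)] A pq(1) in \<open>auto simp: \<gamma>0[OF b]\<close>)
  from log_section_unique[OF S _ this e pq] A b show ?thesis by auto
qed

text \<open>A lift supplied by \<open>lift\<close> is rescaled to start at \<open>F\<close>, and
  convexity of \<open>S\<close> gives the logarithm \<open>v\<close> of its end factor. The value at
  \<open>p\<close> is then corrected by a logarithm of 1, as all admissible values there have the
  same exponential.\<close>

lemma log_section_exists:
  assumes S: "convex S" and A: "continuous_map (top_of_set S) (subtopology X Y) A"
    and lift: "\<And>q :: real \<times> 's::real_normed_vector \<Rightarrow> (nat \<Rightarrow> complex) set. continuous_map (top_of_set ({0..1} \<times> S)) CP_inf q \<Longrightarrow>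
      \<exists>G. lifts (top_of_set ({0..1} \<times> S)) q G"
    and p: "p \<in> S" and c: "\<And>k. \<gamma> (A p) 1 k = exp c * F' (A p) k"
  shows "\<exists>e. log_section h F F' \<gamma> S A e \<and> e p = c"
proof -
  let ?Q = "{0..1::real} \<times> S"
  have AY: "A x \<in> Y" if "x \<in> S" for x using A that by (auto simp: continuous_map_def)
  have "continuous_map (top_of_set ?Q) (prod_topology (top_of_set {0..1}) X) (\<lambda>z. (fst z, A (snd z)))"
  proof (intro continuous_map_pairedI)
    show "continuous_map (top_of_set ?Q) (top_of_set {0..1}) fst"
      by (auto simp: continuous_map_in_subtopology intro!: continuous_intros)
    have "continuous_map (top_of_set ?Q) (top_of_set S) snd"
      by (auto simp: continuous_map_in_subtopology intro!: continuous_intros)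
    from continuous_map_compose[OF this continuous_map_into_fulltopology[OF A]]
    show "continuous_map (top_of_set ?Q) X (\<lambda>z. A (snd z))" by (simp add: o_def)
  qed
  from continuous_map_compose[OF this h] have "continuous_map (top_of_set ?Q) CP_inf (\<lambda>z. h (fst z, A (snd z)))"
    by (simp add: o_def)
  then obtain G0 where G0: "lifts (top_of_set ?Q) (\<lambda>z. h (fst z, A (snd z))) G0" using lift by blast
  have slice: "continuous_map (top_of_set S) (top_of_set ?Q) (\<lambda>x. (t, x))" if "t \<in> {0..1}" for t
    using that by (auto simp: continuous_map_in_subtopology intro!: continuous_intros)
  have "lifts (top_of_set S) (\<lambda>x. h (0, A x)) (\<lambda>x. G0 (0, x))" using lifts_compose[OF G0 slice[of 0]] by simp
  from lifts_ratio_on[OF this lifts_compose[OF F A]] obtain c0 where c0: "continuous_on S c0" "\<And>x. x \<in> S \<Longrightarrow> c0 x \<noteq> 0"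
    "\<And>x k. x \<in> S \<Longrightarrow> F (A x) k = c0 x * G0 (0, x) k"
    by blast
  define G where "G z k = c0 (snd z) * G0 z k" for z k
  have "continuous_on ?Q (\<lambda>z. c0 (snd z))" by (intro continuous_on_compose2[OF c0(1)] continuous_intros) auto
  then have G: "lifts (top_of_set ?Q) (\<lambda>z. h (fst z, A (snd z))) G"
    unfolding G_def using c0(2) by (intro lifts_scale[OF G0]) auto
  have G_0: "G (0, x) k = F (A x) k" if "x \<in> S" for x k using c0(3) that by (simp add: G_def)
  have "lifts (top_of_set S) (\<lambda>x. h (1, A x)) (\<lambda>x. G (1, x))" using lifts_compose[OF G slice[of 1]] by simp
  from lifts_ratio_on[OF lifts_compose[OF F' A] this] obtain c1 where c1: "continuous_on S c1" "\<And>x. x \<in> S \<Longrightarrow> c1 x \<noteq> 0"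
    "\<And>x k. x \<in> S \<Longrightarrow> G (1, x) k = c1 x * F' (A x) k"
    by blast
  obtain v where v: "continuous_on S v" "\<And>x. x \<in> S \<Longrightarrow> c1 x = exp (v x)"
    using continuous_logarithm_on_contractible[OF c1(1) convex_imp_contractible[OF S] c1(2)] by blast
  have "\<exists>r. continuous_on {0..1} r \<and> r 0 = 0 \<and> (\<forall>t\<in>{0..1}. \<forall>k. G (t, x) k = exp (r t) * \<gamma> (A x) t k)" if x: "x \<in> S" for x
  proof -
    have "continuous_map (top_of_set {0..1}) (top_of_set ?Q) (\<lambda>t. (t, x))"
      using x by (auto simp: continuous_map_in_subtopology intro!: continuous_intros)
    from lifts_compose[OF G this] have "lifts (top_of_set {0..1}) (\<lambda>t. h (t, A x)) (\<lambda>t. G (t, x))" by simp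
    from lifts_ratio_on[OF \<gamma>[OF AY[OF x]] this] obtain \<kappa> where \<kappa>: "continuous_on {0..1} \<kappa>" "\<And>t. t \<in> {0..1} \<Longrightarrow> \<kappa> t \<noteq> 0"
      "\<And>t k. t \<in> {0..1} \<Longrightarrow> G (t, x) k = \<kappa> t * \<gamma> (A x) t k"
      by blast
    have "contractible {0..1::real}" by (simp add: convex_imp_contractible)
    then obtain r where r: "continuous_on {0..1} r" "\<And>t. t \<in> {0..1} \<Longrightarrow> \<kappa> t = exp (r t)"
      using continuous_logarithm_on_contractible[OF \<kappa>(1) _ \<kappa>(2)] by blast
    obtain k where k: "F (A x) k \<noteq> 0" using F_nonzero AY x by blast
    have "exp (r 0) = 1" using \<kappa>(3)[of 0 k] r(2)[of 0] G_0[OF x, of k] \<gamma>0[OF AY[OF x]] k by simp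
    \<comment> \<open>\<open>r 0\<close> is a logarithm of 1, so subtracting it makes the logarithm
      start at 0 without changing the factor.\<close>
    then have "G (t, x) k = exp (r t - r 0) * \<gamma> (A x) t k" if "t \<in> {0..1}" for t k
      using \<kappa>(3)[OF that] r(2)[OF that] by (simp add: exp_diff)
    moreover have "continuous_on {0..1} (\<lambda>t. r t - r 0)" using r(1) by (intro continuous_intros)
    ultimately show ?thesis by (intro exI[of _ "\<lambda>t. r t - r 0"]) auto
  qed
  then have "\<forall>x\<in>S. \<exists>r. continuous_on {0..1} r \<and> r 0 = 0 \<and> (\<forall>t\<in>{0..1}. \<forall>k. G (t, x) k = exp (r t) * \<gamma> (A x) t k)"
    by blast
  from bchoice[OF this] obtain r where r: "\<forall>x\<in>S. continuous_on {0..1} (r x) \<and> r x 0 = 0 \<and>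
      (\<forall>t\<in>{0..1}. \<forall>k. G (t, x) k = exp (r x t) * \<gamma> (A x) t k)" by blast
  have G_1: "G (1, x) k = exp (v x) * F' (A x) k" if "x \<in> S" for x k using c1(3) v(2) that by simp
  have sec: "log_section h F F' \<gamma> S A (\<lambda>x. v x - r x 1)"
    using r by (intro log_sectionI[OF G v(1) G_0 G_1]) auto
  obtain k where k: "F' (A p) k \<noteq> 0" using F'_nonzero AY p by blast
  have "exp c = exp (v p - r p 1)" using log_section_value[OF sec p, of k] c[of k] k by simp
  then have "exp (c - (v p - r p 1)) = 1" by (simp add: exp_diff)
  from log_section_add_period[OF sec this] show ?thesis
    by (intro exI[of _ "\<lambda>x. v x - r x 1 + (c - (v p - r p 1))"]) auto
qed

end

section \<open>Injectivity in the complex case\<close>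

definition join_paths :: "(real \<Rightarrow> 'a) \<Rightarrow> (real \<Rightarrow> 'a) \<Rightarrow> real \<Rightarrow> 'a" where
  "join_paths \<alpha> \<omega> s = (if s \<le> 1 / 2 then \<alpha> (2 * s) else \<omega> (2 * s - 1))"

lemma join_paths_left: "s \<in> {0..1} \<Longrightarrow> join_paths \<alpha> \<omega> (s / 2) = \<alpha> s"
  by (simp add: join_paths_def)

lemma join_paths_right: "\<alpha> 1 = \<omega> 0 \<Longrightarrow> s \<in> {0..1} \<Longrightarrow> join_paths \<alpha> \<omega> ((1 + s) / 2) = \<omega> s"
proof -
  assume \<alpha>: "\<alpha> 1 = \<omega> 0" and s: "s \<in> {0..1}"
  have "2 * ((1 + s) / 2) - 1 = s" by (simp add: field_simps)
  then show ?thesis using \<alpha> s by (cases "s = 0") (simp_all only: join_paths_def, auto)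
qed

lemma pathin_join_paths:
  assumes \<alpha>: "pathin Z \<alpha>" and \<omega>: "pathin Z \<omega>" and eq: "\<alpha> 1 = \<omega> 0"
  shows "pathin Z (join_paths \<alpha> \<omega>)"
  unfolding pathin_def join_paths_def
proof (rule continuous_map_cases_le)
  let ?I = "top_of_set {0..1::real}"
  show "continuous_map ?I euclideanreal (\<lambda>s. s)" "continuous_map ?I euclideanreal (\<lambda>s. 1 / 2)"
    by simp_all
  have "continuous_map (subtopology ?I {s \<in> topspace ?I. s \<le> 1 / 2}) ?I (\<lambda>s. 2 * s)"
    by (auto simp: continuous_map_in_subtopology subtopology_subtopology intro!: continuous_intros)
  from continuous_map_compose[OF this \<alpha>[unfolded pathin_def]]
  show "continuous_map (subtopology ?I {s \<in> topspace ?I. s \<le> 1 / 2}) Z (\<lambda>s. \<alpha> (2 * s))"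
    by (simp add: o_def)
  have "continuous_map (subtopology ?I {s \<in> topspace ?I. 1 / 2 \<le> s}) ?I (\<lambda>s. 2 * s - 1)"
    by (auto simp: continuous_map_in_subtopology subtopology_subtopology intro!: continuous_intros)
  from continuous_map_compose[OF this \<omega>[unfolded pathin_def]]
  show "continuous_map (subtopology ?I {s \<in> topspace ?I. 1 / 2 \<le> s}) Z (\<lambda>s. \<omega> (2 * s - 1))"
    by (simp add: o_def)
  fix s :: real assume "s = 1 / 2"
  then have "2 * s = 1" by simp
  then show "\<alpha> (2 * s) = \<omega> (2 * s - 1)" using eq by simp
qed

lemma pathin_reverse:
  assumes "pathin Z \<alpha>"
  shows "pathin Z (\<lambda>s. \<alpha> (1 - s))"
proof -
  have "continuous_map (top_of_set {0..1}) (top_of_set {0..1::real}) (\<lambda>s. 1 - s)"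
    by (auto simp: continuous_map_in_subtopology intro!: continuous_intros)
  from continuous_map_compose[OF this assms[unfolded pathin_def]] show ?thesis
    by (simp add: pathin_def o_def)
qed

context line_homotopy
begin

lemma pathin_memD: "pathin (subtopology X Y) \<omega> \<Longrightarrow> s \<in> {0..1} \<Longrightarrow> \<omega> s \<in> Y"
  by (auto simp: pathin_def continuous_map_def)

lemma log_section_on_path:
  assumes "pathin (subtopology X Y) \<omega>" "\<And>k. \<gamma> (\<omega> 0) 1 k = exp c * F' (\<omega> 0) k"
  shows "\<exists>e. log_section h F F' \<gamma> {0..1} \<omega> e \<and> e 0 = c"
proof (rule log_section_exists)
  fix q :: "real \<times> real \<Rightarrow> (nat \<Rightarrow> complex) set"
  assume "continuous_map (top_of_set ({0..1} \<times> {0..1})) CP_inf q"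
  then show "\<exists>G. lifts (top_of_set ({0..1} \<times> {0..1})) q G" by (rule square_lift_exists) blast
qed (use assms in \<open>auto simp: pathin_def\<close>)

lemma log_section_on_square:
  assumes "continuous_map (top_of_set ({0..1} \<times> {0..1})) (subtopology X Y) A"
    "\<And>k. \<gamma> (A (0, 0)) 1 k = exp c * F' (A (0, 0)) k"
  shows "\<exists>e. log_section h F F' \<gamma> ({0..1} \<times> {0..1::real}) A e \<and> e (0::real, 0) = c"
proof (rule log_section_exists)
  fix q :: "real \<times> real \<times> real \<Rightarrow> (nat \<Rightarrow> complex) set"
  assume "continuous_map (top_of_set ({0..1} \<times> {0..1} \<times> {0..1})) CP_inf q"
  then show "\<exists>G. lifts (top_of_set ({0..1} \<times> {0..1} \<times> {0..1})) q G" by (rule cube_lift_exists) blast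
qed (use assms in \<open>auto intro!: convex_Times\<close>)

lemma log_section_path_unique:
  assumes "pathin (subtopology X Y) \<omega>" "log_section h F F' \<gamma> {0..1} \<omega> e" "log_section h F F' \<gamma> {0..1} \<omega> e'"
    and "s \<in> {0..1}" "t \<in> {0..1}" "e s = e' s"
  shows "e t = e' t"
  using pathin_memD[OF assms(1)] by (intro log_section_unique[OF _ _ assms(2-6)]) auto

text \<open>A null homotopy of the loop formed by two paths carries a section over the square, which is
  constant on the three sides that are mapped to the base point.\<close>

lemma log_section_monodromy:
  assumes sc: "simply_connected_space (subtopology X Y)"
    and \<alpha>: "pathin (subtopology X Y) \<alpha>" and \<omega>: "pathin (subtopology X Y) \<omega>"
    and ends: "\<alpha> 0 = \<omega> 0" "\<alpha> 1 = \<omega> 1"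
    and e: "log_section h F F' \<gamma> {0..1} \<alpha> e" and d: "log_section h F F' \<gamma> {0..1} \<omega> d" and ed: "e 0 = d 0"
  shows "e 1 = d 1"
proof -
  let ?I = "{0..1::real}"
  \<comment> \<open>The loop runs along \<alpha> and back along \<omega>; at parameter 1/2 it passes
    the common end point.\<close>
  define l where "l = join_paths \<alpha> (\<lambda>s. \<omega> (1 - s))"
  define b where "b = \<alpha> 0"
  have l: "pathin (subtopology X Y) l"
    unfolding l_def using \<alpha> pathin_reverse[OF \<omega>] ends by (intro pathin_join_paths) auto
  have l01: "l 0 = b" "l 1 = b" using ends by (auto simp: l_def join_paths_def b_def)
  have b: "b \<in> Y" using pathin_memD[OF \<alpha>, of 0] by (simp add: b_def)
  have "homotopic_with (\<lambda>g. g 0 = l 0 \<and> g 1 = l 0) (top_of_set ?I) (subtopology X Y) l (\<lambda>_. l 0)"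
  proof -
    have "pathin (subtopology X Y) l \<and> l 1 = l 0 \<longrightarrow>
        homotopic_with (\<lambda>g. g 0 = l 0 \<and> g 1 = l 0) (top_of_set ?I) (subtopology X Y) l (\<lambda>_. l 0)"
      using sc unfolding simply_connected_space_def by blast
    moreover have "l 1 = l 0" by (simp only: l01)
    ultimately show ?thesis using l by blast
  qed
  then obtain A where A: "continuous_map (prod_topology (top_of_set ?I) (top_of_set ?I)) (subtopology X Y) A"
    and A_left: "\<And>s. A (0, s) = l s" and A_right: "\<And>s. A (1, s) = b"
    and A_ends: "\<And>t. t \<in> ?I \<Longrightarrow> A (t, 0) = b \<and> A (t, 1) = b"
    unfolding homotopic_with_def l01 by blast
  have "\<gamma> (A (0, 0)) 1 k = exp (e 0) * F' (A (0, 0)) k" for k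
    using log_section_value[OF e, of 0 k] by (simp add: A_left l01 b_def)
  then obtain E where E: "log_section h F F' \<gamma> (?I \<times> ?I) A E" and E0: "E (0, 0) = e 0"
    using log_section_on_square[of A "e 0"] A by auto
  have cI: "convex ?I" by simp
  have bottom: "log_section h F F' \<gamma> ?I (\<lambda>t. A (t, 0)) (\<lambda>t. E (t, 0))"
    by (rule log_section_compose[OF E]) (auto intro!: continuous_intros)
  have right: "log_section h F F' \<gamma> ?I (\<lambda>s. A (1, s)) (\<lambda>s. E (1, s))"
    by (rule log_section_compose[OF E]) (auto intro!: continuous_intros)
  have top: "log_section h F F' \<gamma> ?I (\<lambda>t. A (t, 1)) (\<lambda>t. E (t, 1))"
    by (rule log_section_compose[OF E]) (auto intro!: continuous_intros)
  \<comment> \<open>Three sides of the square go to the base point, which carries the value of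
    \<open>E\<close> from the corner (0, 0) around to (0, 1).\<close>
  have "E (0, 0) = E (1, 0)"
    by (rule log_section_const[OF cI _ b bottom]) (use A_ends in auto)
  also have "\<dots> = E (1, 1)"
    by (rule log_section_const[OF cI _ b right]) (use A_right in auto)
  also have "\<dots> = E (0, 1)"
    by (rule log_section_const[OF cI _ b top]) (use A_ends in auto)
  finally have E1: "E (0, 1) = e 0" using E0 by simp
  \<comment> \<open>On the fourth side, the half starting at (0, 0) runs along \<alpha> and the half
    starting at (0, 1) runs along \<omega>. The given sections therefore both end in the value of
    \<open>E\<close> at the midpoint.\<close>
  have "log_section h F F' \<gamma> ?I \<alpha> (\<lambda>s. E (0, s / 2))"
    by (rule log_section_compose[OF E]) (auto intro!: continuous_intros simp: A_left l_def join_paths_left)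
  from log_section_path_unique[OF \<alpha> this e, of 0 1] have 1: "E (0, 1 / 2) = e 1" using E0 by simp
  have "A (0, 1 - s / 2) = \<omega> s" if "s \<in> ?I" for s
    using join_paths_right[of \<alpha> "\<lambda>s. \<omega> (1 - s)" "1 - s"] that ends by (simp add: A_left l_def field_simps)
  then have "log_section h F F' \<gamma> ?I \<omega> (\<lambda>s. E (0, 1 - s / 2))"
    by (intro log_section_compose[OF E]) (auto intro!: continuous_intros)
  from log_section_path_unique[OF \<omega> this d, of 0 1] have "E (0, 1 / 2) = d 1" using E1 ed by simp
  with 1 show ?thesis by simp
qed

text \<open>\<open>u\<close> arises by transport from a base point, which by
  \<open>log_section_monodromy\<close> does not depend on the path. As \<gamma> may jump,
  \<open>u\<close> need not be continuous, and being parallel is expressed along paths.\<close>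

lemma parallel_logarithm:
  assumes sc: "simply_connected_space (subtopology X Y)"
  obtains u where "\<And>\<omega>. pathin (subtopology X Y) \<omega> \<Longrightarrow>
      \<exists>e. log_section h F F' \<gamma> {0..1} \<omega> e \<and> e 0 = u (\<omega> 0) \<and> e 1 = u (\<omega> 1)"
proof (cases "Y = {}")
  case True
  then have "\<not> pathin (subtopology X Y) \<omega>" for \<omega> using pathin_memD[of \<omega> 0] by auto
  then show ?thesis using that by blast
next
  case False
  then obtain b0 where b0: "b0 \<in> Y" by blast
  obtain c where "c \<noteq> 0" "\<And>k. \<gamma> b0 1 k = c * F' b0 k"
    using lifts_scalar[OF F' \<gamma>[OF b0], of b0 1] topspace_Y b0 by auto
  then have c: "\<gamma> b0 1 k = exp (Ln c) * F' b0 k" for k by simp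
  define R where "R b z \<longleftrightarrow> (\<exists>\<alpha> e. pathin (subtopology X Y) \<alpha> \<and> \<alpha> 0 = b0 \<and> \<alpha> 1 = b \<and>
      log_section h F F' \<gamma> {0..1} \<alpha> e \<and> e 0 = Ln c \<and> e 1 = z)" for b z
  have R_unique: "z = z'" if "R b z" "R b z'" for b z z'
    using that log_section_monodromy[OF sc] unfolding R_def by metis
  have path: "\<exists>\<alpha>. pathin (subtopology X Y) \<alpha> \<and> \<alpha> 0 = b0 \<and> \<alpha> 1 = b" if "b \<in> Y" for b
    using sc b0 that topspace_Y unfolding simply_connected_space_def path_connected_space_def by blast
  have "\<exists>z. R b z" if b: "b \<in> Y" for b
  proof -
    obtain \<alpha> where \<alpha>: "pathin (subtopology X Y) \<alpha>" "\<alpha> 0 = b0" "\<alpha> 1 = b" using path[OF b] by blast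
    then obtain e where "log_section h F F' \<gamma> {0..1} \<alpha> e" "e 0 = Ln c"
      using log_section_on_path[of \<alpha> "Ln c"] c by auto
    with \<alpha> show ?thesis unfolding R_def by blast
  qed
  then obtain u where u: "\<And>b. b \<in> Y \<Longrightarrow> R b (u b)" by metis
  show ?thesis
  proof (rule that)
    fix \<omega> assume \<omega>: "pathin (subtopology X Y) \<omega>"
    then have \<omega>Y: "\<omega> 0 \<in> Y" "\<omega> 1 \<in> Y" using pathin_memD by auto
    obtain \<alpha> d where \<alpha>: "pathin (subtopology X Y) \<alpha>" "\<alpha> 0 = b0" "\<alpha> 1 = \<omega> 0"
      and d: "log_section h F F' \<gamma> {0..1} \<alpha> d" "d 0 = Ln c" "d 1 = u (\<omega> 0)"
      using u[OF \<omega>Y(1)] unfolding R_def by blast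
    have j: "pathin (subtopology X Y) (join_paths \<alpha> \<omega>)" by (rule pathin_join_paths[OF \<alpha>(1) \<omega> \<alpha>(3)])
    have j0: "join_paths \<alpha> \<omega> 0 = b0" using \<alpha> by (simp add: join_paths_def)
    obtain e where e: "log_section h F F' \<gamma> {0..1} (join_paths \<alpha> \<omega>) e" "e 0 = Ln c"
      using log_section_on_path[OF j, of "Ln c"] c j0 by auto
    have "log_section h F F' \<gamma> {0..1} \<alpha> (\<lambda>s. e (s / 2))"
      by (rule log_section_compose[OF e(1)]) (auto intro!: continuous_intros simp: join_paths_left)
    from log_section_path_unique[OF \<alpha>(1) this d(1), of 0 1] have half: "e (1 / 2) = u (\<omega> 0)" using e d by simp
    \<comment> \<open>The second half of the transport along the concatenated path is the required
      section along \<omega>; its end is the value of \<open>u\<close> because the whole path starts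
      at the base point.\<close>
    have "log_section h F F' \<gamma> {0..1} \<omega> (\<lambda>s. e ((1 + s) / 2))"
      by (rule log_section_compose[OF e(1)]) (auto intro!: continuous_intros simp: join_paths_right[of \<alpha> \<omega>, OF \<alpha>(3)])
    moreover have "R (\<omega> 1) (e 1)"
      unfolding R_def using j j0 e by (intro exI[of _ "join_paths \<alpha> \<omega>"] exI[of _ e]) (auto simp: join_paths_def)
    then have "e 1 = u (\<omega> 1)" using R_unique u[OF \<omega>Y(2)] by blast
    ultimately show "\<exists>e. log_section h F F' \<gamma> {0..1} \<omega> e \<and> e 0 = u (\<omega> 0) \<and> e 1 = u (\<omega> 1)"
      using half by (intro exI[of _ "\<lambda>s. e ((1 + s) / 2)"]) simp
  qed
qed

end

text \<open>Sections over two members of the cover are compared along paths, so connectedness of the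
  intersection has to be upgraded to path-connectedness. The intersection inherits local
  path-connectedness as an open subset of \<open>U\<close>.\<close>

lemma path_connected_space_Int:
  assumes "locally_path_connected_space (subtopology X U)" "openin X V" "connectedin X (U \<inter> V)"
  shows "path_connected_space (subtopology X (U \<inter> V))"
proof -
  have "openin (subtopology X U) (U \<inter> V)"
    using assms(2) by (metis inf_commute openin_subtopology_Int)
  then have "locally_path_connected_space (subtopology (subtopology X U) (U \<inter> V))"
    by (rule locally_path_connected_space_open_subset[OF assms(1)])
  then have "locally_path_connected_space (subtopology X (U \<inter> V))"
    by (simp add: subtopology_subtopology Int_assoc[symmetric])
  moreover have "connected_space (subtopology X (U \<inter> V))" using assms(3) by (simp add: connectedin_def)
  ultimately show ?thesis
    by (metis connected_space_iff_components_subset_singleton path_components_eq_connected_components_of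
        path_connected_space_iff_components_subset_singleton)
qed


lemma alternating_reverse3: "alternating \<phi> [k, j, i] = - alternating \<phi> [i, j, k]"
  using alternating_swap[of \<phi> "[]" k j "[i]"] alternating_swap[of \<phi> "[j]" k i "[]"]
    alternating_swap[of \<phi> "[]" j i "[k]"] by simp

lemma homotopic_f_eta_imp_cohomologous:
  assumes \<phi>: "partition_dominated_by X n U \<phi>" and U: "open_cover X n U"
    and \<eta>: "\<eta> \<in> cocycles (nerve n U) 2" and \<eta>': "\<eta>' \<in> cocycles (nerve n U) 2"
    and lpc: "\<And>r. r \<le> n \<Longrightarrow> locally_path_connected_space (subtopology X (U r))"
    and sc: "\<And>r. r \<le> n \<Longrightarrow> simply_connected_space (subtopology X (U r))"
    and conn: "\<And>r t. r \<le> n \<Longrightarrow> t \<le> n \<Longrightarrow> U r \<inter> U t = {} \<or> connectedin X (U r \<inter> U t)"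
    and hom: "homotopic_with (\<lambda>_. True) X CP_inf (f_eta n U \<phi> \<eta>) (f_eta n U \<phi> \<eta>')"
  shows "(\<lambda>s. \<eta> s - \<eta>' s) \<in> coboundaries (nerve n U) 2"
proof -
  let ?I = "top_of_set {0..1::real}" and ?K = "nerve n U"
  obtain h where h: "continuous_map (prod_topology ?I X) CP_inf h"
    and h0: "\<And>b. h (0, b) = f_eta n U \<phi> \<eta> b" and h1: "\<And>b. h (1, b) = f_eta n U \<phi> \<eta>' b"
    using hom by (auto simp: homotopic_with_def)
  obtain \<gamma> where \<gamma>: "\<And>b. b \<in> topspace X \<Longrightarrow> lifts ?I (\<lambda>t. h (t, b)) (\<gamma> b)"
    using path_lift_exists[OF h] by blast
  define F F' where "F = eta_lift n \<phi> \<eta>" and "F' = eta_lift n \<phi> \<eta>'"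
  have F: "lifts (subtopology X (U j)) (\<lambda>b. h (0, b)) (F j)" if "j \<le> n" for j
    unfolding F_def h0 using lifts_f_eta[OF \<phi> U \<eta> that] by simp
  have F': "lifts (subtopology X (U j)) (\<lambda>b. h (1, b)) (F' j)" if "j \<le> n" for j
    unfolding F'_def h1 using lifts_f_eta[OF \<phi> U \<eta>' that] by simp
  note sub = open_coverD(2)[OF U]
  have top: "b \<in> topspace (subtopology X (U j))" "b \<in> topspace X" if "j \<le> n" "b \<in> U j" for j b
    using sub that by auto
  have "\<exists>c. c \<noteq> 0 \<and> (\<forall>r. F j b r = c * \<gamma> b 0 r)" if "j \<le> n" "b \<in> U j" for j b
    using lifts_scalar[OF \<gamma>[OF top(2)[OF that]] F[OF that(1)] _ top(1)[OF that], of 0] by auto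
  then obtain c where c: "\<And>j b. j \<le> n \<Longrightarrow> b \<in> U j \<Longrightarrow> c j b \<noteq> 0"
    "\<And>j b r. j \<le> n \<Longrightarrow> b \<in> U j \<Longrightarrow> F j b r = c j b * \<gamma> b 0 r" by metis
  \<comment> \<open>Rescaled to start at \<open>F j b\<close>, as \<open>line_homotopy\<close>
    demands. For fixed \<open>b\<close> all \<open>g j b\<close> are multiples of the same path, so
    they differ by factors constant in time.\<close>
  define g where "g j b t r = c j b * \<gamma> b t r" for j b t r
  have line: "line_homotopy X (U j) h (F j) (F' j) (g j)" if j: "j \<le> n" for j
  proof
    show "lifts ?I (\<lambda>t. h (t, b)) (g j b)" if b: "b \<in> U j" for b
      unfolding g_def using c(1)[OF j b] by (intro lifts_scale[OF \<gamma>[OF top(2)[OF j b]]]) auto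
    show "g j b 0 = F j b" if b: "b \<in> U j" for b
      using c(2)[OF j b] by (auto simp: g_def)
  qed (use h sub j F[OF j] F'[OF j] in auto)
  have "\<exists>u. \<forall>\<omega>. pathin (subtopology X (U j)) \<omega> \<longrightarrow>
      (\<exists>e. log_section h (F j) (F' j) (g j) {0..1} \<omega> e \<and> e 0 = u (\<omega> 0) \<and> e 1 = u (\<omega> 1))" if j: "j \<le> n" for j
    using line_homotopy.parallel_logarithm[OF line[OF j] sc[OF j]] by metis
  then obtain u where u: "\<And>j \<omega>. j \<le> n \<Longrightarrow> pathin (subtopology X (U j)) \<omega> \<Longrightarrow>
      \<exists>e. log_section h (F j) (F' j) (g j) {0..1} \<omega> e \<and> e 0 = u j (\<omega> 0) \<and> e 1 = u j (\<omega> 1)" by metis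
  have u_value: "g j b 1 r = exp (u j b) * F' j b r" if j: "j \<le> n" and b: "b \<in> U j" for j b r
  proof -
    have "pathin (subtopology X (U j)) (\<lambda>_. b)" using top(1)[OF j b] by (simp add: pathin_def)
    from u[OF j this] obtain e where "log_section h (F j) (F' j) (g j) {0..1} (\<lambda>_::real. b) e" "e 0 = u j b" by blast
    with line_homotopy.log_section_value[OF line[OF j] this(1), of 0 r] show ?thesis by simp
  qed
  \<comment> \<open>Explicit logarithms of the transition functions at the two ends. Being given by
    the partition of unity, they are continuous and single-valued.\<close>
  define T T' where "T i j b = 2 * of_real pi * \<i> * of_real (eta_transition n \<phi> \<eta> i j b)"
    and "T' i j b = 2 * of_real pi * \<i> * of_real (eta_transition n \<phi> \<eta>' i j b)" for i j b
  have F_T: "F j b r = exp (T j i b) * F i b r" and F'_T: "F' j b r = exp (T' j i b) * F' i b r"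
    if "j \<le> n" "i \<le> n" "b \<in> U j" "b \<in> U i" for i j b r
    using eta_lift_transition[OF \<phi> U \<eta> that] eta_lift_transition[OF \<phi> U \<eta>' that]
    by (simp_all add: F_def F'_def T_def T'_def unit_exp_conv_exp)
  have g_T: "g j b t r = exp (T j i b) * g i b t r" if ij: "j \<le> n" "i \<le> n" "b \<in> U j" "b \<in> U i" for i j b t r
  proof -
    have "c j b = exp (T j i b) * c i b"
    proof (rule lifts_scalar_unique[OF \<gamma>[OF top(2)[OF ij(1,3)]], of 0])
      show "c j b * \<gamma> b 0 r = exp (T j i b) * c i b * \<gamma> b 0 r" for r
        using F_T[OF ij, of r] c(2)[OF ij(1,3), of r] c(2)[OF ij(2,4), of r] by (simp add: mult.assoc)
    qed simp
    then show ?thesis by (simp add: g_def)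
  qed
  have cont_T: "continuous_map (subtopology X S) euclidean (T j i)" "continuous_map (subtopology X S) euclidean (T' j i)" for S i j
    unfolding T_def T'_def eta_transition_def
    by (intro continuous_map_mult continuous_map_const[THEN iffD2] continuous_map_of_real continuous_map_minus
        continuous_map_weighted_sum[OF \<phi>]; simp)+
  \<comment> \<open>Rewriting the section over \<open>U i\<close> in the coordinates over
    \<open>U j\<close> adds \<open>T j i - T' j i\<close>; \<open>D\<close> is the remaining
    difference to the section over \<open>U j\<close>.\<close>
  define D where "D i j b = u j b - (u i b + T j i b - T' j i b)" for i j b
  have exp_D: "exp (D i j b) = 1" if ij: "i \<le> n" "j \<le> n" "b \<in> U i" "b \<in> U j" for i j b
  proof -
    obtain r where r: "F' i b r \<noteq> 0" using line_homotopy.F'_nonzero[OF line[OF ij(1)] ij(3)] by blast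
    have "exp (u j b) * (exp (T' j i b) * F' i b r) = g j b 1 r"
      unfolding u_value[OF ij(2,4)] F'_T[OF ij(2,1,4,3)] ..
    also have "\<dots> = exp (T j i b) * (exp (u i b) * F' i b r)"
      unfolding g_T[OF ij(2,1,4,3)] u_value[OF ij(1,3)] ..
    finally have "exp (u j b) * exp (T' j i b) = exp (u i b) * exp (T j i b)" using r by (simp add: mult_ac)
    moreover have "exp (D i j b) = (exp (u j b) * exp (T' j i b)) / (exp (u i b) * exp (T j i b))"
      by (simp add: D_def exp_diff exp_add)
    ultimately show ?thesis by simp
  qed
  have D_path: "D i j (\<omega> 0) = D i j (\<omega> 1)"
    if ij: "i \<le> n" "j \<le> n" and \<omega>: "pathin (subtopology X (U i \<inter> U j)) \<omega>" for i j \<omega>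
  proof -
    have \<omega>i: "pathin (subtopology X (U i)) \<omega>" and \<omega>j: "pathin (subtopology X (U j)) \<omega>"
      using \<omega> by (auto simp: pathin_def continuous_map_in_subtopology)
    have \<omega>U: "\<omega> s \<in> U i" "\<omega> s \<in> U j" if "s \<in> {0..1}" for s
      using line_homotopy.pathin_memD[OF line] ij \<omega>i \<omega>j that by blast+
    obtain e where e: "log_section h (F i) (F' i) (g i) {0..1} \<omega> e" "e 0 = u i (\<omega> 0)" "e 1 = u i (\<omega> 1)"
      using u[OF ij(1) \<omega>i] by blast
    obtain d where d: "log_section h (F j) (F' j) (g j) {0..1} \<omega> d" "d 0 = u j (\<omega> 0)" "d 1 = u j (\<omega> 1)"
      using u[OF ij(2) \<omega>j] by blast
    \<comment> \<open>The section coming from \<open>U i\<close> is carried into the torsor of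
      \<open>U j\<close> and then shifted by a period so that it starts where \<open>d\<close>
      starts. Uniqueness makes both end at the same value, so \<open>D\<close> is the same at both
      ends.\<close>
    have "log_section h (F j) (F' j) (g j) {0..1} \<omega> (\<lambda>s. e s + T j i (\<omega> s) - T' j i (\<omega> s))"
    proof (rule log_section_change[OF e(1) \<omega>[unfolded pathin_def], where a = "T j i" and a' = "T' j i"])
      fix b t k assume "b \<in> U i \<inter> U j"
      then show "F j b k = exp (T j i b) * F i b k" "F' j b k = exp (T' j i b) * F' i b k"
        "g j b t k = exp (T j i b) * g i b t k"
        using ij by (auto intro: F_T F'_T g_T)
    qed (rule cont_T)+
    then have "log_section h (F j) (F' j) (g j) {0..1} \<omega> (\<lambda>s. e s + T j i (\<omega> s) - T' j i (\<omega> s) + D i j (\<omega> 0))"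
      using exp_D[OF ij \<omega>U] by (intro log_section_add_period) auto
    from line_homotopy.log_section_path_unique[OF line[OF ij(2)] \<omega>j this d(1), of 0 1]
    have "e 1 + T j i (\<omega> 1) - T' j i (\<omega> 1) + D i j (\<omega> 0) = d 1"
      using e(2) d(2) by (simp add: D_def)
    then show ?thesis using e(3) d(3) by (simp add: D_def[of i j "\<omega> 1"] algebra_simps)
  qed
  have "\<exists>m. \<forall>b\<in>U i \<inter> U j. D i j b = of_int (2 * m) * of_real pi * \<i>" if ij: "i \<le> n" "j \<le> n" for i j
  proof (cases "U i \<inter> U j = {}")
    case False
    then obtain b where b: "b \<in> U i" "b \<in> U j" by blast
    have pc: "path_connected_space (subtopology X (U i \<inter> U j))"
      using path_connected_space_Int[OF lpc[OF ij(1)] open_coverD(1)[OF U ij(2)]] conn[OF ij] False by blast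
    have "exp (D i j b) = exp 0" using exp_D[OF ij b] by simp
    then obtain m :: int where m: "D i j b = of_int (2 * m) * of_real pi * \<i>"
      unfolding exp_eq by auto
    have "D i j b' = D i j b" if b': "b' \<in> U i \<inter> U j" for b'
    proof -
      have "b \<in> topspace (subtopology X (U i \<inter> U j))" "b' \<in> topspace (subtopology X (U i \<inter> U j))"
        using b b' top(2)[OF ij(1)] by auto
      then obtain \<omega> where "pathin (subtopology X (U i \<inter> U j)) \<omega>" "\<omega> 0 = b" "\<omega> 1 = b'"
        using pc unfolding path_connected_space_def by blast
      then show ?thesis using D_path[OF ij, of \<omega>] by simp
    qed
    then show ?thesis using m by auto
  qed auto
  then obtain m where m: "\<And>i j b. i \<le> n \<Longrightarrow> j \<le> n \<Longrightarrow> b \<in> U i \<Longrightarrow> b \<in> U j \<Longrightarrow> D i j b = of_int (2 * m i j) * of_real pi * \<i>"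
    by (metis IntI)
  \<comment> \<open>The integers \<open>m\<close> have coboundary \<open>\<eta>' - \<eta>\<close>,
    hence the sign. \<open>Min\<close> and \<open>Max\<close> recover the ordered edge from its
    vertex set.\<close>
  define \<theta> where "\<theta> s = (if s \<in> simplices ?K 1 then - m (Min s) (Max s) else 0)" for s
  have "\<eta> s - \<eta>' s = coboundary ?K 1 \<theta> s" for s
  proof (cases "s \<in> simplices ?K 2")
    case True
    obtain i j k where s: "i < j" "j < k" "s = {i, j, k}" "{i, j, k} \<in> ?K" by (rule simplices_2E[OF True])
    then obtain b where ijk: "i \<le> n" "j \<le> n" "k \<le> n" "b \<in> U i" "b \<in> U j" "b \<in> U k"
      by (auto simp: nerve_def)
    have b: "b \<in> topspace X" using top ijk by blast
    \<comment> \<open>The indices are in decreasing order because \<open>D i j\<close> involves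
      \<open>T j i\<close>. Reversing three indices is an odd permutation, and its sign cancels the
      one in \<open>eta_sum_cocycle\<close>.\<close>
    have sum: "2 * of_real pi * \<i> * of_real (eta_transition n \<phi> \<zeta> j i b) - 2 * of_real pi * \<i> * of_real (eta_transition n \<phi> \<zeta> k i b)
        + 2 * of_real pi * \<i> * of_real (eta_transition n \<phi> \<zeta> k j b) = 2 * of_real pi * \<i> * of_int (\<zeta> s)"
      if \<zeta>: "\<zeta> \<in> cocycles ?K 2" for \<zeta>
    proof -
      have "eta_transition n \<phi> \<zeta> j i b - eta_transition n \<phi> \<zeta> k i b + eta_transition n \<phi> \<zeta> k j b = of_int (\<zeta> s)"
        using eta_sum_cocycle[OF \<phi> b \<zeta>, of k j i] ijk s
        by (simp add: alternating_reverse3[of \<zeta> k j i] alternating_less3)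
      then have "of_real (eta_transition n \<phi> \<zeta> j i b - eta_transition n \<phi> \<zeta> k i b + eta_transition n \<phi> \<zeta> k j b) =
          (of_int (\<zeta> s) :: complex)" by simp
      then show ?thesis by (metis distrib_left of_real_add of_real_diff right_diff_distrib)
    qed
    \<comment> \<open>The unknown values of \<open>u\<close> cancel in the alternating sum, and the
      explicit corrections remain.\<close>
    have "D j k b - D i k b + D i j b =
        (T' j i b - T' k i b + T' k j b) - (T j i b - T k i b + T k j b)"
      by (simp add: D_def)
    also have "\<dots> = 2 * of_real pi * \<i> * of_int (\<eta>' s - \<eta> s)"
      unfolding T_def T'_def sum[OF \<eta>] sum[OF \<eta>'] by (simp add: algebra_simps)
    also have "D j k b - D i k b + D i j b = 2 * of_real pi * \<i> * of_int (m j k - m i k + m i j)"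
      using m ijk by (simp add: algebra_simps)
    finally have "(of_int (m j k - m i k + m i j) :: complex) = of_int (\<eta>' s - \<eta> s)" by simp
    then have m_sum: "m j k - m i k + m i j = \<eta>' s - \<eta> s" by (simp only: of_int_eq_iff)
    have "{i, j} \<in> ?K" "{i, k} \<in> ?K" "{j, k} \<in> ?K" using s(4) by (auto intro: nerve_subset)
    then have "{i, j} \<in> simplices ?K 1" "{i, k} \<in> simplices ?K 1" "{j, k} \<in> simplices ?K 1"
      using s(1,2) by (auto simp: simplices_def)
    then have "\<theta> {i, j} = - m i j" "\<theta> {i, k} = - m i k" "\<theta> {j, k} = - m j k"
      using s(1,2) by (auto simp: \<theta>_def)
    then show ?thesis using coboundary_1[OF s(1,2,4), of \<theta>] m_sum by (simp add: s(3))
  next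
    case False
    then show ?thesis using \<eta> \<eta>' by (simp add: cocycles_iff carrier_cochain_group coboundary_def numeral_2_eq_2)
  qed
  moreover have "\<theta> \<in> carrier (cochain_group ?K 1)" by (simp add: carrier_cochain_group \<theta>_def)
  ultimately show ?thesis using coboundaries_Suc[of ?K 1] by (auto simp: numeral_2_eq_2)
qed

section \<open>The maps on cohomology\<close>

lemma homotopy_class_cong:
  assumes "homotopic_with (\<lambda>_. True) X Y f g"
  shows "homotopy_class X Y f = homotopy_class X Y g"
  using homotopic_with_trans[OF assms] homotopic_with_trans[OF homotopic_with_symD[OF assms]]
  by (auto simp: homotopy_class_def homotopy_rel_def)

text \<open>Continuity of \<open>g\<close> makes the constant homotopy available, so
  \<open>g\<close> belongs to its own class.\<close>

lemma homotopy_class_eqD: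
  assumes "homotopy_class X Y f = homotopy_class X Y g" "continuous_map X Y g"
  shows "homotopic_with (\<lambda>_. True) X Y f g"
proof -
  have "g \<in> homotopy_class X Y g" using assms(2) by (simp add: homotopy_class_def homotopy_rel_def)
  then have "g \<in> homotopy_class X Y f" using assms(1) by simp
  then show ?thesis by (simp add: homotopy_class_def homotopy_rel_def)
qed

lemma homotopy_class_in_classes:
  "continuous_map X Y f \<Longrightarrow> homotopy_class X Y f \<in> homotopy_classes X Y"
  unfolding homotopy_class_def homotopy_classes_def by (rule quotientI) simp

lemma cocycles_add:
  assumes "\<phi> \<in> cocycles K k" "\<psi> \<in> cocycles K k"
  shows "(\<lambda>s. \<phi> s + \<psi> s) \<in> cocycles K k"
  using assms by (simp add: cocycles_iff carrier_cochain_group coboundary_add)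

lemma w1_cohomology_class:
  assumes \<phi>: "partition_dominated_by X n U \<phi>" and U: "open_cover X n U" and \<tau>: "\<tau> \<in> cocycles (nerve n U) 1"
  shows "w1 X n U \<phi> (cohomology_class (nerve n U) 1 \<tau>) = homotopy_class X RP_inf (f_tau n U \<phi> \<tau>)"
  unfolding w1_def One_nat_def
proof (rule the_elem_cohomology_class)
  fix \<beta> :: "nat set \<Rightarrow> bit" assume "\<beta> \<in> coboundaries (nerve n U) (Suc 0)"
  then obtain \<epsilon> where \<beta>: "\<beta> = coboundary (nerve n U) 0 \<epsilon>" by (auto simp: coboundaries_Suc)
  \<comment> \<open>The shifted representative has to be a cocycle again, since the homotopy lemma
    uses the coordinates of both maps over the cover.\<close>
  have "\<beta> \<in> cocycles (nerve n U) 1"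
    unfolding \<beta> by (rule coboundary_0_in_cocycles) (rule nerve_subset)
  then have "(\<lambda>s. \<beta> s + \<tau> s) \<in> cocycles (nerve n U) 1" using \<tau> by (rule cocycles_add)
  from homotopic_f_tau_cohomologous[OF \<phi> U \<tau> this] \<beta>
  show "homotopy_class X RP_inf (f_tau n U \<phi> (\<lambda>s. \<beta> s + \<tau> s)) = homotopy_class X RP_inf (f_tau n U \<phi> \<tau>)"
    by (intro homotopy_class_cong) simp
qed

lemma c1_cohomology_class:
  assumes \<phi>: "partition_dominated_by X n U \<phi>" and U: "open_cover X n U" and \<eta>: "\<eta> \<in> cocycles (nerve n U) 2"
  shows "c1 X n U \<phi> (cohomology_class (nerve n U) 2 \<eta>) = homotopy_class X CP_inf (f_eta n U \<phi> \<eta>)"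
  unfolding c1_def numeral_2_eq_2
proof (rule the_elem_cohomology_class)
  fix \<beta> :: "nat set \<Rightarrow> int" assume "\<beta> \<in> coboundaries (nerve n U) (Suc (Suc 0))"
  then obtain \<theta> where \<beta>: "\<beta> = coboundary (nerve n U) 1 \<theta>" by (auto simp: coboundaries_Suc)
  have "\<beta> \<in> cocycles (nerve n U) 2"
    unfolding \<beta> by (rule coboundary_1_in_cocycles) (rule nerve_subset)
  then have "(\<lambda>s. \<beta> s + \<eta> s) \<in> cocycles (nerve n U) 2" using \<eta> by (rule cocycles_add)
  from homotopic_f_eta_cohomologous[OF \<phi> U \<eta> this] \<beta>
  show "homotopy_class X CP_inf (f_eta n U \<phi> (\<lambda>s. \<beta> s + \<eta> s)) = homotopy_class X CP_inf (f_eta n U \<phi> \<eta>)"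
    by (intro homotopy_class_cong) simp
qed

section \<open>Maps induced by refinements, and naturality\<close>

lemma nerve_refinement:
  assumes "\<And>i. i \<le> m \<Longrightarrow> \<rho> i \<le> n \<and> V i \<subseteq> U (\<rho> i)" "s \<in> nerve m V"
  shows "\<rho> ` s \<in> nerve n U"
proof -
  obtain b where b: "\<And>i. i \<in> s \<Longrightarrow> b \<in> V i" using assms(2) by (auto simp: nerve_def)
  show ?thesis
    by (rule nerveI[where b = b]) (use assms b in \<open>auto simp: nerve_def\<close>)
qed

lemma cohomology_pullback_class_1:
  fixes \<tau> :: "nat set \<Rightarrow> bit"
  assumes \<rho>: "\<And>i. i \<le> m \<Longrightarrow> \<rho> i \<le> n \<and> V i \<subseteq> U (\<rho> i)" and \<tau>: "\<tau> \<in> cocycles (nerve n U) 1"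
  shows "cohomology_pullback (nerve m V) 1 \<rho> (cohomology_class (nerve n U) 1 \<tau>) =
     cohomology_class (nerve m V) 1 (cochain_pullback (nerve m V) 1 \<rho> \<tau>)"
  unfolding cohomology_pullback_def One_nat_def
proof (rule the_elem_cohomology_class)
  fix \<beta> :: "nat set \<Rightarrow> bit" assume "\<beta> \<in> coboundaries (nerve n U) (Suc 0)"
  then have \<beta>: "\<beta> \<in> coboundaries (nerve n U) 1" by simp
  show "cohomology_class (nerve m V) (Suc 0) (cochain_pullback (nerve m V) (Suc 0) \<rho> (\<lambda>s. \<beta> s + \<tau> s)) =
      cohomology_class (nerve m V) (Suc 0) (cochain_pullback (nerve m V) (Suc 0) \<rho> \<tau>)"
  proof (rule cohomology_class_eqI, fold One_nat_def, rule bit_pullback_coboundary[OF _ _ _ \<beta>])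
    show "\<rho> ` s \<in> nerve n U" if "s \<in> nerve m V" for s
      using nerve_refinement[of m \<rho> n V U, OF \<rho> that] by simp
  qed (auto intro: nerve_subset cocycle_singleton[OF \<tau>])
qed

lemma cohomology_pullback_class_2:
  fixes \<eta> :: "nat set \<Rightarrow> int"
  assumes \<rho>: "\<And>i. i \<le> m \<Longrightarrow> \<rho> i \<le> n \<and> V i \<subseteq> U (\<rho> i)"
  shows "cohomology_pullback (nerve m V) 2 \<rho> (cohomology_class (nerve n U) 2 \<eta>) =
     cohomology_class (nerve m V) 2 (cochain_pullback (nerve m V) 2 \<rho> \<eta>)"
  unfolding cohomology_pullback_def numeral_2_eq_2
proof (rule the_elem_cohomology_class)
  fix \<beta> :: "nat set \<Rightarrow> int" assume "\<beta> \<in> coboundaries (nerve n U) (Suc (Suc 0))"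
  then have \<beta>: "\<beta> \<in> coboundaries (nerve n U) 2" by (simp add: numeral_2_eq_2)
  show "cohomology_class (nerve m V) (Suc (Suc 0)) (cochain_pullback (nerve m V) (Suc (Suc 0)) \<rho> (\<lambda>s. \<beta> s + \<eta> s)) =
      cohomology_class (nerve m V) (Suc (Suc 0)) (cochain_pullback (nerve m V) (Suc (Suc 0)) \<rho> \<eta>)"
  proof (rule cohomology_class_eqI, fold numeral_2_eq_2, rule pullback_coboundary_2[OF _ _ \<beta>])
    show "\<rho> ` s \<in> nerve n U" if "s \<in> nerve m V" for s
      using nerve_refinement[of m \<rho> n V U, OF \<rho> that] by simp
  qed (auto intro: nerve_subset)
qed

lemma w1_natural:
  assumes \<phi>: "partition_dominated_by X n U \<phi>" and U: "open_cover X n U"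
    and \<psi>: "partition_dominated_by X m V \<psi>" and V: "open_cover X m V"
    and \<rho>: "\<And>i. i \<le> m \<Longrightarrow> \<rho> i \<le> n \<and> V i \<subseteq> U (\<rho> i)" and c: "c \<in> carrier (cohomology (nerve n U) 1)"
  shows "w1 X m V \<psi> (cohomology_pullback (nerve m V) 1 \<rho> c) = w1 X n U \<phi> c"
proof -
  obtain \<tau> where \<tau>: "\<tau> \<in> cocycles (nerve n U) 1" "c = cohomology_class (nerve n U) 1 \<tau>"
    using c by (auto simp: carrier_cohomology)
  have \<tau>': "cochain_pullback (nerve m V) 1 \<rho> \<tau> \<in> cocycles (nerve m V) 1"
    using nerve_refinement[of m \<rho> n V U, OF \<rho>] nerve_subset by (intro bit_pullback_cocycle[OF \<tau>(1)]) blast+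
  have pullback: "cohomology_pullback (nerve m V) 1 \<rho> (cohomology_class (nerve n U) 1 \<tau>) =
      cohomology_class (nerve m V) 1 (cochain_pullback (nerve m V) 1 \<rho> \<tau>)"
    by (rule cohomology_pullback_class_1[OF _ \<tau>(1)]) (rule \<rho>)
  show ?thesis
    unfolding \<tau>(2) pullback w1_cohomology_class[OF \<phi> U \<tau>(1)]
      w1_cohomology_class[OF \<psi> V \<tau>']
    by (intro homotopy_class_cong homotopic_f_tau_refinement[OF \<phi> U \<tau>(1) \<psi> V _ \<tau>'] \<rho>)
qed

lemma c1_natural:
  assumes \<phi>: "partition_dominated_by X n U \<phi>" and U: "open_cover X n U"
    and \<psi>: "partition_dominated_by X m V \<psi>" and V: "open_cover X m V"
    and \<rho>: "\<And>i. i \<le> m \<Longrightarrow> \<rho> i \<le> n \<and> V i \<subseteq> U (\<rho> i)" and c: "c \<in> carrier (cohomology (nerve n U) 2)"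
  shows "c1 X m V \<psi> (cohomology_pullback (nerve m V) 2 \<rho> c) = c1 X n U \<phi> c"
proof -
  obtain \<eta> where \<eta>: "\<eta> \<in> cocycles (nerve n U) 2" "c = cohomology_class (nerve n U) 2 \<eta>"
    using c by (auto simp: carrier_cohomology)
  have \<eta>': "cochain_pullback (nerve m V) 2 \<rho> \<eta> \<in> cocycles (nerve m V) 2"
    using nerve_refinement[of m \<rho> n V U, OF \<rho>] nerve_subset by (intro pullback_cocycle_2[OF \<eta>(1)]) blast+
  have pullback: "cohomology_pullback (nerve m V) 2 \<rho> (cohomology_class (nerve n U) 2 \<eta>) =
      cohomology_class (nerve m V) 2 (cochain_pullback (nerve m V) 2 \<rho> \<eta>)"
    by (rule cohomology_pullback_class_2) (rule \<rho>)
  show ?thesis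
    unfolding \<eta>(2) pullback c1_cohomology_class[OF \<phi> U \<eta>(1)]
      c1_cohomology_class[OF \<psi> V \<eta>']
    by (intro homotopy_class_cong homotopic_f_eta_refinement[OF \<phi> U \<eta>(1) \<psi> V _ \<eta>'] \<rho>)
qed

section \<open>Injectivity on cohomology classes\<close>

lemma inj_on_w1:
  assumes \<phi>: "partition_dominated_by X n U \<phi>" and U: "open_cover X n U"
    and conn: "\<And>r. r \<le> n \<Longrightarrow> connectedin X (U r)"
  shows "inj_on (w1 X n U \<phi>) (carrier (cohomology (nerve n U) 1))"
proof (rule inj_onI)
  fix c c' assume "c \<in> carrier (cohomology (nerve n U) 1)" "c' \<in> carrier (cohomology (nerve n U) 1)"
    and eq: "w1 X n U \<phi> c = w1 X n U \<phi> c'"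
  then obtain \<tau> \<tau>' where \<tau>: "\<tau> \<in> cocycles (nerve n U) 1" "c = cohomology_class (nerve n U) 1 \<tau>"
    and \<tau>': "\<tau>' \<in> cocycles (nerve n U) 1" "c' = cohomology_class (nerve n U) 1 \<tau>'"
    by (auto simp: carrier_cohomology)
  have "homotopic_with (\<lambda>_. True) X RP_inf (f_tau n U \<phi> \<tau>) (f_tau n U \<phi> \<tau>')"
    using eq unfolding \<tau>(2) \<tau>'(2) w1_cohomology_class[OF \<phi> U \<tau>(1)] w1_cohomology_class[OF \<phi> U \<tau>'(1)]
    by (rule homotopy_class_eqD[OF _ continuous_map_proj_space_inf[OF continuous_f_tau[OF \<phi> U \<tau>'(1)]]])
  from homotopic_f_tau_imp_cohomologous[OF \<phi> U \<tau>(1) \<tau>'(1) conn this]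
  show "c = c'" unfolding \<tau>(2) \<tau>'(2) One_nat_def by (rule cohomology_class_eqI)
qed

lemma inj_on_c1:
  assumes \<phi>: "partition_dominated_by X n U \<phi>" and U: "open_cover X n U"
    and lpc: "\<And>r. r \<le> n \<Longrightarrow> locally_path_connected_space (subtopology X (U r))"
    and sc: "\<And>r. r \<le> n \<Longrightarrow> simply_connected_space (subtopology X (U r))"
    and conn: "\<And>r t. r \<le> n \<Longrightarrow> t \<le> n \<Longrightarrow> U r \<inter> U t = {} \<or> connectedin X (U r \<inter> U t)"
  shows "inj_on (c1 X n U \<phi>) (carrier (cohomology (nerve n U) 2))"
proof (rule inj_onI)
  fix c c' assume "c \<in> carrier (cohomology (nerve n U) 2)" "c' \<in> carrier (cohomology (nerve n U) 2)"
    and eq: "c1 X n U \<phi> c = c1 X n U \<phi> c'"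
  then obtain \<eta> \<eta>' where \<eta>: "\<eta> \<in> cocycles (nerve n U) 2" "c = cohomology_class (nerve n U) 2 \<eta>"
    and \<eta>': "\<eta>' \<in> cocycles (nerve n U) 2" "c' = cohomology_class (nerve n U) 2 \<eta>'"
    by (auto simp: carrier_cohomology)
  have "homotopic_with (\<lambda>_. True) X CP_inf (f_eta n U \<phi> \<eta>) (f_eta n U \<phi> \<eta>')"
    using eq unfolding \<eta>(2) \<eta>'(2) c1_cohomology_class[OF \<phi> U \<eta>(1)] c1_cohomology_class[OF \<phi> U \<eta>'(1)]
    by (rule homotopy_class_eqD[OF _ continuous_map_proj_space_inf[OF continuous_f_eta[OF \<phi> U \<eta>'(1)]]])
  from homotopic_f_eta_imp_cohomologous[OF \<phi> U \<eta>(1) \<eta>'(1) lpc sc conn this]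
  show "c = c'" unfolding \<eta>(2) \<eta>'(2) numeral_2_eq_2 by (rule cohomology_class_eqI)
qed

theorem theorem4p11:
  fixes X :: "'a topology" and n :: nat and U :: "nat \<Rightarrow> 'a set" and \<phi> :: "nat \<Rightarrow> 'a \<Rightarrow> real"
  assumes "paracompact_space X" and "Hausdorff_space X"
    and "open_cover X n U" and "partition_dominated_by X n U \<phi>"
  shows
   "\<comment> \<open>the maps are well-defined\<close>
    (\<forall>\<tau> \<in> cocycles (nerve n U) 1.
       (\<forall>j\<le>n. \<forall>b\<in>U j. f_tau n U \<phi> \<tau> b = f_tau_on n \<phi> \<tau> j b) \<and>
       continuous_map X (RP n) (f_tau n U \<phi> \<tau>)) \<and>
    (\<forall>\<eta> \<in> cocycles (nerve n U) 2.
       (\<forall>j\<le>n. \<forall>b\<in>U j. f_eta n U \<phi> \<eta> b = f_eta_on n \<phi> \<eta> j b) \<and>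
       continuous_map X (CP n) (f_eta n U \<phi> \<eta>)) \<and>
    \<comment> \<open>the assignments are functions on cohomology\<close>
    w1 X n U \<phi> \<in> carrier (cohomology (nerve n U) 1) \<rightarrow> homotopy_classes X RP_inf \<and>
    (\<forall>\<tau> \<in> cocycles (nerve n U) 1.
       w1 X n U \<phi> (cohomology_class (nerve n U) 1 \<tau>) = homotopy_class X RP_inf (f_tau n U \<phi> \<tau>)) \<and>
    c1 X n U \<phi> \<in> carrier (cohomology (nerve n U) 2) \<rightarrow> homotopy_classes X CP_inf \<and>
    (\<forall>\<eta> \<in> cocycles (nerve n U) 2.
       c1 X n U \<phi> (cohomology_class (nerve n U) 2 \<eta>) = homotopy_class X CP_inf (f_eta n U \<phi> \<eta>)) \<and>
    \<comment> \<open>naturality with respect to refinements\<close>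
    (\<forall>m V \<psi> \<rho>. open_cover X m V \<and> partition_dominated_by X m V \<psi> \<and>
         (\<forall>i\<le>m. \<rho> i \<le> n \<and> V i \<subseteq> U (\<rho> i)) \<longrightarrow>
       (\<forall>c \<in> carrier (cohomology (nerve n U) 1).
          w1 X m V \<psi> (cohomology_pullback (nerve m V) 1 \<rho> c) = w1 X n U \<phi> c) \<and>
       (\<forall>c \<in> carrier (cohomology (nerve n U) 2).
          c1 X m V \<psi> (cohomology_pullback (nerve m V) 2 \<rho> c) = c1 X n U \<phi> c)) \<and>
    \<comment> \<open>injectivity\<close>
    ((\<forall>r\<le>n. connectedin X (U r)) \<longrightarrow>
       inj_on (w1 X n U \<phi>) (carrier (cohomology (nerve n U) 1))) \<and>
    ((\<forall>r\<le>n. connectedin X (U r)) \<and>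
     (\<forall>r\<le>n. locally_path_connected_space (subtopology X (U r)) \<and>
             simply_connected_space (subtopology X (U r))) \<and>
     (\<forall>r\<le>n. \<forall>t\<le>n. U r \<inter> U t = {} \<or> connectedin X (U r \<inter> U t)) \<longrightarrow>
       inj_on (c1 X n U \<phi>) (carrier (cohomology (nerve n U) 2)))"
proof (intro conjI)
  note U = assms(3) and \<phi> = assms(4)
  show "\<forall>\<tau> \<in> cocycles (nerve n U) 1.
       (\<forall>j\<le>n. \<forall>b\<in>U j. f_tau n U \<phi> \<tau> b = f_tau_on n \<phi> \<tau> j b) \<and>
       continuous_map X (RP n) (f_tau n U \<phi> \<tau>)"
    using f_tau_eq[OF \<phi> U] continuous_f_tau[OF \<phi> U] by blast
  show "\<forall>\<eta> \<in> cocycles (nerve n U) 2.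
       (\<forall>j\<le>n. \<forall>b\<in>U j. f_eta n U \<phi> \<eta> b = f_eta_on n \<phi> \<eta> j b) \<and>
       continuous_map X (CP n) (f_eta n U \<phi> \<eta>)"
    using f_eta_eq[OF \<phi> U] continuous_f_eta[OF \<phi> U] by blast
  show "w1 X n U \<phi> \<in> carrier (cohomology (nerve n U) 1) \<rightarrow> homotopy_classes X RP_inf"
    by (auto simp: carrier_cohomology w1_cohomology_class[OF \<phi> U, unfolded One_nat_def]
        intro!: homotopy_class_in_classes continuous_map_proj_space_inf[OF continuous_f_tau[OF \<phi> U]])
  show "\<forall>\<tau> \<in> cocycles (nerve n U) 1.
       w1 X n U \<phi> (cohomology_class (nerve n U) 1 \<tau>) = homotopy_class X RP_inf (f_tau n U \<phi> \<tau>)"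
    using w1_cohomology_class[OF \<phi> U] by blast
  show "c1 X n U \<phi> \<in> carrier (cohomology (nerve n U) 2) \<rightarrow> homotopy_classes X CP_inf"
    by (auto simp: carrier_cohomology c1_cohomology_class[OF \<phi> U]
        intro!: homotopy_class_in_classes continuous_map_proj_space_inf[OF continuous_f_eta[OF \<phi> U]])
  show "\<forall>\<eta> \<in> cocycles (nerve n U) 2.
       c1 X n U \<phi> (cohomology_class (nerve n U) 2 \<eta>) = homotopy_class X CP_inf (f_eta n U \<phi> \<eta>)"
    using c1_cohomology_class[OF \<phi> U] by blast
  show "\<forall>m V \<psi> \<rho>. open_cover X m V \<and> partition_dominated_by X m V \<psi> \<and>
         (\<forall>i\<le>m. \<rho> i \<le> n \<and> V i \<subseteq> U (\<rho> i)) \<longrightarrow>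
       (\<forall>c \<in> carrier (cohomology (nerve n U) 1).
          w1 X m V \<psi> (cohomology_pullback (nerve m V) 1 \<rho> c) = w1 X n U \<phi> c) \<and>
       (\<forall>c \<in> carrier (cohomology (nerve n U) 2).
          c1 X m V \<psi> (cohomology_pullback (nerve m V) 2 \<rho> c) = c1 X n U \<phi> c)"
  proof (intro allI impI)
    fix m V \<psi> \<rho>
    assume "open_cover X m V \<and> partition_dominated_by X m V \<psi> \<and> (\<forall>i\<le>m. \<rho> i \<le> n \<and> V i \<subseteq> U (\<rho> i))"
    then have V: "open_cover X m V" and \<psi>: "partition_dominated_by X m V \<psi>"
      and \<rho>: "\<And>i. i \<le> m \<Longrightarrow> \<rho> i \<le> n \<and> V i \<subseteq> U (\<rho> i)" by auto
    show "(\<forall>c \<in> carrier (cohomology (nerve n U) 1).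
          w1 X m V \<psi> (cohomology_pullback (nerve m V) 1 \<rho> c) = w1 X n U \<phi> c) \<and>
       (\<forall>c \<in> carrier (cohomology (nerve n U) 2).
          c1 X m V \<psi> (cohomology_pullback (nerve m V) 2 \<rho> c) = c1 X n U \<phi> c)"
      by (intro conjI ballI w1_natural[OF \<phi> U \<psi> V \<rho>] c1_natural[OF \<phi> U \<psi> V \<rho>])
  qed
  show "(\<forall>r\<le>n. connectedin X (U r)) \<longrightarrow>
       inj_on (w1 X n U \<phi>) (carrier (cohomology (nerve n U) 1))"
    using inj_on_w1[OF \<phi> U] by blast
  show "(\<forall>r\<le>n. connectedin X (U r)) \<and>
     (\<forall>r\<le>n. locally_path_connected_space (subtopology X (U r)) \<and>
             simply_connected_space (subtopology X (U r))) \<and>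
     (\<forall>r\<le>n. \<forall>t\<le>n. U r \<inter> U t = {} \<or> connectedin X (U r \<inter> U t)) \<longrightarrow>
       inj_on (c1 X n U \<phi>) (carrier (cohomology (nerve n U) 2))"
    by (intro impI inj_on_c1[OF \<phi> U]) blast+
qed

end
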